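(* For every $\varepsilon>0$ there exists $C=C(m,k,\varepsilon)>0$ such that for every $\alpha>\max\{0,(Q-4)/2\}$, every $R>0$, and every $u\in S^{2,2}_0(B_R\setminus\{0\})$ with $\operatorname{supp}u\subset B_R\setminus\{0\}$, one has $$\alpha^2\int_{B_R}\rho^{-2\alpha-4+\varepsilon}\,u^2\,\psi\;+\;\int_{B_R}\rho^{-2\alpha-2+\varepsilon}\,|Xu|^2\;\le\; C R^{\varepsilon}\int_{B_R}\rho^{-2\alpha}\,(\mathscr{B}_\gamma u)^2\,\psi^{-1}.$$
   Context: Let $m,k\ge 1$ be integers, $\gamma>0$, $N=m+k$, and write points of $\mathbb{R}^N$ as $(z,t)$ with $z\in\mathbb{R}^m$, $t\in\mathbb{R}^k$. Integrals are with respect to Lebesgue measure $dz\,dt$. Vector fields: $X_i=\partial_{z_i}$ for $i=1,\dots,m$, and $X_{m+j}=|z|^\gamma\partial_{t_j}$ for $j=1,\dots,k$. The Baouendi-Grushin operator is $\mathscr{B}_\gamma u=\sum_{i=1}^N X_i^2u=\Delta_z u+|z|^{2\gamma}\Delta_t u$. Also $Xu=(X_1u,\dots,X_Nu)$ and $|Xu|^2=\sum_{i=1}^N (X_iu)^2$. Homogeneous dimension: $Q=m+(\gamma+1)k$. Pseudo-gauge: $\rho(z,t)=\left(|z|^{2(\gamma+1)}+(\gamma+1)^2|t|^2\right)^{\frac{1}{2(\gamma+1)}}$; $B_r=\{(z,t)\in\mathbb{R}^N:\rho(z,t)<r\}$. Angle function: $\psi=|X\rho|^2=|z|^{2\gamma}/\rho^{2\gamma}$,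 so $0\le\psi\le1$. For an open set $\Omega\subset\mathbb{R}^N$, $S^{2,2}_0(\Omega)$ is the completion of $C_0^\infty(\Omega)$ with respect to the norm $\left(\int_\Omega f^2+|Xf|^2+\sum_{i,j=1}^N|X_iX_jf|^2\right)^{1/2}$. The right-hand side of the inequality is allowed to be $+\infty$. *)

theory Defs
  imports "HOL-Analysis.Analysis"
begin

type_synonym ('m, 'k) point = "(real^'m) \<times> (real^'k)"

definition partial_deriv :: "'a::real_normed_vector \<Rightarrow> ('a \<Rightarrow> real) \<Rightarrow> 'a \<Rightarrow> real" where
  "partial_deriv v f p = deriv (\<lambda>s. f (p + s *\<^sub>R v)) 0"

(* The N = m + k vector fields are indexed by the sum type: Inl i is X_i (i <= m),
   Inr j is X_(m+j).  Second derivatives X_i X_j f are taken classically.  Since |z|^gamma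
   need not be differentiable at z = 0, they may have no meaning on {z = 0}, which is a null
   set; there deriv returns an irrelevant default value. *)
definition grushin_X ::
  "real \<Rightarrow> 'm + 'k \<Rightarrow> (('m::finite, 'k::finite) point \<Rightarrow> real) \<Rightarrow> ('m, 'k) point \<Rightarrow> real" where
  "grushin_X \<gamma> i f p =
     (case i of
        Inl a \<Rightarrow> partial_deriv (axis a 1, 0) f p
      | Inr b \<Rightarrow> norm (fst p) powr \<gamma> * partial_deriv (0, axis b 1) f p)"

definition hom_dim :: "nat \<Rightarrow> nat \<Rightarrow> real \<Rightarrow> real" where
  "hom_dim m k \<gamma> = real m + (\<gamma> + 1) * real k"

definition rho :: "real \<Rightarrow> ('m::finite, 'k::finite) point \<Rightarrow> real" where
  "rho \<gamma> p = (norm (fst p) powr (2 * (\<gamma> + 1)) + (\<gamma> + 1)\<^sup>2 * (norm (snd p))\<^sup>2)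
                powr (1 / (2 * (\<gamma> + 1)))"

definition gauge_ball :: "real \<Rightarrow> real \<Rightarrow> ('m::finite, 'k::finite) point set" where
  "gauge_ball \<gamma> r = {p. rho \<gamma> p < r}"

definition sq_length :: "('i::finite \<Rightarrow> 'a \<Rightarrow> real) \<Rightarrow> 'a \<Rightarrow> real" where
  "sq_length V p = (\<Sum>i\<in>UNIV. (V i p)\<^sup>2)"

definition psi :: "real \<Rightarrow> ('m::finite, 'k::finite) point \<Rightarrow> real" where
  "psi \<gamma> = sq_length (\<lambda>i. grushin_X \<gamma> i (rho \<gamma>))"

lemma has_deriv_norm_powr:
  fixes z e :: "'a::real_inner"
  assumes b: "b > 1"
  shows "((\<lambda>s. norm (z + s *\<^sub>R e) powr b) has_real_derivative
           b * norm z powr (b - 2) * (z \<bullet> e)) (at 0)"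
proof (cases "z = 0")
  case True
  have "(\<lambda>h. (\<bar>h\<bar> powr b) / h) \<midarrow>0\<rightarrow> (0::real)"
  proof (rule Lim_null_comparison)
    show "\<forall>\<^sub>F h in at 0. norm ((\<bar>h\<bar> powr b) / h) \<le> \<bar>h\<bar> powr (b - 1)"
      by (auto simp: eventually_at_filter powr_diff)
    show "((\<lambda>h. \<bar>h\<bar> powr (b - 1)) \<longlongrightarrow> 0) (at (0::real))"
      using b by (intro tendsto_zero_powrI[where b = "b - 1"] tendsto_eq_intros) auto
  qed
  from tendsto_mult_left[OF this, of "norm e powr b"]
  have "((\<lambda>s. norm (s *\<^sub>R e) powr b) has_real_derivative 0) (at 0)"
    using b by (simp add: DERIV_def powr_mult mult.commute)
  then show ?thesis using True by simp
next
  case False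
  then have pos: "0 < z \<bullet> z" by simp
  have eq: "norm x powr b = (x \<bullet> x) powr (b / 2)" for x :: 'a
    by (simp add: norm_eq_sqrt_inner powr_half_sqrt[symmetric] powr_powr)
  have "((\<lambda>s. ((z + s *\<^sub>R e) \<bullet> (z + s *\<^sub>R e)) powr (b / 2)) has_real_derivative
           b / 2 * (z \<bullet> z) powr (b / 2 - 1) * (2 * (z \<bullet> e))) (at 0)"
  proof (rule DERIV_cong[OF DERIV_powr])
    show "((\<lambda>s. (z + s *\<^sub>R e) \<bullet> (z + s *\<^sub>R e)) has_real_derivative 2 * (z \<bullet> e)) (at 0)"
      by (auto simp: inner_add_left inner_add_right inner_commute power2_eq_square
               intro!: derivative_eq_intros)
  qed (use pos in \<open>auto intro!: derivative_eq_intros simp: powr_diff\<close>)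
  moreover have "norm z powr (b - 2) = (z \<bullet> z) powr (b / 2 - 1)"
    by (simp add: norm_eq_sqrt_inner powr_half_sqrt[symmetric] powr_powr diff_divide_distrib)
  ultimately show ?thesis by (simp add: eq mult.assoc)
qed

lemma psi_eq:
  fixes p :: "('m::finite, 'k::finite) point"
  assumes g: "\<gamma> > 0" and p: "p \<noteq> 0"
  shows "psi \<gamma> p = norm (fst p) powr (2 * \<gamma>) / rho \<gamma> p powr (2 * \<gamma>)"
proof -
  obtain z t where zt: "p = (z, t)" by (cases p)
  define c where "c = \<gamma> + 1"
  have c: "c > 1" using g c_def by simp
  define T where "T = norm z powr (2 * c) + c\<^sup>2 * (norm t)\<^sup>2"
  have T: "T > 0"
  proof (cases "z = 0")
    case True
    with p zt have "t \<noteq> 0" by (auto simp: zero_prod_def)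
    with c show ?thesis by (simp add: T_def add_nonneg_pos)
  next
    case False
    then show ?thesis by (simp add: T_def add_pos_nonneg)
  qed
  define d where "d = 1 / (2 * c) * T powr (1 / (2 * c) - 1)"
  have D: "((\<lambda>s. F s powr (1 / (2 * c))) has_real_derivative d * F') (at 0)"
    if "(F has_real_derivative F') (at 0)" "F 0 = T" for F :: "real \<Rightarrow> real" and F'
    by (rule DERIV_cong[OF DERIV_fun_powr[OF that(1)]]) (use that T in \<open>auto simp: d_def\<close>)
  have 1: "grushin_X \<gamma> (Inl a) (rho \<gamma>) p = d * (2 * c * norm z powr (2 * c - 2) * z $ a)" for a
  proof -
    have "((\<lambda>s. norm (z + s *\<^sub>R axis a 1) powr (2 * c) + c\<^sup>2 * (norm t)\<^sup>2) has_real_derivative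
           2 * c * norm z powr (2 * c - 2) * (z \<bullet> axis a 1)) (at 0)"
      using c by (intro DERIV_cong[OF DERIV_add[OF has_deriv_norm_powr DERIV_const]]) auto
    from DERIV_imp_deriv[OF D[OF this]] show ?thesis
      by (simp add: T_def grushin_X_def partial_deriv_def rho_def zt c_def inner_axis)
  qed
  have 2: "grushin_X \<gamma> (Inr b) (rho \<gamma>) p = norm z powr \<gamma> * (d * (c\<^sup>2 * (2 * t $ b)))" for b
  proof -
    have "((\<lambda>s. norm z powr (2 * c) + c\<^sup>2 * ((t + s *\<^sub>R axis b 1) \<bullet> (t + s *\<^sub>R axis b 1)))
           has_real_derivative c\<^sup>2 * (2 * (t \<bullet> axis b 1))) (at 0)"
      by (auto simp: inner_add_left inner_add_right inner_commute power2_eq_square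
               intro!: derivative_eq_intros)
    from DERIV_imp_deriv[OF D[OF this]] show ?thesis
      by (simp add: T_def grushin_X_def partial_deriv_def rho_def zt c_def inner_axis
                    power2_norm_eq_inner)
  qed
  have n: "(\<Sum>i\<in>UNIV. (x $ i)\<^sup>2) = (norm x)\<^sup>2" for x :: "real^'n::finite"
    by (simp only: power2_norm_eq_inner) (simp add: inner_vec_def power2_eq_square)
  have pp: "(x powr y)\<^sup>2 = x powr (2 * y)" for x y :: real
    by (simp add: power2_eq_square powr_add[symmetric])
  have zz: "norm z powr (2 * (2 * c - 2)) * (norm z)\<^sup>2 = norm z powr (2 * \<gamma>) * norm z powr (2 * c)"
  proof (cases "z = 0")
    case False
    then have sq: "(norm z)\<^sup>2 = norm z powr 2" by simp
    have e: "2 * (2 * c - 2) + 2 = 2 * \<gamma> + 2 * c" by (simp add: c_def)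
    show ?thesis unfolding sq powr_add[symmetric] e ..
  qed (use g in auto)
  have "psi \<gamma> p = (\<Sum>a\<in>UNIV. (grushin_X \<gamma> (Inl a) (rho \<gamma>) p)\<^sup>2)
                + (\<Sum>b\<in>UNIV. (grushin_X \<gamma> (Inr b) (rho \<gamma>) p)\<^sup>2)"
    using sum.Plus[of "UNIV :: 'm set" "UNIV :: 'k set" "\<lambda>i. (grushin_X \<gamma> i (rho \<gamma>) p)\<^sup>2"]
    by (simp add: psi_def sq_length_def)
  also have "(\<Sum>a\<in>UNIV. (grushin_X \<gamma> (Inl a) (rho \<gamma>) p)\<^sup>2)
      = d\<^sup>2 * (4 * c\<^sup>2) * (norm z powr (2 * (2 * c - 2)) * (norm z)\<^sup>2)"
    by (simp only: 1 power_mult_distrib pp sum_distrib_left[symmetric] n) simp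
  also have "(\<Sum>b\<in>UNIV. (grushin_X \<gamma> (Inr b) (rho \<gamma>) p)\<^sup>2)
      = d\<^sup>2 * (4 * c\<^sup>2) * (norm z powr (2 * \<gamma>) * (c\<^sup>2 * (norm t)\<^sup>2))"
    by (simp only: 2 power_mult_distrib pp sum_distrib_left[symmetric] n)
       (simp add: power2_eq_square)
  also have "d\<^sup>2 * (4 * c\<^sup>2) * (norm z powr (2 * (2 * c - 2)) * (norm z)\<^sup>2)
      + d\<^sup>2 * (4 * c\<^sup>2) * (norm z powr (2 * \<gamma>) * (c\<^sup>2 * (norm t)\<^sup>2))
      = norm z powr (2 * \<gamma>) * ((2 * c * d)\<^sup>2 * T)"
    unfolding zz T_def by (simp add: algebra_simps power_mult_distrib)
  also have "(2 * c * d)\<^sup>2 * T = T powr (2 * (1 / (2 * c) - 1)) * T powr 1"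
    using c T by (simp add: d_def pp)
  also have "\<dots> = T powr (1 / c - 1)"
    by (simp only: powr_add[symmetric]) (simp add: algebra_simps)
  also have "\<dots> = 1 / rho \<gamma> p powr (2 * \<gamma>)"
  proof -
    have "rho \<gamma> p = T powr (1 / (2 * c))"
      by (simp add: rho_def T_def zt c_def)
    moreover have "1 / (2 * c) * (2 * \<gamma>) = - (1 / c - 1)"
      using c by (simp add: c_def field_simps)
    ultimately have "rho \<gamma> p powr (2 * \<gamma>) = T powr (- (1 / c - 1))"
      by (simp only: powr_powr)
    then show ?thesis by (simp only: powr_minus) (simp add: divide_inverse)
  qed
  finally show ?thesis by (simp add: zt)
qed

definition smooth :: "('a::euclidean_space \<Rightarrow> real) \<Rightarrow> bool" where
  "smooth f \<longleftrightarrow>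
     (\<forall>vs. set vs \<subseteq> Basis \<longrightarrow> (\<forall>p. foldr partial_deriv vs f differentiable (at p)))"

definition test_functions :: "'a::euclidean_space set \<Rightarrow> ('a \<Rightarrow> real) set" where
  "test_functions \<Omega> =
     {f. smooth f \<and> compact (closure {p. f p \<noteq> 0}) \<and> closure {p. f p \<noteq> 0} \<subseteq> \<Omega>}"

definition L2_on :: "'a::euclidean_space set \<Rightarrow> ('a \<Rightarrow> real) set" where
  "L2_on \<Omega> = {f. set_borel_measurable lebesgue \<Omega> f \<and>
                   (\<integral>\<^sup>+ p \<in> \<Omega>. ennreal ((f p)\<^sup>2) \<partial>lebesgue) < \<infinity>}"

(* The square of the norm of the statement, for the function u, its first derivatives
   V i = X_i u and its second derivatives W i j = X_i X_j u. *)
definition S22_norm_sq ::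
  "'a::euclidean_space set \<Rightarrow> ('a \<Rightarrow> real) \<Rightarrow> ('i::finite \<Rightarrow> 'a \<Rightarrow> real)
     \<Rightarrow> ('i \<Rightarrow> 'i \<Rightarrow> 'a \<Rightarrow> real) \<Rightarrow> ennreal" where
  "S22_norm_sq \<Omega> u V W =
     (\<integral>\<^sup>+ p \<in> \<Omega>. ennreal ((u p)\<^sup>2 + sq_length V p + (\<Sum>i\<in>UNIV. \<Sum>j\<in>UNIV. (W i j p)\<^sup>2))
        \<partial>lebesgue)"

(* The completion, realised isometrically as the closure of the graph
   {(f, (X_i f), (X_i X_j f)) | f test function} in a product of L^2 spaces.
   S22_0 gamma Omega u V W says that u is an element of the completion whose derivatives,
   in the sense of the continuous extension of X_i and X_i X_j, are V i and W i j.
   All functions are representatives of classes modulo null sets of Omega; values outside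
   Omega are irrelevant.  For m = 1 and gamma <= 1/2 some test functions have infinite norm;
   they are excluded automatically, since they have infinite distance from L^2 data. *)
definition S22_0 ::
  "real \<Rightarrow> ('m::finite, 'k::finite) point set \<Rightarrow> (('m, 'k) point \<Rightarrow> real)
     \<Rightarrow> ('m + 'k \<Rightarrow> ('m, 'k) point \<Rightarrow> real)
     \<Rightarrow> ('m + 'k \<Rightarrow> 'm + 'k \<Rightarrow> ('m, 'k) point \<Rightarrow> real) \<Rightarrow> bool" where
  "S22_0 \<gamma> \<Omega> u V W \<longleftrightarrow>
     u \<in> L2_on \<Omega> \<and> (\<forall>i. V i \<in> L2_on \<Omega>) \<and> (\<forall>i j. W i j \<in> L2_on \<Omega>) \<and>
     (\<exists>f. (\<forall>n. f n \<in> test_functions \<Omega>) \<and>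
          (\<lambda>n. S22_norm_sq \<Omega>
                  (\<lambda>p. f n p - u p)
                  (\<lambda>i p. grushin_X \<gamma> i (f n) p - V i p)
                  (\<lambda>i j p. grushin_X \<gamma> i (grushin_X \<gamma> j (f n)) p - W i j p))
            \<longlonglongrightarrow> (0::ennreal))"

(* The Baouendi-Grushin operator, as a function of the second derivatives W i j = X_i X_j u. *)
definition grushin_op :: "('i::finite \<Rightarrow> 'i \<Rightarrow> 'a \<Rightarrow> real) \<Rightarrow> 'a \<Rightarrow> real" where
  "grushin_op W p = (\<Sum>i\<in>UNIV. W i i p)"

(* Support, closed in the whole space, of the class of u on Omega extended by 0. *)
definition ess_support :: "'a::euclidean_space set \<Rightarrow> ('a \<Rightarrow> real) \<Rightarrow> 'a set" where
  "ess_support \<Omega> u =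
     {p. \<forall>U. open U \<and> p \<in> U \<longrightarrow> \<not> (AE q in lebesgue. q \<in> U \<inter> \<Omega> \<longrightarrow> u q = 0)}"

end

theory Submission
  imports Defs
begin

text \<open>
  Write \<open>T\<^sub>s g = e\<^bsup>Q s / 2\<^esup> g \<circ> \<delta>\<^sub>s\<close> for the unitary group on \<open>L\<^sup>2\<close> of the anisotropic
  dilations \<open>\<delta>\<^sub>s (z, t) = (e\<^sup>s z, e\<^bsup>(\<gamma> + 1) s\<^esup> t)\<close>, and put
  \<open>w = \<rho>\<^bsup>- \<alpha> - 2\<^esup> \<psi>\<^bsup>1/2\<^esup> u\<close>, \<open>G = \<rho>\<^bsup>- \<alpha>\<^esup> \<psi>\<^bsup>- 1/2\<^esup> B u\<close>,
  \<open>\<xi>\<^sub>i = \<rho>\<^bsup>- \<alpha> - 1\<^esup> X\<^sub>i u\<close>. Testing \<open>B u\<close> against \<open>\<rho>\<^bsup>- 2 \<alpha> - 2\<^esup> u \<circ> \<delta>\<^sub>s\<close> gives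
  \<open>\<langle>G, T\<^sub>s w\<rangle> = (2 \<alpha> + 2) \<langle>q, T\<^sub>s w\<rangle> - (\<Sum>i. \<langle>\<xi>\<^sub>i, T\<^sub>s \<xi>\<^sub>i\<rangle>)\<close>, where
  \<open>q = \<psi>\<^bsup>- 1/2\<^esup> (\<Sum>i. (X\<^sub>i \<rho>) \<xi>\<^sub>i)\<close>; with \<open>b = \<alpha> + 2 - Q / 2\<close>, the generator of \<open>T\<close> maps \<open>w\<close> to
  \<open>q - b w\<close>, and \<open>\<langle>w, T\<^sub>s w\<rangle>\<close> is even in \<open>s\<close>. The last sum is even too, so the odd part of the identity expresses the
  derivative of \<open>\<parallel>T\<^sub>s w - w\<parallel>\<^sup>2\<close> through \<open>\<langle>G, T\<^sub>s w - T\<^bsub>-s\<^esub> w\<rangle> / (\<alpha> + 1)\<close>, and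
  \<open>\<parallel>T\<^sub>s w - w\<parallel> \<le> s \<parallel>G\<parallel> / (\<alpha> + 1)\<close> follows. As \<open>\<rho>\<close> is homogeneous,
  \<open>\<parallel>\<rho>\<^bsup>\<epsilon>/2\<^esup> T\<^sub>s w\<parallel> = e\<^bsup>- \<epsilon> s / 2\<^esup> \<parallel>\<rho>\<^bsup>\<epsilon>/2\<^esup> w\<parallel>\<close>, so the single value
  \<open>s = 2 / \<epsilon>\<close> bounds \<open>\<rho>\<^bsup>\<epsilon>/2\<^esup> w\<close>; testing \<open>B u\<close> against
  \<open>\<rho>\<^bsup>- 2 \<alpha> - 2 + \<epsilon>\<^esup> u\<close> then bounds the gradient. Working with differences \<open>T\<^sub>s w - w\<close>
  instead of the radial derivative of \<open>w\<close> keeps every step meaningful for an \<open>L\<^sup>2\<close> limit of test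
  functions.
\<close>

section \<open>Square integrable functions\<close>

definition sq_integrable :: "'a measure \<Rightarrow> ('a \<Rightarrow> real) \<Rightarrow> bool" where
  "sq_integrable M f \<longleftrightarrow> f \<in> borel_measurable M \<and> integrable M (\<lambda>x. (f x)\<^sup>2)"

text \<open>The Bochner integral defaults to 0 when the square is not integrable, so
  \<open>l2norm\<close> carries information only together with \<open>sq_integrable\<close>. Using
  concrete functions instead of classes lets a dilation act as plain composition.\<close>

definition l2norm :: "'a measure \<Rightarrow> ('a \<Rightarrow> real) \<Rightarrow> real" where
  "l2norm M f = sqrt (\<integral>x. (f x)\<^sup>2 \<partial>M)"

lemma sq_integrable_measurable[measurable_dest]: "sq_integrable M f \<Longrightarrow> f \<in> borel_measurable M"
  by (simp add: sq_integrable_def)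

lemma sq_integrableD: "sq_integrable M f \<Longrightarrow> integrable M (\<lambda>x. (f x)\<^sup>2)"
  by (simp add: sq_integrable_def)

lemma l2norm_nonneg[simp]: "0 \<le> l2norm M f"
  by (simp add: l2norm_def)

lemma l2norm_power2: "(l2norm M f)\<^sup>2 = (\<integral>x. (f x)\<^sup>2 \<partial>M)"
  by (simp add: l2norm_def)

lemma sq_integrable_mult_integrable:
  assumes f: "sq_integrable M f" and g: "sq_integrable M g"
  shows "integrable M (\<lambda>x. f x * g x)"
proof (rule Bochner_Integration.integrable_bound)
  note [measurable] = f g
  show "integrable M (\<lambda>x. (f x)\<^sup>2 + (g x)\<^sup>2)"
    using f g by (simp add: sq_integrableD)
  show "(\<lambda>x. f x * g x) \<in> borel_measurable M" by measurable
  have "\<bar>f x * g x\<bar> \<le> (f x)\<^sup>2 + (g x)\<^sup>2" for x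
  proof -
    have "0 \<le> (\<bar>f x\<bar> - \<bar>g x\<bar>)\<^sup>2" by simp
    moreover have "0 \<le> \<bar>f x\<bar> * \<bar>g x\<bar>" by simp
    ultimately show ?thesis unfolding abs_mult power2_diff power2_abs by linarith
  qed
  then show "AE x in M. norm (f x * g x) \<le> norm ((f x)\<^sup>2 + (g x)\<^sup>2)" by auto
qed

lemma sq_integrable_bound:
  assumes f: "sq_integrable M f" and [measurable]: "g \<in> borel_measurable M"
    and le: "AE x in M. \<bar>g x\<bar> \<le> C * \<bar>f x\<bar>"
  shows "sq_integrable M g"
  unfolding sq_integrable_def
proof
  note [measurable] = f
  show "integrable M (\<lambda>x. (g x)\<^sup>2)"
  proof (rule Bochner_Integration.integrable_bound)
    show "integrable M (\<lambda>x. C\<^sup>2 * (f x)\<^sup>2)" using f by (simp add: sq_integrableD)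
    show "AE x in M. norm ((g x)\<^sup>2) \<le> norm (C\<^sup>2 * (f x)\<^sup>2)"
      using le
    proof eventually_elim
      case (elim x)
      from power_mono[OF elim abs_ge_zero, of 2] show ?case
        by (simp add: power_mult_distrib)
    qed
  qed simp
qed simp

lemma l2norm_le:
  assumes f: "sq_integrable M f" and C: "0 \<le> C"
    and le: "AE x in M. \<bar>g x\<bar> \<le> C * \<bar>f x\<bar>"
  shows "l2norm M g \<le> C * l2norm M f"
proof -
  have "(\<integral>x. (g x)\<^sup>2 \<partial>M) \<le> (\<integral>x. C\<^sup>2 * (f x)\<^sup>2 \<partial>M)"
  proof (rule integral_mono_AE')
    show "integrable M (\<lambda>x. C\<^sup>2 * (f x)\<^sup>2)" using f by (simp add: sq_integrableD)
    show "AE x in M. (g x)\<^sup>2 \<le> C\<^sup>2 * (f x)\<^sup>2"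
      using le
    proof eventually_elim
      case (elim x)
      from power_mono[OF elim abs_ge_zero, of 2] show ?case
        by (simp add: power_mult_distrib)
    qed
  qed auto
  also have "\<dots> = (C * l2norm M f)\<^sup>2"
    by (simp add: power_mult_distrib l2norm_power2)
  finally show ?thesis
    using C by (simp add: l2norm_def real_le_lsqrt mult_nonneg_nonneg)
qed

lemma sq_integrable_cmult: "sq_integrable M f \<Longrightarrow> sq_integrable M (\<lambda>x. c * f x)"
  by (rule sq_integrable_bound[where C = "\<bar>c\<bar>"]) (auto simp: abs_mult)

lemma l2norm_cmult: "l2norm M (\<lambda>x. c * f x) = \<bar>c\<bar> * l2norm M f"
  by (simp add: l2norm_def power_mult_distrib real_sqrt_mult)

lemma sq_integrable_add:
  assumes f: "sq_integrable M f" and g: "sq_integrable M g"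
  shows "sq_integrable M (\<lambda>x. f x + g x)"
  unfolding sq_integrable_def
proof
  note [measurable] = f g
  show "(\<lambda>x. f x + g x) \<in> borel_measurable M" by measurable
  show "integrable M (\<lambda>x. (f x + g x)\<^sup>2)"
    unfolding power2_sum mult.assoc using f g sq_integrable_mult_integrable[OF f g]
    by (simp add: sq_integrableD)
qed

lemma sq_integrable_diff:
  assumes f: "sq_integrable M f" and g: "sq_integrable M g"
  shows "sq_integrable M (\<lambda>x. f x - g x)"
  using sq_integrable_add[OF f sq_integrable_cmult[OF g, of "-1"]] by simp

lemma sq_integrable_zero[simp]: "sq_integrable M (\<lambda>x. 0)"
  by (simp add: sq_integrable_def)

lemma sq_integrable_sum:
  "(\<And>i. i \<in> I \<Longrightarrow> sq_integrable M (f i)) \<Longrightarrow> sq_integrable M (\<lambda>x. \<Sum>i\<in>I. f i x)"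
  by (induction I rule: infinite_finite_induct) (auto intro: sq_integrable_add)

lemma l2norm_add_power2:
  assumes f: "sq_integrable M f" and g: "sq_integrable M g"
  shows "(l2norm M (\<lambda>x. f x + g x))\<^sup>2 = (l2norm M f)\<^sup>2 + (l2norm M g)\<^sup>2 + 2 * (\<integral>x. f x * g x \<partial>M)"
  unfolding l2norm_power2 power2_sum mult.assoc
  using f g sq_integrable_mult_integrable[OF f g] by (simp add: sq_integrableD)

lemma l2norm_diff_power2:
  assumes f: "sq_integrable M f" and g: "sq_integrable M g"
  shows "(l2norm M (\<lambda>x. f x - g x))\<^sup>2 = (l2norm M f)\<^sup>2 + (l2norm M g)\<^sup>2 - 2 * (\<integral>x. f x * g x \<partial>M)"
  unfolding l2norm_power2 power2_diff mult.assoc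
  using f g sq_integrable_mult_integrable[OF f g] by (simp add: sq_integrableD)

text \<open>Nonnegativity of the squared norm of \<open>s f - t g\<close> is the quadratic
  inequality \<open>quad\<close> in \<open>s\<close> and \<open>t\<close>; two special choices of
  \<open>s\<close> and \<open>t\<close> give the claim.\<close>

lemma l2_Cauchy_Schwarz:
  assumes f: "sq_integrable M f" and g: "sq_integrable M g"
  shows "\<bar>\<integral>x. f x * g x \<partial>M\<bar> \<le> l2norm M f * l2norm M g"
proof -
  define A B c where "A = l2norm M f" and "B = l2norm M g" and "c = (\<integral>x. f x * g x \<partial>M)"
  have quad: "0 \<le> s\<^sup>2 * A\<^sup>2 + t\<^sup>2 * B\<^sup>2 - 2 * (s * t * c)" for s t
  proof -
    have "0 \<le> (l2norm M (\<lambda>x. s * f x - t * g x))\<^sup>2" by simp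
    also have "\<dots> = s\<^sup>2 * A\<^sup>2 + t\<^sup>2 * B\<^sup>2 - 2 * (\<integral>x. (s * f x) * (t * g x) \<partial>M)"
      by (simp add: l2norm_diff_power2 sq_integrable_cmult f g l2norm_cmult power_mult_distrib A_def B_def)
    also have "(\<integral>x. (s * f x) * (t * g x) \<partial>M) = (\<integral>x. (s * t) * (f x * g x) \<partial>M)"
      by (simp add: ac_simps)
    also have "\<dots> = s * t * c" by (simp add: c_def)
    finally show ?thesis .
  qed
  have "c\<^sup>2 \<le> A\<^sup>2 * B\<^sup>2"
  proof (cases "B = 0")
    case True
    have "c = 0"
    proof (rule ccontr)
      assume "c \<noteq> 0"
      \<comment> \<open>With \<open>B = 0\<close> and this value of \<open>t\<close> the quadratic
        form equals -1.\<close>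
      then show False using quad[of 1 "(A\<^sup>2 + 1) / (2 * c)"] True by simp
    qed
    then show ?thesis by simp
  next
    case False
    \<comment> \<open>At \<open>s = B\<^sup>2\<close>, \<open>t = c\<close> the form factors, and
      the positive factor \<open>B\<^sup>2\<close> can be divided out.\<close>
    from quad[of "B\<^sup>2" c] have "0 \<le> B\<^sup>2 * (A\<^sup>2 * B\<^sup>2 - c\<^sup>2)"
      by (simp add: algebra_simps power2_eq_square)
    with False show ?thesis by (simp add: zero_le_mult_iff)
  qed
  then have "\<bar>c\<bar>\<^sup>2 \<le> (A * B)\<^sup>2" by (simp add: power_mult_distrib)
  then show ?thesis unfolding c_def A_def B_def by (rule power2_le_imp_le) simp
qed

lemma l2norm_triangle:
  assumes f: "sq_integrable M f" and g: "sq_integrable M g"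
  shows "l2norm M (\<lambda>x. f x + g x) \<le> l2norm M f + l2norm M g"
proof (rule power2_le_imp_le)
  show "(l2norm M (\<lambda>x. f x + g x))\<^sup>2 \<le> (l2norm M f + l2norm M g)\<^sup>2"
    using l2_Cauchy_Schwarz[OF f g] by (simp add: l2norm_add_power2 f g power2_sum)
qed simp

lemma l2norm_triangle_diff:
  assumes f: "sq_integrable M f" and g: "sq_integrable M g"
  shows "l2norm M (\<lambda>x. f x - g x) \<le> l2norm M f + l2norm M g"
  using l2norm_triangle[OF f sq_integrable_cmult[OF g, of "-1"]]
  by (simp add: l2norm_cmult[of M "-1", simplified])

text \<open>The difference is split as \<open>(f' - f) g' + f (g' - g)\<close>. An explicit bound,
  rather than mere convergence, is what yields uniformity in the dilation parameter in
  \<open>pairing_dil_uniform\<close>.\<close>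

lemma l2_pairing_diff:
  assumes f: "sq_integrable M f" and g: "sq_integrable M g"
    and f': "sq_integrable M f'" and g': "sq_integrable M g'"
  shows "\<bar>(\<integral>x. f' x * g' x \<partial>M) - (\<integral>x. f x * g x \<partial>M)\<bar> \<le>
    l2norm M (\<lambda>x. f' x - f x) * (l2norm M g + l2norm M (\<lambda>x. g' x - g x))
      + l2norm M f * l2norm M (\<lambda>x. g' x - g x)"
proof -
  note df = sq_integrable_diff[OF f' f] and dg = sq_integrable_diff[OF g' g]
  have "(\<integral>x. f' x * g' x \<partial>M) - (\<integral>x. f x * g x \<partial>M)
    = (\<integral>x. (f' x - f x) * g' x + f x * (g' x - g x) \<partial>M)"
    by (simp add: sq_integrable_mult_integrable f g f' g' left_diff_distrib right_diff_distrib)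
  also have "\<dots> = (\<integral>x. (f' x - f x) * g' x \<partial>M) + (\<integral>x. f x * (g' x - g x) \<partial>M)"
    by (intro Bochner_Integration.integral_add sq_integrable_mult_integrable df dg f g')
  finally have "\<bar>(\<integral>x. f' x * g' x \<partial>M) - (\<integral>x. f x * g x \<partial>M)\<bar> \<le>
     l2norm M (\<lambda>x. f' x - f x) * l2norm M g' + l2norm M f * l2norm M (\<lambda>x. g' x - g x)"
    using l2_Cauchy_Schwarz[OF df g'] l2_Cauchy_Schwarz[OF f dg] by linarith
  moreover have "l2norm M g' \<le> l2norm M g + l2norm M (\<lambda>x. g' x - g x)"
    using l2norm_triangle[OF g dg] by simp
  ultimately show ?thesis
    by (smt (verit) l2norm_nonneg mult_left_mono)
qed

lemma l2_pairing_tendsto: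
  assumes f: "sq_integrable M f" and g: "sq_integrable M g"
    and F: "\<And>n. sq_integrable M (F n)" and G: "\<And>n. sq_integrable M (G n)"
    and Ff: "(\<lambda>n. l2norm M (\<lambda>x. F n x - f x)) \<longlonglongrightarrow> 0"
    and Gg: "(\<lambda>n. l2norm M (\<lambda>x. G n x - g x)) \<longlonglongrightarrow> 0"
  shows "(\<lambda>n. \<integral>x. F n x * G n x \<partial>M) \<longlonglongrightarrow> (\<integral>x. f x * g x \<partial>M)"
proof (rule LIM_zero_cancel, rule Lim_null_comparison)
  show "\<forall>\<^sub>F n in sequentially. norm ((\<integral>x. F n x * G n x \<partial>M) - (\<integral>x. f x * g x \<partial>M)) \<le>
      l2norm M (\<lambda>x. F n x - f x) * (l2norm M g + l2norm M (\<lambda>x. G n x - g x))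
      + l2norm M f * l2norm M (\<lambda>x. G n x - g x)"
    using l2_pairing_diff[OF f g F G] by simp
  show "(\<lambda>n. l2norm M (\<lambda>x. F n x - f x) * (l2norm M g + l2norm M (\<lambda>x. G n x - g x))
      + l2norm M f * l2norm M (\<lambda>x. G n x - g x)) \<longlonglongrightarrow> 0"
    by (rule tendsto_eq_rhs, (rule tendsto_intros Ff Gg)+) simp
qed

lemma l2norm_zero_limit:
  assumes "(\<lambda>n. l2norm M (H n)) \<longlonglongrightarrow> 0" and "0 \<le> C"
    and "\<And>n. sq_integrable M (H n)"
    and "\<And>n. AE x in M. \<bar>H' n x\<bar> \<le> C * \<bar>H n x\<bar>"
  shows "(\<lambda>n. l2norm M (H' n)) \<longlonglongrightarrow> 0"
proof (rule Lim_null_comparison)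
  show "\<forall>\<^sub>F n in sequentially. norm (l2norm M (H' n)) \<le> C * l2norm M (H n)"
    using l2norm_le[OF assms(3) assms(2) assms(4)] by simp
  show "(\<lambda>n. C * l2norm M (H n)) \<longlonglongrightarrow> 0"
    using tendsto_mult_left[OF assms(1), of C] by simp
qed

lemma l2norm_sum_le:
  assumes "\<And>i. i \<in> I \<Longrightarrow> sq_integrable M (f i)"
  shows "l2norm M (\<lambda>x. \<Sum>i\<in>I. f i x) \<le> (\<Sum>i\<in>I. l2norm M (f i))"
  using assms
proof (induction I rule: infinite_finite_induct)
  case (insert i I)
  then have "l2norm M (\<lambda>x. f i x + (\<Sum>i\<in>I. f i x)) \<le> l2norm M (f i) + l2norm M (\<lambda>x. \<Sum>i\<in>I. f i x)"
    by (intro l2norm_triangle sq_integrable_sum) auto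
  with insert show ?case by (simp add: insert.hyps)
qed (auto simp: l2norm_def)

lemma ennreal_l2norm_power2:
  assumes "sq_integrable M f"
  shows "ennreal ((l2norm M f)\<^sup>2) = (\<integral>\<^sup>+x. ennreal ((f x)\<^sup>2) \<partial>M)"
  unfolding l2norm_power2 using assms by (subst nn_integral_eq_integral) (auto dest: sq_integrableD)

text \<open>Passes from an \<open>ennreal\<close>-valued error such as the squared Sobolev norm,
  which majorises the squared error of every component, to convergence of real norms.\<close>

lemma l2norm_tendsto_0:
  assumes H: "\<And>n. sq_integrable M (H n)" and le: "\<And>n. (\<integral>\<^sup>+x. ennreal ((H n x)\<^sup>2) \<partial>M) \<le> e n"
    and e: "e \<longlonglongrightarrow> 0"
  shows "(\<lambda>n. l2norm M (H n)) \<longlonglongrightarrow> 0"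
proof -
  have "(\<lambda>n. ennreal ((l2norm M (H n))\<^sup>2)) \<longlonglongrightarrow> ennreal 0"
    unfolding ennreal_0
    by (rule tendsto_sandwich[OF _ _ tendsto_const e]) (auto simp: ennreal_l2norm_power2 H le)
  then have "(\<lambda>n. (l2norm M (H n))\<^sup>2) \<longlonglongrightarrow> 0"
    by (subst (asm) tendsto_ennreal_iff) auto
  from tendsto_real_sqrt[OF this] show ?thesis by simp
qed

lemma nn_integral_sum_l2norm:
  assumes "finite I" "\<And>i. i \<in> I \<Longrightarrow> sq_integrable M (g i)"
  shows "(\<integral>\<^sup>+p. ennreal (\<Sum>i\<in>I. (g i p)\<^sup>2) \<partial>M) = ennreal (\<Sum>i\<in>I. (l2norm M (g i))\<^sup>2)"
proof -
  have "(\<integral>\<^sup>+p. ennreal (\<Sum>i\<in>I. (g i p)\<^sup>2) \<partial>M) = (\<integral>\<^sup>+p. (\<Sum>i\<in>I. ennreal ((g i p)\<^sup>2)) \<partial>M)"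
    by (simp add: sum_ennreal)
  also have "\<dots> = (\<Sum>i\<in>I. \<integral>\<^sup>+p. ennreal ((g i p)\<^sup>2) \<partial>M)"
    using assms(2) by (intro nn_integral_sum) (auto dest!: sq_integrable_measurable)
  also have "\<dots> = (\<Sum>i\<in>I. ennreal ((l2norm M (g i))\<^sup>2))"
    by (intro sum.cong refl ennreal_l2norm_power2[symmetric] assms(2))
  finally show ?thesis by (simp add: sum_ennreal)
qed

section \<open>Calculus\<close>

text \<open>The squared positive part is continuously differentiable, which makes it the building
  block of the cutoffs in \<open>near_V\<close> and \<open>power_identity\<close>.\<close>

lemma has_real_derivative_max_0_power2:
  "((\<lambda>x. (max 0 x)\<^sup>2) has_real_derivative 2 * max 0 x) (at (x::real))"
proof -
  consider "x > 0" | "x < 0" | "x = 0" by linarith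
  then show ?thesis
  proof cases
    case 1
    have "eventually (\<lambda>y. y > 0) (nhds x)" using eventually_nhds_in_open[of "{0<..}" x] 1 by simp
    then have "eventually (\<lambda>y. (max 0 y)\<^sup>2 = y\<^sup>2) (nhds x)" by eventually_elim (simp add: max_def)
    moreover have "((\<lambda>x. x\<^sup>2) has_real_derivative 2 * max 0 x) (at x)"
      using 1 by (auto intro!: derivative_eq_intros)
    ultimately show ?thesis by (subst DERIV_cong_ev) auto
  next
    case 2
    have "eventually (\<lambda>y. y < 0) (nhds x)" using eventually_nhds_in_open[of "{..<0}" x] 2 by simp
    then have "eventually (\<lambda>y. (max 0 y)\<^sup>2 = 0) (nhds x)" by eventually_elim (simp add: max_def)
    then show ?thesis using 2 by (subst DERIV_cong_ev[OF refl _ refl, where g = "\<lambda>_. 0"]) auto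
  next
    case 3
    have "(\<lambda>h. (max 0 h)\<^sup>2 / h) \<midarrow>0\<rightarrow> (0::real)"
    proof (rule Lim_null_comparison)
      show "\<forall>\<^sub>F h in at 0. norm ((max 0 h)\<^sup>2 / h) \<le> \<bar>h :: real\<bar>"
        by (auto simp: eventually_at_filter max_def power2_eq_square)
      show "((\<lambda>h::real. \<bar>h\<bar>) \<longlongrightarrow> 0) (at 0)" by (auto intro!: tendsto_eq_intros)
    qed
    then show ?thesis using 3 by (simp add: DERIV_def)
  qed
qed

lemma has_real_derivative_max_0_diff_power2:
  "((\<lambda>r. (max 0 (a - r))\<^sup>2) has_real_derivative - 2 * max 0 (a - r)) (at (r::real))"
proof -
  have "((\<lambda>r. a - r) has_real_derivative - 1) (at r)"
    by (auto intro!: derivative_eq_intros)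
  from DERIV_chain'[OF this has_real_derivative_max_0_power2] show ?thesis by simp
qed

text \<open>Differentiability is available for the approximants \<open>C n\<close> only. The mean
  value inequality is applied to \<open>C n s + C n (- s)\<close>, whose derivative is
  \<open>D n s - D n (- s)\<close>, so it is the odd part of \<open>d\<close> that has to be
  bounded.\<close>

lemma mean_value_limit:
  fixes C D :: "nat \<Rightarrow> real \<Rightarrow> real"
  assumes h: "0 \<le> h" and der: "\<And>n s. (C n has_real_derivative D n s) (at s)"
    and lim: "\<And>s. (\<lambda>n. C n s) \<longlonglongrightarrow> c s"
    and unif: "\<And>n s. \<bar>s\<bar> \<le> h \<Longrightarrow> \<bar>D n s - d s\<bar> \<le> \<delta> n" "\<delta> \<longlonglongrightarrow> 0"
    and L: "\<And>s. 0 \<le> s \<Longrightarrow> s \<le> h \<Longrightarrow> \<bar>d s - d (- s)\<bar> \<le> L"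
  shows "\<bar>2 * c 0 - c h - c (- h)\<bar> \<le> h * L"
proof (rule LIMSEQ_le)
  show "(\<lambda>n. \<bar>2 * C n 0 - C n h - C n (- h)\<bar>) \<longlonglongrightarrow> \<bar>2 * c 0 - c h - c (- h)\<bar>"
    by (intro tendsto_intros lim)
  show "(\<lambda>n. h * (L + 2 * \<delta> n)) \<longlonglongrightarrow> h * L"
    by (rule tendsto_eq_rhs, (rule tendsto_intros unif)+) simp
  have "\<bar>2 * C n 0 - C n h - C n (- h)\<bar> \<le> h * (L + 2 * \<delta> n)" for n
  proof -
    have "norm ((C n h + C n (- h)) - (C n 0 + C n (- 0))) \<le> (L + 2 * \<delta> n) * norm (h - 0)"
    proof (rule field_differentiable_bound[of "{0..h}" "\<lambda>s. C n s + C n (- s)" "\<lambda>s. D n s - D n (- s)"])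
      fix s assume s: "s \<in> {0..h}"
      have "((\<lambda>s. C n (- s)) has_real_derivative D n (- s) * - 1) (at s)"
        by (rule DERIV_chain2[OF der]) (auto intro!: derivative_eq_intros)
      from DERIV_add[OF der this]
      show "((\<lambda>s. C n s + C n (- s)) has_field_derivative D n s - D n (- s)) (at s within {0..h})"
        by (simp add: has_field_derivative_at_within)
      show "norm (D n s - D n (- s)) \<le> L + 2 * \<delta> n"
        using unif(1)[of s n] unif(1)[of "- s" n] L[of s] s by auto
    qed (use h in auto)
    then show ?thesis using h by (simp add: mult.commute abs_if split: if_splits)
  qed
  then show "\<exists>N. \<forall>n\<ge>N. \<bar>2 * C n 0 - C n h - C n (- h)\<bar> \<le> h * (L + 2 * \<delta> n)" by blast
qed

text \<open>Dominated convergence for difference quotients: by the mean value inequality each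
  quotient is bounded by the same \<open>D\<close> that bounds the derivative.\<close>

lemma has_real_derivative_integral:
  fixes G :: "real \<Rightarrow> 'a \<Rightarrow> real"
  assumes d: "d > 0" and int: "\<And>s. \<bar>s\<bar> < d \<Longrightarrow> integrable M (G s)"
    and der: "\<And>s p. \<bar>s\<bar> < d \<Longrightarrow> ((\<lambda>s. G s p) has_real_derivative G' s p) (at s)"
    and bound: "\<And>s p. \<bar>s\<bar> < d \<Longrightarrow> \<bar>G' s p\<bar> \<le> D p" and D: "integrable M D"
  shows "((\<lambda>s. \<integral>p. G s p \<partial>M) has_real_derivative (\<integral>p. G' 0 p \<partial>M)) (at 0)"
proof -
  have quot: "\<bar>(G s p - G 0 p) / s\<bar> \<le> D p" if s: "\<bar>s\<bar> < d" for s p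
  proof (cases "s = 0")
    case True
    then show ?thesis using bound[of 0 p] d by simp
  next
    case False
    have "norm (G s p - G 0 p) \<le> D p * norm (s - 0)"
    proof (rule field_differentiable_bound[of "{-\<bar>s\<bar>..\<bar>s\<bar>}" "\<lambda>s. G s p" "\<lambda>s. G' s p"])
      fix x assume "x \<in> {-\<bar>s\<bar>..\<bar>s\<bar>}"
      then have "\<bar>x\<bar> < d" using s by auto
      then show "((\<lambda>s. G s p) has_field_derivative G' x p) (at x within {-\<bar>s\<bar>..\<bar>s\<bar>})"
        "norm (G' x p) \<le> D p"
        using der bound by (auto intro: has_field_derivative_at_within)
    qed auto
    with False show ?thesis by (simp add: field_simps)
  qed
  have lim: "(\<lambda>n. (G (S n) p - G 0 p) / S n) \<longlonglongrightarrow> G' 0 p"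
    if "\<And>n. S n \<noteq> 0" "S \<longlonglongrightarrow> 0" for S :: "nat \<Rightarrow> real" and p
  proof -
    have "((\<lambda>s. (G s p - G 0 p) / s) \<longlongrightarrow> G' 0 p) (at 0)"
      using der[of 0 p] d by (simp add: has_field_derivative_iff)
    moreover have "filterlim S (at 0) sequentially"
      using that by (simp add: filterlim_at)
    ultimately show ?thesis by (rule filterlim_compose)
  qed
  show ?thesis
    unfolding has_field_derivative_iff
  proof (subst tendsto_at_iff_sequentially, intro allI impI)
    fix S :: "nat \<Rightarrow> real" assume S: "\<forall>i. S i \<in> UNIV - {0}" "S \<longlonglongrightarrow> 0"
    then obtain N where N: "\<And>n. n \<ge> N \<Longrightarrow> \<bar>S n\<bar> < d"
      using d unfolding LIMSEQ_def by (metis dist_real_def diff_0_right)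
    have S0: "S n \<noteq> 0" for n using S(1) by auto
    have "(\<lambda>n. \<integral>p. (G (S (n + N)) p - G 0 p) / S (n + N) \<partial>M) \<longlonglongrightarrow> (\<integral>p. G' 0 p \<partial>M)"
    proof (rule integral_dominated_convergence[where w = D])
      have m: "(\<lambda>p. (G (S (n + N)) p - G 0 p) / S (n + N)) \<in> borel_measurable M" for n
        using int[of "S (n + N)"] int[of 0] d N[of "n + N"] by auto
      then show "\<And>n. (\<lambda>p. (G (S (n + N)) p - G 0 p) / S (n + N)) \<in> borel_measurable M" .
      have l: "(\<lambda>n. (G (S (n + N)) p - G 0 p) / S (n + N)) \<longlonglongrightarrow> G' 0 p" for p
        using lim[of "\<lambda>n. S (n + N)"] S0 LIMSEQ_ignore_initial_segment[OF S(2)] by simp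
      then show "AE p in M. (\<lambda>n. (G (S (n + N)) p - G 0 p) / S (n + N)) \<longlonglongrightarrow> G' 0 p" by simp
      show "G' 0 \<in> borel_measurable M"
        by (rule borel_measurable_LIMSEQ_real[OF l m])
      show "\<And>n. AE p in M. norm ((G (S (n + N)) p - G 0 p) / S (n + N)) \<le> D p"
        using quot N by simp
    qed (rule D)
    moreover have "(\<integral>p. (G (S (n + N)) p - G 0 p) / S (n + N) \<partial>M) =
      ((\<integral>p. G (S (n + N)) p \<partial>M) - (\<integral>p. G 0 p \<partial>M)) / S (n + N)" for n
      using int[of "S (n + N)"] int[of 0] d N[of "n + N"] by simp
    ultimately have "(\<lambda>n. ((\<integral>p. G (S (n + N)) p \<partial>M) - (\<integral>p. G 0 p \<partial>M)) / S (n + N)) \<longlonglongrightarrow> (\<integral>p. G' 0 p \<partial>M)"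
      by (simp only:)
    from LIMSEQ_offset[OF this]
    show "((\<lambda>s. ((\<integral>p. G s p \<partial>M) - (\<integral>p. G 0 p \<partial>M)) / (s - 0)) \<circ> S) \<longlonglongrightarrow> (\<integral>p. G' 0 p \<partial>M)"
      by (simp add: o_def)
  qed
qed

section \<open>Integrals of continuous functions with compact support\<close>

lemma continuous_compact_support_bounded:
  fixes g :: "'a::euclidean_space \<Rightarrow> real"
  assumes "continuous_on UNIV g" "compact S" "\<And>p. p \<notin> S \<Longrightarrow> g p = 0"
  obtains B where "0 \<le> B" "\<And>p. \<bar>g p\<bar> \<le> B"
proof -
  have "bounded (g ` S)"
    using assms(1,2) by (intro compact_imp_bounded compact_continuous_image) (auto intro: continuous_on_subset)
  then obtain B where B: "\<And>p. p \<in> S \<Longrightarrow> \<bar>g p\<bar> \<le> B" by (auto simp: bounded_iff)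
  have "\<bar>g p\<bar> \<le> max B 0" for p using B[of p] assms(3)[of p] by (cases "p \<in> S") auto
  then show ?thesis by (intro that[of "max B 0"]) auto
qed

lemma integrable_continuous_compact_support:
  fixes g :: "'a::euclidean_space \<Rightarrow> real"
  assumes g: "continuous_on UNIV g" and S: "compact S" "\<And>p. p \<notin> S \<Longrightarrow> g p = 0"
  shows "integrable lebesgue g"
proof -
  have "integrable lborel (\<lambda>x. indicator S x *\<^sub>R g x)"
    by (intro borel_integrable_compact S continuous_on_subset[OF g]) auto
  moreover have "(\<lambda>x. indicator S x *\<^sub>R g x) = g"
    using S(2) by (fastforce simp: indicator_def)
  ultimately show ?thesis using integrable_completion[of g lborel]
    by (simp add: borel_measurable_integrable)
qed

lemma sq_integrable_continuous_compact_support: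
  fixes g :: "'a::euclidean_space \<Rightarrow> real"
  assumes g: "continuous_on UNIV g" and S: "compact S" "\<And>p. p \<notin> S \<Longrightarrow> g p = 0"
  shows "sq_integrable lebesgue g"
  unfolding sq_integrable_def
proof
  show "g \<in> borel_measurable lebesgue"
    using integrable_continuous_compact_support[OF assms] by auto
  show "integrable lebesgue (\<lambda>p. (g p)\<^sup>2)"
    by (rule integrable_continuous_compact_support[OF _ S(1)]) (auto intro!: continuous_intros g simp: S)
qed

lemma lebesgue_integral_translation:
  fixes g :: "'a::euclidean_space \<Rightarrow> real"
  assumes "g \<in> borel_measurable lborel"
  shows "(\<integral>p. g (p + c) \<partial>lebesgue) = (\<integral>p. g p \<partial>lebesgue)"
proof -
  have "(\<integral>p. g p \<partial>lborel) = (\<integral>p. g p \<partial>distr lborel borel ((+) c))"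
    by (simp add: lborel_distr_plus)
  also have "\<dots> = (\<integral>p. g (p + c) \<partial>lborel)"
    using assms by (subst integral_distr) (auto simp: add.commute)
  finally show ?thesis using assms
    by (subst (1 2) integral_completion) auto
qed

text \<open>Translating by \<open>s *\<^sub>R v\<close> leaves the integral unchanged, so
  differentiating under the integral at \<open>s = 0\<close> gives zero. The hypothesis concerns the
  single direction \<open>v\<close>, which suits integrands containing the nonsmooth factor
  \<open>norm (fst p) powr \<gamma>\<close>.\<close>

lemma integral_directional_derivative_eq_0:
  fixes g :: "'a::euclidean_space \<Rightarrow> real"
  assumes g: "continuous_on UNIV g" and g': "continuous_on UNIV g'"
    and der: "\<And>p. ((\<lambda>s. g (p + s *\<^sub>R v)) has_real_derivative g' p) (at 0)"
    and S: "compact S" "\<And>p. p \<notin> S \<Longrightarrow> g p = 0" "\<And>p. p \<notin> S \<Longrightarrow> g' p = 0"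
  shows "(\<integral>p. g' p \<partial>lebesgue) = 0"
proof -
  obtain B where B: "0 \<le> B" "\<And>p. \<bar>g' p\<bar> \<le> B"
    using continuous_compact_support_bounded[OF g' S(1) S(3)] by blast
  obtain r where r: "\<And>p. p \<in> S \<Longrightarrow> norm p \<le> r"
    using compact_imp_bounded[OF S(1)] by (auto simp: bounded_iff)
  \<comment> \<open>A ball containing every \<open>p\<close> for which some
    \<open>p + s *\<^sub>R v\<close> with |s| < 1 lies in \<open>S\<close>; its indicator carries
    the dominating function.\<close>
  define T where "T = cball (0::'a) (r + norm v)"
  have der': "((\<lambda>s. g (p + s *\<^sub>R v)) has_real_derivative g' (p + s *\<^sub>R v)) (at s)" for s p
  proof -
    have "((\<lambda>x. g ((p + s *\<^sub>R v) + (x - s) *\<^sub>R v)) has_real_derivative g' (p + s *\<^sub>R v) * 1) (at s)"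
      by (rule DERIV_chain'[where f = "\<lambda>x. x - s" and g = "\<lambda>t. g ((p + s *\<^sub>R v) + t *\<^sub>R v)"])
         (use der[of "p + s *\<^sub>R v"] in \<open>auto intro!: derivative_eq_intros\<close>)
    then show ?thesis by (simp add: algebra_simps)
  qed
  have "((\<lambda>s. \<integral>p. g (p + s *\<^sub>R v) \<partial>lebesgue) has_real_derivative (\<integral>p. g' (p + 0 *\<^sub>R v) \<partial>lebesgue)) (at 0)"
  proof (rule has_real_derivative_integral[where d = 1 and D = "\<lambda>p. B * indicator T p"])
    fix s :: real assume s: "\<bar>s\<bar> < 1"
    have sv: "norm (s *\<^sub>R v) \<le> norm v"
      using s by (simp add: mult_left_le_one_le)
    have out: "p + s *\<^sub>R v \<notin> S" if "p \<notin> T" for p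
    proof
      assume "p + s *\<^sub>R v \<in> S"
      then have "norm p \<le> r + norm v"
        using r[of "p + s *\<^sub>R v"] sv norm_triangle_ineq4[of "p + s *\<^sub>R v" "s *\<^sub>R v"] by simp
      with that show False by (simp add: T_def)
    qed
    show "integrable lebesgue (\<lambda>p. g (p + s *\<^sub>R v))"
      by (rule integrable_continuous_compact_support[where S = T])
         (auto simp: T_def[symmetric] S out intro!: continuous_on_compose2[OF g] continuous_intros, simp add: T_def)
    show "\<bar>g' (p + s *\<^sub>R v)\<bar> \<le> B * indicator T p" for p
      using B S out by (cases "p \<in> T") auto
  next
    have "integrable lborel (\<lambda>p. indicator T p *\<^sub>R B)"
      by (intro borel_integrable_compact) (auto simp: T_def)
    then show "integrable lebesgue (\<lambda>p. B * indicator T p)"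
      by (auto simp: mult.commute integrable_completion borel_measurable_integrable)
  qed (auto intro: der')
  moreover have "(\<integral>p. g (p + s *\<^sub>R v) \<partial>lebesgue) = (\<integral>p. g p \<partial>lebesgue)" for s
    using g by (intro lebesgue_integral_translation) (simp add: borel_measurable_continuous_onI)
  ultimately have "((\<lambda>s::real. \<integral>p. g p \<partial>lebesgue) has_real_derivative (\<integral>p. g' p \<partial>lebesgue)) (at 0)" by simp
  from DERIV_unique[OF this DERIV_const] show ?thesis .
qed

section \<open>Gauge and anisotropic dilations\<close>

definition dil :: "real \<Rightarrow> real \<Rightarrow> ('m::finite, 'k::finite) point \<Rightarrow> ('m, 'k) point" where
  "dil \<gamma> s p = (exp s *\<^sub>R fst p, exp ((\<gamma> + 1) * s) *\<^sub>R snd p)"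

lemma dil_0[simp]: "dil \<gamma> 0 p = p"
  by (simp add: dil_def)

lemma dil_zero[simp]: "dil \<gamma> s 0 = 0"
  by (simp add: dil_def prod_eq_iff)

lemma dil_dil: "dil \<gamma> s (dil \<gamma> r p) = dil \<gamma> (s + r) p"
  by (simp add: dil_def exp_add[symmetric] distrib_left)

lemma dil_eq_0_iff[simp]: "dil \<gamma> s p = 0 \<longleftrightarrow> p = 0"
  by (simp add: dil_def prod_eq_iff)

lemma fst_dil: "fst (dil \<gamma> s p) = exp s *\<^sub>R fst p"
  by (simp add: dil_def)

lemma snd_dil: "snd (dil \<gamma> s p) = exp ((\<gamma> + 1) * s) *\<^sub>R snd p"
  by (simp add: dil_def)

lemma continuous_on_dil[continuous_intros]:
  "continuous_on A f \<Longrightarrow> continuous_on A (\<lambda>x. dil \<gamma> s (f x))"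
  unfolding dil_def by (intro continuous_intros)

section \<open>Change of variables under dilations\<close>

context
  fixes \<gamma> s :: real
begin

text \<open>The eigenvalue of the dilation on the basis vector \<open>j\<close>;
  \<open>snd j = 0\<close> singles out the directions of \<open>z\<close>. The diagonal form is the
  one to which \<open>lebesgue_affine_euclidean\<close> applies.\<close>

definition dil_coef :: "('m::finite, 'k::finite) point \<Rightarrow> real" where
  "dil_coef j = (if snd j = 0 then exp s else exp ((\<gamma> + 1) * s))"

lemma dil_eq_sum:
  "dil \<gamma> s = (\<lambda>p::('m::finite, 'k::finite) point. 0 + (\<Sum>j\<in>Basis. (dil_coef j * (p \<bullet> j)) *\<^sub>R j))"
proof
  fix p :: "('m, 'k) point"
  show "dil \<gamma> s p = 0 + (\<Sum>j\<in>Basis. (dil_coef j * (p \<bullet> j)) *\<^sub>R j)"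
  proof (rule euclidean_eqI)
    fix b :: "('m, 'k) point" assume b: "b \<in> Basis"
    have "dil \<gamma> s p \<bullet> b = dil_coef b * (p \<bullet> b)"
      using b by (cases p) (auto simp: dil_def dil_coef_def Basis_prod_def)
    also have "\<dots> = (0 + (\<Sum>j\<in>Basis. (dil_coef j * (p \<bullet> j)) *\<^sub>R j)) \<bullet> b"
      using b by simp
    finally show "dil \<gamma> s p \<bullet> b = (0 + (\<Sum>j\<in>Basis. (dil_coef j * (p \<bullet> j)) *\<^sub>R j)) \<bullet> b" .
  qed
qed

text \<open>Each of the m directions of \<open>z\<close> contributes \<open>exp s\<close> and each
  of the k directions of \<open>t\<close> contributes \<open>exp ((\<gamma> + 1) * s)\<close>, so
  the Jacobian exponent is the homogeneous dimension.\<close>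

lemma prod_dil_coef:
  "(\<Prod>j\<in>(Basis :: ('m::finite, 'k::finite) point set). \<bar>dil_coef j\<bar>)
    = exp (hom_dim CARD('m) CARD('k) \<gamma> * s)"
proof -
  have "(\<Prod>j\<in>(Basis :: ('m, 'k) point set). \<bar>dil_coef j\<bar>) =
    (\<Prod>j\<in>(\<lambda>u. (u, 0)) ` (Basis :: (real^'m) set). \<bar>dil_coef (j :: ('m, 'k) point)\<bar>) *
    (\<Prod>j\<in>(\<lambda>v. (0, v)) ` (Basis :: (real^'k) set). \<bar>dil_coef (j :: ('m, 'k) point)\<bar>)"
    unfolding Basis_prod_def by (rule prod.union_disjoint) auto
  also have "\<dots> = exp s ^ CARD('m) * exp ((\<gamma> + 1) * s) ^ CARD('k)"
  proof -
    have "(\<Prod>x\<in>(Basis :: (real^'k) set). if x = 0 then exp s else exp ((\<gamma> + 1) * s))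
        = (\<Prod>x\<in>(Basis :: (real^'k) set). exp ((\<gamma> + 1) * s))"
      by (rule prod.cong) auto
    then show ?thesis
      by (subst (1 2) prod.reindex) (auto simp: inj_on_def dil_coef_def)
  qed
  also have "\<dots> = exp (hom_dim CARD('m) CARD('k) \<gamma> * s)"
    by (simp add: hom_dim_def exp_add[symmetric] exp_of_nat_mult[symmetric] algebra_simps)
  finally show ?thesis .
qed

lemma dil_measurable_lebesgue:
  "(dil \<gamma> s :: ('m::finite, 'k::finite) point \<Rightarrow> _) \<in> lebesgue \<rightarrow>\<^sub>M lebesgue"
  unfolding dil_eq_sum by (rule lebesgue_affine_measurable) (simp add: dil_coef_def)

lemma lebesgue_eq_dil:
  "(lebesgue :: ('m::finite, 'k::finite) point measure) =
    density (distr lebesgue lebesgue (dil \<gamma> s)) (\<lambda>_. ennreal (exp (hom_dim CARD('m) CARD('k) \<gamma> * s)))"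
  using lebesgue_affine_euclidean[of "dil_coef :: ('m, 'k) point \<Rightarrow> real" 0]
  by (simp add: dil_eq_sum prod_dil_coef[symmetric] dil_coef_def)

end

lemma borel_measurable_dil:
  fixes g :: "('m::finite, 'k::finite) point \<Rightarrow> real"
  shows "g \<in> borel_measurable lebesgue \<Longrightarrow> (\<lambda>p. g (dil \<gamma> s p)) \<in> borel_measurable lebesgue"
  using measurable_compose[OF dil_measurable_lebesgue] by blast

lemma integral_dil:
  fixes g :: "('m::finite, 'k::finite) point \<Rightarrow> real"
  assumes g: "g \<in> borel_measurable lebesgue"
  shows "(\<integral>p. g p \<partial>lebesgue) = exp (hom_dim CARD('m) CARD('k) \<gamma> * s) * (\<integral>p. g (dil \<gamma> s p) \<partial>lebesgue)"
proof -
  have "(\<integral>p. g p \<partial>lebesgue) = (\<integral>p. g p \<partial>density (distr lebesgue lebesgue (dil \<gamma> s))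
      (\<lambda>_. ennreal (exp (hom_dim CARD('m) CARD('k) \<gamma> * s))))"
    using lebesgue_eq_dil[of \<gamma> s, where 'm = 'm and 'k = 'k] by simp
  also have "\<dots> = exp (hom_dim CARD('m) CARD('k) \<gamma> * s) * (\<integral>p. g p \<partial>distr lebesgue lebesgue (dil \<gamma> s))"
    using g by (subst integral_density) auto
  also have "(\<integral>p. g p \<partial>distr lebesgue lebesgue (dil \<gamma> s)) = (\<integral>p. g (dil \<gamma> s p) \<partial>lebesgue)"
    using g by (intro integral_distr dil_measurable_lebesgue)
  finally show ?thesis .
qed

lemma integrable_dil:
  fixes g :: "('m::finite, 'k::finite) point \<Rightarrow> real"
  assumes g: "integrable lebesgue g"
  shows "integrable lebesgue (\<lambda>p. g (dil \<gamma> s p))"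
proof -
  have "integrable (density (distr lebesgue lebesgue (dil \<gamma> s))
      (\<lambda>_. ennreal (exp (hom_dim CARD('m) CARD('k) \<gamma> * s)))) g"
    using g lebesgue_eq_dil[of \<gamma> s, where 'm = 'm and 'k = 'k] by simp
  then have "integrable (distr lebesgue lebesgue (dil \<gamma> s)) g"
    using g by (subst (asm) integrable_density) auto
  then show ?thesis
    using g by (subst (asm) integrable_distr_eq) (auto intro: dil_measurable_lebesgue)
qed

lemma sq_integrable_dil:
  fixes g :: "('m::finite, 'k::finite) point \<Rightarrow> real"
  assumes "sq_integrable lebesgue g"
  shows "sq_integrable lebesgue (\<lambda>p. g (dil \<gamma> s p))"
  using assms integrable_dil[of "\<lambda>p. (g p)\<^sup>2"] borel_measurable_dil
  unfolding sq_integrable_def by blast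

lemma l2norm_dil:
  fixes g :: "('m::finite, 'k::finite) point \<Rightarrow> real"
  assumes "g \<in> borel_measurable lebesgue"
  shows "l2norm lebesgue (\<lambda>p. g (dil \<gamma> s p))
    = exp (- hom_dim CARD('m) CARD('k) \<gamma> * s / 2) * l2norm lebesgue g"
proof -
  define Q where "Q = hom_dim CARD('m) CARD('k) \<gamma>"
  have "(\<integral>p. (g p)\<^sup>2 \<partial>lebesgue) = exp (Q * s) * (\<integral>p. (g (dil \<gamma> s p))\<^sup>2 \<partial>lebesgue)"
    unfolding Q_def using assms by (intro integral_dil) auto
  then have "(\<integral>p. (g (dil \<gamma> s p))\<^sup>2 \<partial>lebesgue) = exp (- Q * s) * (\<integral>p. (g p)\<^sup>2 \<partial>lebesgue)"
    by (simp add: exp_minus field_simps)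
  moreover have "sqrt (exp (- Q * s)) = exp (- Q * s / 2)"
    by (rule real_sqrt_unique) (simp_all add: power2_eq_square exp_add[symmetric])
  ultimately show ?thesis
    unfolding Q_def[symmetric] by (simp add: l2norm_def real_sqrt_mult)
qed

text \<open>The measure of a set is a positive multiple of the measure of its preimage, so preimages
  of null sets are null.\<close>

lemma AE_dil:
  assumes "AE p in (lebesgue :: ('m::finite, 'k::finite) point measure). P p"
  shows "AE p in (lebesgue :: ('m, 'k) point measure). P (dil \<gamma> s p)"
proof -
  from assms obtain N where N: "N \<in> null_sets (lebesgue :: ('m, 'k) point measure)" "{p. \<not> P p} \<subseteq> N"
    by (auto simp: eventually_ae_filter)
  have s: "dil \<gamma> s -` N \<in> sets lebesgue"
    using measurable_sets[OF dil_measurable_lebesgue[of \<gamma> s], of N] N(1) by auto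
  have "emeasure lebesgue N = ennreal (exp (hom_dim CARD('m) CARD('k) \<gamma> * s)) * emeasure lebesgue (dil \<gamma> s -` N)"
    using N(1)
    by (subst lebesgue_eq_dil[of \<gamma> s])
       (auto simp: emeasure_density nn_integral_cmult emeasure_distr[OF dil_measurable_lebesgue]
         simp del: emeasure_completion)
  with N(1) have "emeasure lebesgue (dil \<gamma> s -` N) = 0"
    by (metis ennreal_eq_0_iff exp_gt_zero linorder_not_le mult_eq_0_iff null_setsD1)
  with s have "dil \<gamma> s -` N \<in> null_sets (lebesgue :: ('m, 'k) point measure)" by blast
  then show ?thesis
    by (rule AE_I') (use N(2) in auto)
qed

section \<open>Size and homogeneity of the gauge\<close>

lemma rho_nonneg[simp]: "0 \<le> rho \<gamma> p"
  by (simp add: rho_def)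

lemma rho_arg_pos:
  assumes "\<gamma> > 0" "p \<noteq> 0"
  shows "0 < norm (fst p) powr (2 * (\<gamma> + 1)) + (\<gamma> + 1)\<^sup>2 * (norm (snd p))\<^sup>2"
  using assms by (cases p) (auto simp: zero_prod_def add_pos_nonneg add_nonneg_pos)

lemma rho_pos: "\<gamma> > 0 \<Longrightarrow> p \<noteq> 0 \<Longrightarrow> 0 < rho \<gamma> p"
  using rho_arg_pos[of \<gamma> p] by (simp add: rho_def)

lemma rho_0[simp]: "rho \<gamma> 0 = 0"
  by (simp add: rho_def)

lemma rho_powr:
  assumes "\<gamma> > 0"
  shows "rho \<gamma> p powr (2 * (\<gamma> + 1)) = norm (fst p) powr (2 * (\<gamma> + 1)) + (\<gamma> + 1)\<^sup>2 * (norm (snd p))\<^sup>2"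
  using assms by (simp add: rho_def powr_powr)

lemma norm_fst_le_rho:
  assumes "\<gamma> > 0"
  shows "norm (fst p) \<le> rho \<gamma> p"
proof (rule ccontr)
  assume "\<not> ?thesis"
  then have "rho \<gamma> p powr (2 * (\<gamma> + 1)) < norm (fst p) powr (2 * (\<gamma> + 1))"
    using assms by (intro powr_less_mono2) auto
  moreover have "0 \<le> (\<gamma> + 1)\<^sup>2 * (norm (snd p))\<^sup>2" by simp
  ultimately show False unfolding rho_powr[OF assms] by linarith
qed

lemma norm_snd_le_rho:
  assumes "\<gamma> > 0"
  shows "norm (snd p) \<le> rho \<gamma> p powr (\<gamma> + 1)"
proof (rule power2_le_imp_le)
  have "1 \<le> (\<gamma> + 1)\<^sup>2" using assms by (simp add: one_le_power)
  then have "1 * (norm (snd p))\<^sup>2 \<le> (\<gamma> + 1)\<^sup>2 * (norm (snd p))\<^sup>2"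
    by (rule mult_right_mono) simp
  also have "\<dots> \<le> rho \<gamma> p powr (2 * (\<gamma> + 1))" unfolding rho_powr[OF assms] by simp
  also have "2 * (\<gamma> + 1) = (\<gamma> + 1) + (\<gamma> + 1)" by simp
  also have "rho \<gamma> p powr ((\<gamma> + 1) + (\<gamma> + 1)) = (rho \<gamma> p powr (\<gamma> + 1))\<^sup>2"
    unfolding powr_add power2_eq_square ..
  finally show "(norm (snd p))\<^sup>2 \<le> (rho \<gamma> p powr (\<gamma> + 1))\<^sup>2" by simp
qed simp

lemma rho_dil:
  assumes "\<gamma> > 0"
  shows "rho \<gamma> (dil \<gamma> s p) = exp s * rho \<gamma> p"
proof -
  have e: "exp (x::real) powr y = exp (x * y)" for x y
    by (simp add: powr_def mult.commute)
  have "norm (fst (dil \<gamma> s p)) powr (2 * (\<gamma> + 1)) + (\<gamma> + 1)\<^sup>2 * (norm (snd (dil \<gamma> s p)))\<^sup>2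
    = exp (2 * (\<gamma> + 1) * s) *
      (norm (fst p) powr (2 * (\<gamma> + 1)) + (\<gamma> + 1)\<^sup>2 * (norm (snd p))\<^sup>2)"
  proof -
    have "norm (fst (dil \<gamma> s p)) powr (2 * (\<gamma> + 1)) = exp (2 * (\<gamma> + 1) * s) * norm (fst p) powr (2 * (\<gamma> + 1))"
      by (simp add: fst_dil powr_mult e mult.commute)
    moreover have "(exp ((\<gamma> + 1) * s))\<^sup>2 = exp (2 * (\<gamma> + 1) * s)"
      by (simp add: exp_double[symmetric] mult.assoc)
    then have "(norm (snd (dil \<gamma> s p)))\<^sup>2 = exp (2 * (\<gamma> + 1) * s) * (norm (snd p))\<^sup>2"
      by (simp only: snd_dil norm_scaleR power_mult_distrib abs_exp_cancel)
    ultimately show ?thesis by (simp only: distrib_left mult.left_commute)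
  qed
  then show ?thesis
    using assms by (simp add: rho_def powr_mult e)
qed

lemma continuous_on_rho: "\<gamma> > 0 \<Longrightarrow> continuous_on A (rho \<gamma>)"
  unfolding rho_def by (intro continuous_on_powr' continuous_intros) (auto simp: add_nonneg_eq_0_iff)

lemma borel_measurable_rho: "\<gamma> > 0 \<Longrightarrow> rho \<gamma> \<in> borel_measurable borel"
  by (intro borel_measurable_continuous_onI continuous_on_rho)

section \<open>The Grushin fields and the derivatives of the gauge\<close>

definition field_dir :: "'m + 'k \<Rightarrow> ('m::finite, 'k::finite) point" where
  "field_dir i = (case i of Inl a \<Rightarrow> (axis a 1, 0) | Inr b \<Rightarrow> (0, axis b 1))"

text \<open>Each field is \<open>field_coef\<close> times the derivative in the constant direction
  \<open>field_dir\<close>, and the coefficient is constant along its own direction. Hence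
  integration by parts never differentiates the possibly nonsmooth power of |z|.\<close>

definition field_coef :: "real \<Rightarrow> 'm + 'k \<Rightarrow> ('m::finite, 'k::finite) point \<Rightarrow> real" where
  "field_coef \<gamma> i p = (case i of Inl a \<Rightarrow> 1 | Inr b \<Rightarrow> norm (fst p) powr \<gamma>)"

text \<open>Away from the origin this is the ordinary partial derivative of
  \<open>rho \<gamma>\<close> along \<open>field_dir i\<close>; the field derivative of the gauge is
  \<open>field_coef \<gamma> i p * drho \<gamma> i p\<close>.\<close>

definition drho :: "real \<Rightarrow> 'm + 'k \<Rightarrow> ('m::finite, 'k::finite) point \<Rightarrow> real" where
  "drho \<gamma> i p = rho \<gamma> p powr (- (2 * \<gamma> + 1)) *
     (case i of Inl a \<Rightarrow> norm (fst p) powr (2 * \<gamma>) * (fst p $ a) | Inr b \<Rightarrow> (\<gamma> + 1) * (snd p $ b))"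

lemma grushin_X_eq: "grushin_X \<gamma> i f p = field_coef \<gamma> i p * partial_deriv (field_dir i) f p"
  by (simp add: grushin_X_def field_coef_def field_dir_def split: sum.split)

lemma field_dir_in_Basis: "field_dir i \<in> Basis"
  by (auto simp: field_dir_def Basis_prod_def axis_in_Basis_iff split: sum.split)

lemma field_coef_translate: "field_coef \<gamma> i (p + s *\<^sub>R field_dir i) = field_coef \<gamma> i p"
  by (simp add: field_coef_def field_dir_def split: sum.split)

lemma continuous_on_norm_fst_powr:
  "0 < c \<Longrightarrow> continuous_on A (\<lambda>p::('m::finite, 'k::finite) point. norm (fst p) powr c)"
  by (rule continuous_on_powr') (auto intro!: continuous_on_norm continuous_on_fst continuous_on_id continuous_on_const)

lemma continuous_on_field_coef: "\<gamma> > 0 \<Longrightarrow> continuous_on A (field_coef \<gamma> i)"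
  unfolding field_coef_def by (cases i) (simp_all add: continuous_on_norm_fst_powr)

text \<open>The first equation says that the fields are homogeneous of degree one: applying a field
  to \<open>f\<close> composed with \<open>dil \<gamma> s\<close> gives \<open>exp s\<close> times
  the field derivative of \<open>f\<close>, composed with \<open>dil \<gamma> s\<close>.\<close>

lemma dil_translate:
  "field_coef \<gamma> i p * dil_coef \<gamma> s (field_dir i) = exp s * field_coef \<gamma> i (dil \<gamma> s p)"
  "dil \<gamma> s (p + x *\<^sub>R field_dir i) = dil \<gamma> s p + (x * dil_coef \<gamma> s (field_dir i)) *\<^sub>R field_dir i"
proof -
  have e: "exp (x::real) powr y = exp (x * y)" for x y
    by (simp add: powr_def mult.commute)
  show "field_coef \<gamma> i p * dil_coef \<gamma> s (field_dir i) = exp s * field_coef \<gamma> i (dil \<gamma> s p)"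
    by (auto simp: field_coef_def field_dir_def dil_coef_def dil_def powr_mult e exp_add[symmetric]
       axis_eq_0_iff algebra_simps split: sum.split)
  show "dil \<gamma> s (p + x *\<^sub>R field_dir i) = dil \<gamma> s p + (x * dil_coef \<gamma> s (field_dir i)) *\<^sub>R field_dir i"
    by (auto simp: field_dir_def dil_coef_def dil_def axis_eq_0_iff algebra_simps split: sum.split)
qed

text \<open>The gauge has degree one and the fields lower the degree by one, so the field
  derivatives of the gauge have degree zero.\<close>

lemma drho_dil:
  assumes "\<gamma> > 0"
  shows "field_coef \<gamma> i (dil \<gamma> s p) * drho \<gamma> i (dil \<gamma> s p) = field_coef \<gamma> i p * drho \<gamma> i p"
proof -
  have e: "exp (x::real) powr y = exp (x * y)" for x y
    by (simp add: powr_def mult.commute)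
  show ?thesis
  proof (cases i)
    case (Inl a)
    have "exp (s * (- (2 * \<gamma> + 1))) * (exp (s * (2 * \<gamma>)) * exp s) = 1"
      by (simp add: exp_add[symmetric] algebra_simps del: exp_minus)
    then show ?thesis
      by (simp only: drho_def field_coef_def rho_dil[OF assms] fst_dil snd_dil powr_mult e
          norm_scaleR abs_exp_cancel Inl sum.case vector_scaleR_component real_scaleR_def) algebra
  next
    case (Inr b)
    have "exp (s * \<gamma>) * (exp (s * (- (2 * \<gamma> + 1))) * exp ((\<gamma> + 1) * s)) = 1"
      by (simp add: exp_add[symmetric] algebra_simps del: exp_minus)
    then show ?thesis
      by (simp only: drho_def field_coef_def rho_dil[OF assms] fst_dil snd_dil powr_mult e
          norm_scaleR abs_exp_cancel Inr sum.case vector_scaleR_component real_scaleR_def) algebra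
  qed
qed

text \<open>\<open>has_deriv_norm_powr\<close> also covers a vanishing \<open>z\<close>, as the
  exponent \<open>2 * (\<gamma> + 1)\<close> exceeds 1; the outer root is differentiable because its
  argument is positive off the origin.\<close>

lemma rho_has_derivative_field_dir:
  fixes p :: "('m::finite, 'k::finite) point"
  assumes g: "\<gamma> > 0" and p: "p \<noteq> 0"
  shows "((\<lambda>s. rho \<gamma> (p + s *\<^sub>R field_dir i)) has_real_derivative drho \<gamma> i p) (at 0)"
proof -
  obtain z t where zt: "p = (z, t)" by (cases p)
  define c where "c = \<gamma> + 1"
  have c: "c > 1" using g c_def by simp
  define T where "T = norm z powr (2 * c) + c\<^sup>2 * (norm t)\<^sup>2"
  have T: "T > 0" using rho_arg_pos[OF g p] by (simp add: T_def c_def zt)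
  define d where "d = 1 / (2 * c) * T powr (1 / (2 * c) - 1)"
  have D: "((\<lambda>s. F s powr (1 / (2 * c))) has_real_derivative d * F') (at 0)"
    if "(F has_real_derivative F') (at 0)" "F 0 = T" for F :: "real \<Rightarrow> real" and F'
    by (rule DERIV_cong[OF DERIV_fun_powr[OF that(1)]]) (use that T in \<open>auto simp: d_def\<close>)
  have r: "rho \<gamma> p powr (- (2 * \<gamma> + 1)) = T powr (1 / (2 * c) - 1)"
  proof -
    have "1 / (2 * c) * (- (2 * \<gamma> + 1)) = 1 / (2 * c) - 1"
      using c by (simp add: c_def field_simps)
    then show ?thesis by (simp add: rho_def T_def zt c_def powr_powr)
  qed
  show ?thesis
  proof (cases i)
    case (Inl a)
    have "((\<lambda>s. norm (z + s *\<^sub>R axis a 1) powr (2 * c) + c\<^sup>2 * (norm t)\<^sup>2) has_real_derivative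
           2 * c * norm z powr (2 * c - 2) * (z \<bullet> axis a 1)) (at 0)"
      using c by (intro DERIV_cong[OF DERIV_add[OF has_deriv_norm_powr DERIV_const]]) auto
    from D[OF this] have "((\<lambda>s. rho \<gamma> (p + s *\<^sub>R field_dir i)) has_real_derivative
        d * (2 * c * norm z powr (2 * c - 2) * (z \<bullet> axis a 1))) (at 0)"
      by (simp add: T_def rho_def zt c_def Inl field_dir_def)
    moreover have "d * (2 * c * norm z powr (2 * c - 2) * (z \<bullet> axis a 1)) = drho \<gamma> i p"
      unfolding drho_def r using c by (simp add: d_def Inl zt inner_axis) (simp add: c_def)
    ultimately show ?thesis by simp
  next
    case (Inr b)
    have "((\<lambda>s. norm z powr (2 * c) + c\<^sup>2 * ((t + s *\<^sub>R axis b 1) \<bullet> (t + s *\<^sub>R axis b 1)))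
           has_real_derivative c\<^sup>2 * (2 * (t \<bullet> axis b 1))) (at 0)"
      by (auto simp: inner_add_left inner_add_right inner_commute power2_eq_square
               intro!: derivative_eq_intros)
    from D[OF this] have "((\<lambda>s. rho \<gamma> (p + s *\<^sub>R field_dir i)) has_real_derivative
        d * (c\<^sup>2 * (2 * (t \<bullet> axis b 1)))) (at 0)"
      by (simp add: T_def rho_def zt c_def Inr field_dir_def power2_norm_eq_inner)
    moreover have "d * (c\<^sup>2 * (2 * (t \<bullet> axis b 1))) = drho \<gamma> i p"
      unfolding drho_def r using c by (simp add: d_def Inr zt inner_axis power2_eq_square) (simp add: c_def)
    ultimately show ?thesis by simp
  qed
qed

lemma grushin_X_rho:
  assumes "\<gamma> > 0" "p \<noteq> 0"
  shows "grushin_X \<gamma> i (rho \<gamma>) p = field_coef \<gamma> i p * drho \<gamma> i p"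
  using DERIV_imp_deriv[OF rho_has_derivative_field_dir[OF assms]]
  by (simp add: grushin_X_eq partial_deriv_def)

lemma continuous_on_rho_powr:
  assumes g: "\<gamma> > 0"
  shows "continuous_on (- {0}) (\<lambda>p. rho \<gamma> p powr c)"
  by (rule continuous_on_powr) (auto simp: continuous_on_rho g dest!: rho_pos[OF g])

lemma continuous_on_drho:
  assumes g: "\<gamma> > 0"
  shows "continuous_on (- {0}) (drho \<gamma> i)"
  unfolding drho_def using g
  by (cases i) (auto intro!: continuous_on_mult continuous_on_rho_powr continuous_on_norm_fst_powr
     continuous_on_component continuous_on_fst continuous_on_snd continuous_on_id continuous_on_const)

lemma psi_eq_sum:
  assumes "\<gamma> > 0" "p \<noteq> 0"
  shows "psi \<gamma> p = (\<Sum>i\<in>UNIV. (field_coef \<gamma> i p * drho \<gamma> i p)\<^sup>2)"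
  using grushin_X_rho[OF assms] by (simp add: psi_def sq_length_def)

lemma continuous_on_psi:
  assumes "\<gamma> > 0"
  shows "continuous_on (- {0}) (psi \<gamma>)"
  by (rule continuous_on_eq[where f = "\<lambda>p. \<Sum>i\<in>UNIV. (field_coef \<gamma> i p * drho \<gamma> i p)\<^sup>2"])
     (auto intro!: continuous_intros continuous_on_drho continuous_on_field_coef assms simp: psi_eq_sum assms)

lemma psi_le_1:
  assumes "\<gamma> > 0" "p \<noteq> 0"
  shows "psi \<gamma> p \<le> 1"
  using powr_mono2[OF _ _ norm_fst_le_rho[OF assms(1)], of "2 * \<gamma>" p] assms rho_pos[OF assms]
  by (simp add: psi_eq[OF assms])

lemma psi_nonneg: "0 \<le> psi \<gamma> p"
  by (simp add: psi_def sq_length_def sum_nonneg)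

lemma psi_pos:
  assumes "\<gamma> > 0" "fst p \<noteq> 0"
  shows "psi \<gamma> p > 0"
proof -
  have "p \<noteq> 0" using assms by auto
  then show ?thesis using rho_pos[OF assms(1) \<open>p \<noteq> 0\<close>] assms by (simp add: psi_eq)
qed

lemma psi_dil:
  assumes "\<gamma> > 0"
  shows "psi \<gamma> (dil \<gamma> s p) = psi \<gamma> p"
proof (cases "p = 0")
  case False
  then show ?thesis using assms by (simp add: psi_eq_sum drho_dil)
qed simp

lemma abs_field_coef_drho_le_1:
  assumes "\<gamma> > 0" "p \<noteq> 0"
  shows "\<bar>field_coef \<gamma> i p * drho \<gamma> i p\<bar> \<le> 1"
proof -
  have "(field_coef \<gamma> i p * drho \<gamma> i p)\<^sup>2 \<le> psi \<gamma> p"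
    unfolding psi_eq_sum[OF assms] by (rule member_le_sum) auto
  then have "(field_coef \<gamma> i p * drho \<gamma> i p)\<^sup>2 \<le> 1" using psi_le_1[OF assms] by linarith
  then show ?thesis by (simp add: abs_square_le_1)
qed

lemma borel_measurable_field_coef: "\<gamma> > 0 \<Longrightarrow> field_coef \<gamma> i \<in> borel_measurable borel"
  by (intro borel_measurable_continuous_onI continuous_on_field_coef)

lemma borel_measurable_away_0:
  fixes f :: "'a::euclidean_space \<Rightarrow> real"
  assumes "continuous_on (- {0}) f"
  shows "f \<in> borel_measurable borel"
proof -
  have "(\<lambda>p. if p \<in> - {0} then f p else f 0) \<in> borel_measurable borel"
    using assms by (intro borel_measurable_continuous_on_if) auto
  moreover have "(\<lambda>p. if p \<in> - {0} then f p else f 0) = f" by auto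
  ultimately show ?thesis by simp
qed

lemma borel_measurable_drho: "\<gamma> > 0 \<Longrightarrow> drho \<gamma> i \<in> borel_measurable borel"
  by (intro borel_measurable_away_0 continuous_on_drho)

lemma borel_measurable_psi: "\<gamma> > 0 \<Longrightarrow> psi \<gamma> \<in> borel_measurable borel"
  by (intro borel_measurable_away_0 continuous_on_psi)

text \<open>Off the set \<open>fst p = 0\<close> the function \<open>psi \<gamma>\<close> is
  positive, so almost everywhere \<open>sqrt (psi \<gamma> p)\<close> may be cancelled. The set lies
  in the hyperplane on which one arbitrarily chosen coordinate of \<open>z\<close> vanishes.\<close>

lemma AE_fst_neq_0: "AE p in (lebesgue :: ('m::finite, 'k::finite) point measure). fst p \<noteq> 0"
proof -
  define a :: 'm where "a = undefined"
  have "(axis a 1, 0) \<in> (Basis :: ('m, 'k) point set)"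
    by (simp add: Basis_prod_def axis_in_Basis_iff)
  then have "negligible {p :: ('m, 'k) point. p \<bullet> (axis a 1, 0) = 0}"
    by (rule negligible_standard_hyperplane)
  then have "{p :: ('m, 'k) point. p \<bullet> (axis a 1, 0) = 0} \<in> null_sets lebesgue"
    by (simp add: negligible_iff_null_sets)
  then show ?thesis by (rule AE_I') (auto simp: inner_prod_def)
qed

lemma AE_neq_0: "AE p in (lebesgue :: ('m::finite, 'k::finite) point measure). p \<noteq> 0"
  using AE_fst_neq_0 by eventually_elim auto

text \<open>The components of \<open>X \<rho> / |X \<rho>|\<close>; the junk value 0 on \<open>\<psi> = 0\<close> is harmless, as \<open>X \<rho> = 0\<close> there.\<close>

definition ang :: "real \<Rightarrow> 'm + 'k \<Rightarrow> ('m::finite, 'k::finite) point \<Rightarrow> real" where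
  "ang \<gamma> i p = field_coef \<gamma> i p * drho \<gamma> i p / sqrt (psi \<gamma> p)"

lemma sqrt_psi_ang:
  assumes "\<gamma> > 0" "p \<noteq> 0"
  shows "sqrt (psi \<gamma> p) * ang \<gamma> i p = field_coef \<gamma> i p * drho \<gamma> i p"
proof (cases "psi \<gamma> p = 0")
  case True
  then have "(field_coef \<gamma> i p * drho \<gamma> i p)\<^sup>2 = 0"
    unfolding psi_eq_sum[OF assms] by (subst (asm) sum_nonneg_eq_0_iff) auto
  then show ?thesis by (auto simp: ang_def)
qed (simp add: ang_def)

text \<open>The sum equals \<open>psi \<gamma> p / psi \<gamma> p\<close>, which is 1, or 0 where
  \<open>psi\<close> vanishes.\<close>

lemma sum_ang_power2_le:
  assumes "\<gamma> > 0" "p \<noteq> 0"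
  shows "(\<Sum>i\<in>UNIV. (ang \<gamma> i p)\<^sup>2) \<le> 1"
proof -
  have "(\<Sum>i\<in>UNIV. (ang \<gamma> i p)\<^sup>2) = (\<Sum>i\<in>UNIV. (field_coef \<gamma> i p * drho \<gamma> i p)\<^sup>2) / psi \<gamma> p"
    by (simp add: ang_def power_divide sum_divide_distrib psi_nonneg)
  also have "\<dots> = psi \<gamma> p / psi \<gamma> p"
    by (simp only: psi_eq_sum[OF assms, symmetric])
  finally have "(\<Sum>i\<in>UNIV. (ang \<gamma> i p)\<^sup>2) = psi \<gamma> p / psi \<gamma> p" .
  then show ?thesis by simp
qed

lemma abs_ang_le_1:
  assumes "\<gamma> > 0" "p \<noteq> 0"
  shows "\<bar>ang \<gamma> i p\<bar> \<le> 1"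
proof -
  have "(ang \<gamma> i p)\<^sup>2 \<le> (\<Sum>i\<in>UNIV. (ang \<gamma> i p)\<^sup>2)" by (rule member_le_sum) auto
  then have "(ang \<gamma> i p)\<^sup>2 \<le> 1" using sum_ang_power2_le[OF assms] by linarith
  then show ?thesis by (simp add: abs_square_le_1)
qed

lemma ang_dil: "\<gamma> > 0 \<Longrightarrow> ang \<gamma> i (dil \<gamma> s p) = ang \<gamma> i p"
  by (simp add: ang_def psi_dil drho_dil)

section \<open>Test functions\<close>

lemma smooth_partial_deriv:
  assumes "smooth f" "v \<in> Basis"
  shows "smooth (partial_deriv v f)"
  unfolding smooth_def
proof (intro allI impI)
  fix vs :: "'a list" and p assume "set vs \<subseteq> Basis"
  \<comment> \<open>\<open>foldr\<close> applies the last entry first, so appending \<open>v\<close>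
    differentiates along \<open>v\<close> before the directions in \<open>vs\<close>.\<close>
  then have "foldr partial_deriv (vs @ [v]) f differentiable at p"
    using assms unfolding smooth_def by (metis Un_subset_iff empty_set insert_subset list.simps(15) empty_subsetI set_append)
  then show "foldr partial_deriv vs (partial_deriv v f) differentiable at p" by simp
qed

lemma smooth_differentiable: "smooth f \<Longrightarrow> f differentiable (at p)"
  unfolding smooth_def by (auto dest!: spec[of _ "[]"])

lemma smooth_continuous: "smooth f \<Longrightarrow> continuous_on A f"
  by (meson continuous_at_imp_continuous_on differentiable_imp_continuous_within smooth_differentiable)

lemma has_derivative_along:
  assumes D: "(f has_derivative D) (at (p + s *\<^sub>R v))"
  shows "((\<lambda>s. f (p + s *\<^sub>R v)) has_real_derivative D v) (at s)"
proof -
  have "((\<lambda>s. p + s *\<^sub>R v) has_derivative (\<lambda>h. h *\<^sub>R v)) (at s)"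
    by (auto intro!: derivative_eq_intros)
  from has_derivative_compose[OF this D]
  have "((\<lambda>s. f (p + s *\<^sub>R v)) has_derivative (\<lambda>h. D (h *\<^sub>R v))) (at s)" .
  moreover have "(\<lambda>h. D (h *\<^sub>R v)) = (*) (D v)"
    using linear_cmul[OF has_derivative_linear[OF D]] by (auto simp: mult.commute)
  ultimately show ?thesis by (simp add: has_field_derivative_def)
qed

lemma partial_deriv_eq:
  assumes "(f has_derivative D) (at p)"
  shows "partial_deriv v f p = D v"
  using has_derivative_along[of f D p 0 v] assms by (auto simp: partial_deriv_def intro: DERIV_imp_deriv)

lemma smooth_has_derivative:
  assumes "smooth f"
  shows "(f has_derivative (\<lambda>w. \<Sum>b\<in>Basis. (w \<bullet> b) * partial_deriv b f p)) (at p)"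
proof -
  obtain D where D: "(f has_derivative D) (at p)"
    using smooth_differentiable[OF assms] by (auto simp: differentiable_def)
  have "D w = (\<Sum>b\<in>Basis. (w \<bullet> b) * partial_deriv b f p)" for w
    using has_derivative_linear[OF D] partial_deriv_eq[OF D]
    by (subst euclidean_representation[of w, symmetric]) (simp add: linear_sum linear_cmul)
  then have "D = (\<lambda>w. \<Sum>b\<in>Basis. (w \<bullet> b) * partial_deriv b f p)" by auto
  with D show ?thesis by simp
qed

lemma smooth_has_partial_deriv:
  assumes "smooth f"
  shows "((\<lambda>s. f (p + s *\<^sub>R v)) has_real_derivative partial_deriv v f (p + s *\<^sub>R v)) (at s)"
proof -
  obtain D where D: "(f has_derivative D) (at (p + s *\<^sub>R v))"
    using smooth_differentiable[OF assms] by (auto simp: differentiable_def)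
  show ?thesis using has_derivative_along[OF D] by (simp add: partial_deriv_eq[OF D])
qed

lemma partial_deriv_outside_support:
  fixes f :: "'a::real_normed_vector \<Rightarrow> real"
  assumes "closed S" "\<And>p. p \<notin> S \<Longrightarrow> f p = 0" "p \<notin> S"
  shows "partial_deriv v f p = 0"
proof -
  have "eventually (\<lambda>q. q \<in> - S) (nhds p)"
    using assms by (intro eventually_nhds_in_open) auto
  moreover have "filterlim (\<lambda>s. p + s *\<^sub>R v) (nhds p) (nhds (0::real))"
    by (rule tendsto_eq_rhs, (rule tendsto_intros filterlim_ident)+) simp
  ultimately have "eventually (\<lambda>s. p + s *\<^sub>R v \<in> - S) (nhds (0::real))"
    by (rule eventually_compose_filterlim)
  then have "eventually (\<lambda>s. f (p + s *\<^sub>R v) = 0) (nhds (0::real))"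
    by eventually_elim (use assms in auto)
  then have "((\<lambda>s. f (p + s *\<^sub>R v)) has_real_derivative 0) (at 0)"
    by (subst DERIV_cong_ev[of 0 0 _ "\<lambda>_. 0" 0 0]) auto
  then show ?thesis by (auto simp: partial_deriv_def intro: DERIV_imp_deriv)
qed

text \<open>The factor \<open>h\<close> may be singular at the origin, but \<open>f\<close> vanishes
  on the open set \<open>- S\<close> around it; continuity is glued from the two open sets
  \<open>- {0}\<close> and \<open>- S\<close>.\<close>

lemma continuous_on_mult_away_0:
  fixes f h :: "'a::euclidean_space \<Rightarrow> real"
  assumes f: "continuous_on UNIV f" and h: "continuous_on (- {0}) h"
    and S: "closed S" "0 \<notin> S" "\<And>p. p \<notin> S \<Longrightarrow> f p = 0"
  shows "continuous_on UNIV (\<lambda>p. h p * f p)"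
proof -
  have 1: "continuous_on (- {0}) (\<lambda>p. h p * f p)"
    by (intro continuous_intros h continuous_on_subset[OF f]) auto
  have 2: "continuous_on (- S) (\<lambda>p. h p * f p)"
    by (rule continuous_on_eq[where f = "\<lambda>_. 0"]) (auto simp: S)
  have "continuous_on (- {0} \<union> - S) (\<lambda>p. h p * f p)"
    using S by (intro continuous_on_open_Un 1 2) auto
  moreover have "- {0} \<union> - S = UNIV" using S by auto
  ultimately show ?thesis by simp
qed

lemma sum_field_dir:
  fixes F :: "('m::finite, 'k::finite) point \<Rightarrow> real"
  shows "(\<Sum>b\<in>Basis. F b) = (\<Sum>i\<in>(UNIV :: ('m + 'k) set). F (field_dir i))"
proof -
  have "inj (field_dir :: 'm + 'k \<Rightarrow> ('m, 'k) point)"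
    by (rule injI) (auto simp: field_dir_def axis_eq_axis axis_eq_0_iff split: sum.splits)
  moreover have "range (field_dir :: 'm + 'k \<Rightarrow> ('m, 'k) point) = Basis"
  proof
    show "Basis \<subseteq> range (field_dir :: 'm + 'k \<Rightarrow> ('m, 'k) point)"
    proof
      fix b :: "('m, 'k) point" assume "b \<in> Basis"
      then consider a where "b = (axis a 1, 0)" | a where "b = (0, axis a 1)"
        by (auto simp: Basis_prod_def Basis_vec_def)
      then show "b \<in> range field_dir"
      proof cases
        case (1 a)
        then show ?thesis by (intro image_eqI[of _ _ "Inl a"]) (simp_all add: field_dir_def)
      next
        case (2 a)
        then show ?thesis by (intro image_eqI[of _ _ "Inr a"]) (simp_all add: field_dir_def)
      qed
    qed
  qed (auto simp: field_dir_in_Basis)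
  ultimately show ?thesis by (metis (no_types, lifting) sum.reindex_cong)
qed

text \<open>A smooth function whose compact support avoids the origin, so that products with weights
  singular there stay continuous.\<close>

locale test_fun =
  fixes \<gamma> :: real and f :: "('m::finite, 'k::finite) point \<Rightarrow> real" and S
  assumes gamma: "\<gamma> > 0" and smooth: "smooth f" and compact: "compact S" and zero: "0 \<notin> S"
    and support: "p \<notin> S \<Longrightarrow> f p = 0"
begin

lemma closed: "closed S"
  using compact by (rule compact_imp_closed)

abbreviation pd where "pd i \<equiv> partial_deriv (field_dir i) f"

lemma support_pd: "p \<notin> S \<Longrightarrow> pd i p = 0"
  by (rule partial_deriv_outside_support[OF closed]) (auto simp: support)

lemma smooth_pd: "smooth (pd i)"
  by (rule smooth_partial_deriv[OF smooth field_dir_in_Basis])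

lemma support_pd2: "p \<notin> S \<Longrightarrow> partial_deriv (field_dir i) (pd i) p = 0"
  by (rule partial_deriv_outside_support[OF closed]) (auto simp: support_pd)

lemma smooth_pd2: "smooth (partial_deriv (field_dir i) (pd i))"
  by (rule smooth_partial_deriv[OF smooth_pd field_dir_in_Basis])

lemma grushin_X2_eq:
  "grushin_X \<gamma> i (grushin_X \<gamma> i f) p = (field_coef \<gamma> i p)\<^sup>2 * partial_deriv (field_dir i) (pd i) p"
proof -
  have "((\<lambda>s. field_coef \<gamma> i p * pd i (p + s *\<^sub>R field_dir i)) has_real_derivative
      field_coef \<gamma> i p * partial_deriv (field_dir i) (pd i) (p + 0 *\<^sub>R field_dir i)) (at 0)"
    by (intro DERIV_cmult smooth_has_partial_deriv smooth_pd)
  then have "partial_deriv (field_dir i) (grushin_X \<gamma> i f) p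
      = field_coef \<gamma> i p * partial_deriv (field_dir i) (pd i) p"
    unfolding partial_deriv_def[of _ "grushin_X \<gamma> i f"]
    by (intro DERIV_imp_deriv) (simp add: grushin_X_eq field_coef_translate)
  then show ?thesis
    by (simp add: grushin_X_eq[of \<gamma> i "grushin_X \<gamma> i f"] power2_eq_square)
qed

lemma compact_dil_support: "compact (dil \<gamma> (- s) ` S)"
  by (intro compact_continuous_image compact continuous_intros)

lemma dil_support_zero: "0 \<notin> dil \<gamma> (- s) ` S"
  using zero by (auto simp: eq_commute[of 0])

lemma dil_support: "p \<notin> dil \<gamma> (- s) ` S \<Longrightarrow> dil \<gamma> s p \<notin> S"
  by (metis dil_0 dil_dil imageI add.commute add.right_inverse)

text \<open>Integration by parts against a radial weight times the dilated function
  \<open>f (dil \<gamma> s p)\<close>; the factor \<open>exp s\<close> is the degree-one homogeneity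
  of the fields. Letting \<open>s\<close> vary produces the correlations on which the whole estimate
  rests.\<close>

lemma Green_identity:
  assumes th: "\<And>r. r > 0 \<Longrightarrow> (\<theta> has_real_derivative \<theta>' r) (at r)" "continuous_on {0<..} \<theta>'"
  shows "(\<integral>p. grushin_op (\<lambda>i j. grushin_X \<gamma> i (grushin_X \<gamma> j f)) p * (\<theta> (rho \<gamma> p) * f (dil \<gamma> s p)) \<partial>lebesgue)
    = - (\<Sum>i\<in>UNIV. \<integral>p. grushin_X \<gamma> i f p *
         (\<theta>' (rho \<gamma> p) * (field_coef \<gamma> i p * drho \<gamma> i p) * f (dil \<gamma> s p)
            + \<theta> (rho \<gamma> p) * exp s * grushin_X \<gamma> i f (dil \<gamma> s p)) \<partial>lebesgue)"
proof -
  let ?T = "dil \<gamma> (- s) ` S"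
  have thc: "continuous_on {0<..} \<theta>"
    by (rule continuous_at_imp_continuous_on) (auto intro!: DERIV_isCont[OF th(1)])
  have comp: "continuous_on (- {0}) (\<lambda>p. h (rho \<gamma> p))" if "continuous_on {0<..} h" for h :: "real \<Rightarrow> real"
    by (rule continuous_on_compose2[OF that continuous_on_rho[OF gamma]]) (auto intro: rho_pos[OF gamma])
  define w where "w = (\<lambda>p. \<theta> (rho \<gamma> p) * f (dil \<gamma> s p))"
  \<comment> \<open>The ordinary partial derivative of \<open>w\<close> along
    \<open>field_dir i\<close>, without the field coefficient.\<close>
  define w' where "w' = (\<lambda>i p. \<theta>' (rho \<gamma> p) * drho \<gamma> i p * f (dil \<gamma> s p)
      + \<theta> (rho \<gamma> p) * (dil_coef \<gamma> s (field_dir i) * pd i (dil \<gamma> s p)))"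
  have w: "continuous_on UNIV w"
    unfolding w_def
    by (rule continuous_on_mult_away_0[OF _ comp[OF thc] compact_imp_closed[OF compact_dil_support] dil_support_zero])
       (auto intro!: continuous_on_compose2[OF smooth_continuous[OF smooth]] continuous_intros support dil_support)
  have w': "continuous_on UNIV (w' i)" for i
    unfolding w'_def
    by (intro continuous_on_add continuous_on_mult_away_0[OF _ _ compact_imp_closed[OF compact_dil_support] dil_support_zero]
        continuous_on_mult comp thc th continuous_on_drho gamma continuous_on_const
        continuous_on_compose2[OF smooth_continuous[OF smooth]] continuous_on_compose2[OF smooth_continuous[OF smooth_pd]] continuous_intros)
       (auto intro!: support support_pd dil_support)
  have wder: "((\<lambda>x. w (p + x *\<^sub>R field_dir i)) has_real_derivative w' i p) (at 0)" for i p
  proof (cases "p = 0")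
    case False
    have r: "((\<lambda>x. \<theta> (rho \<gamma> (p + x *\<^sub>R field_dir i))) has_real_derivative \<theta>' (rho \<gamma> p) * drho \<gamma> i p) (at 0)"
      using DERIV_chain2[of \<theta> "\<theta>' (rho \<gamma> p)" "\<lambda>x. rho \<gamma> (p + x *\<^sub>R field_dir i)" 0 "drho \<gamma> i p" UNIV]
        th(1)[OF rho_pos[OF gamma False]] rho_has_derivative_field_dir[OF gamma False, of i] by simp
    have "((\<lambda>x. f (dil \<gamma> s p + (x * dil_coef \<gamma> s (field_dir i)) *\<^sub>R field_dir i)) has_real_derivative
       pd i (dil \<gamma> s p) * dil_coef \<gamma> s (field_dir i)) (at 0)"
    proof -
      have "((\<lambda>x. x * dil_coef \<gamma> s (field_dir i)) has_real_derivative dil_coef \<gamma> s (field_dir i)) (at 0)"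
        by (auto intro!: derivative_eq_intros)
      moreover have "((\<lambda>x. f (dil \<gamma> s p + x *\<^sub>R field_dir i)) has_real_derivative pd i (dil \<gamma> s p))
          (at (0 * dil_coef \<gamma> s (field_dir i)))"
        using smooth_has_partial_deriv[OF smooth, of "dil \<gamma> s p" "field_dir i" 0] by simp
      ultimately show ?thesis by (rule DERIV_chain2[rotated])
    qed
    from DERIV_mult[OF r this] show ?thesis
      by (simp add: w_def w'_def dil_translate(2) ac_simps)
  next
    case True
    \<comment> \<open>The gauge need not be differentiable at the origin, but \<open>w\<close>
      vanishes in a whole neighbourhood of it.\<close>
    have "eventually (\<lambda>q. q \<in> - ?T) (nhds p)"
      using dil_support_zero True by (intro eventually_nhds_in_open open_Compl compact_imp_closed compact_dil_support) auto
    moreover have "filterlim (\<lambda>x. p + x *\<^sub>R field_dir i) (nhds p) (nhds (0::real))"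
      by (rule tendsto_eq_rhs, (rule tendsto_intros filterlim_ident)+) simp
    ultimately have "eventually (\<lambda>x. p + x *\<^sub>R field_dir i \<in> - ?T) (nhds (0::real))"
      by (rule eventually_compose_filterlim)
    then have "eventually (\<lambda>x. w (p + x *\<^sub>R field_dir i) = 0) (nhds (0::real))"
      by eventually_elim (auto simp: w_def support dil_support)
    then have "((\<lambda>x. w (p + x *\<^sub>R field_dir i)) has_real_derivative 0) (at 0)"
      by (subst DERIV_cong_ev[of 0 0 _ "\<lambda>_. 0" 0 0]) auto
    moreover have "w' i p = 0"
      using True zero by (simp add: w'_def support support_pd)
    ultimately show ?thesis by simp
  qed
  have cc: "continuous_on UNIV (\<lambda>p. (field_coef \<gamma> i p)\<^sup>2)" for i
    by (intro continuous_intros continuous_on_field_coef gamma)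
  have int: "integrable lebesgue (\<lambda>p. (field_coef \<gamma> i p)\<^sup>2 * (partial_deriv (field_dir i) (pd i) p * w p))"
    "integrable lebesgue (\<lambda>p. (field_coef \<gamma> i p)\<^sup>2 * (pd i p * w' i p))" for i
    by (rule integrable_continuous_compact_support[OF _ compact],
        (intro continuous_on_mult cc w w' smooth_continuous smooth_pd smooth_pd2),
        simp add: support_pd support_pd2)+
  have "(\<integral>p. (field_coef \<gamma> i p)\<^sup>2 * (partial_deriv (field_dir i) (pd i) p * w p)
      + (field_coef \<gamma> i p)\<^sup>2 * (pd i p * w' i p) \<partial>lebesgue) = 0" for i
  \<comment> \<open>The integrand is the derivative along \<open>field_dir i\<close> of the product
    of the squared coefficient, \<open>pd i\<close> and \<open>w\<close>; the squared coefficient is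
    constant in that direction.\<close>
  proof (rule integral_directional_derivative_eq_0[OF _ _ _ compact])
    show "continuous_on UNIV (\<lambda>p. (field_coef \<gamma> i p)\<^sup>2 * (pd i p * w p))"
      by (intro continuous_on_mult cc w smooth_continuous smooth_pd)
    show "continuous_on UNIV (\<lambda>p. (field_coef \<gamma> i p)\<^sup>2 * (partial_deriv (field_dir i) (pd i) p * w p)
      + (field_coef \<gamma> i p)\<^sup>2 * (pd i p * w' i p))"
      by (intro continuous_on_add continuous_on_mult cc w w' smooth_continuous smooth_pd smooth_pd2)
    show "((\<lambda>x. (field_coef \<gamma> i (p + x *\<^sub>R field_dir i))\<^sup>2 * (pd i (p + x *\<^sub>R field_dir i) * w (p + x *\<^sub>R field_dir i)))
       has_real_derivative (field_coef \<gamma> i p)\<^sup>2 * (partial_deriv (field_dir i) (pd i) p * w p)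
      + (field_coef \<gamma> i p)\<^sup>2 * (pd i p * w' i p)) (at 0)" for p
      unfolding field_coef_translate
      by (rule DERIV_cong[OF DERIV_cmult[OF DERIV_mult[OF smooth_has_partial_deriv[OF smooth_pd] wder]]])
         (simp add: algebra_simps)
  qed (auto simp: support_pd support_pd2)
  then have main: "(\<integral>p. (field_coef \<gamma> i p)\<^sup>2 * (partial_deriv (field_dir i) (pd i) p * w p) \<partial>lebesgue)
     = - (\<integral>p. (field_coef \<gamma> i p)\<^sup>2 * (pd i p * w' i p) \<partial>lebesgue)" for i
    by (subst (asm) Bochner_Integration.integral_add[OF int]) (simp add: eq_neg_iff_add_eq_0)
  have "(\<integral>p. grushin_op (\<lambda>i j. grushin_X \<gamma> i (grushin_X \<gamma> j f)) p * w p \<partial>lebesgue) =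
     (\<integral>p. (\<Sum>i\<in>UNIV. (field_coef \<gamma> i p)\<^sup>2 * (partial_deriv (field_dir i) (pd i) p * w p)) \<partial>lebesgue)"
    by (simp add: grushin_op_def grushin_X2_eq sum_distrib_right mult.assoc)
  also have "\<dots> = (\<Sum>i\<in>UNIV. - (\<integral>p. (field_coef \<gamma> i p)\<^sup>2 * (pd i p * w' i p) \<partial>lebesgue))"
    by (subst Bochner_Integration.integral_sum) (auto intro: int simp: main)
  also have "\<dots> = - (\<Sum>i\<in>UNIV. \<integral>p. grushin_X \<gamma> i f p *
         (\<theta>' (rho \<gamma> p) * (field_coef \<gamma> i p * drho \<gamma> i p) * f (dil \<gamma> s p)
            + \<theta> (rho \<gamma> p) * exp s * grushin_X \<gamma> i f (dil \<gamma> s p)) \<partial>lebesgue)"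
  proof -
    have "(field_coef \<gamma> i p)\<^sup>2 * (pd i p * w' i p) = grushin_X \<gamma> i f p *
         (\<theta>' (rho \<gamma> p) * (field_coef \<gamma> i p * drho \<gamma> i p) * f (dil \<gamma> s p)
            + \<theta> (rho \<gamma> p) * exp s * grushin_X \<gamma> i f (dil \<gamma> s p))" for i p
      using dil_translate(1)[of \<gamma> i p s] unfolding w'_def grushin_X_eq power2_eq_square by algebra
    then show ?thesis by (simp add: sum_negf)
  qed
  finally show ?thesis unfolding w_def .
qed

text \<open>The derivative of \<open>f\<close> along the generator of the dilations.\<close>

definition euler :: "('m, 'k) point \<Rightarrow> real" where
  "euler q = (\<Sum>b\<in>Basis. ((fst q, (\<gamma> + 1) *\<^sub>R snd q) \<bullet> b) * partial_deriv b f q)"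

lemma has_derivative_dil: "((\<lambda>s. f (dil \<gamma> s p)) has_real_derivative euler (dil \<gamma> s p)) (at s)"
proof -
  have "((\<lambda>s. dil \<gamma> s p) has_derivative
      (\<lambda>h. h *\<^sub>R (fst (dil \<gamma> s p), (\<gamma> + 1) *\<^sub>R snd (dil \<gamma> s p)))) (at s)"
    unfolding dil_def by (auto intro!: derivative_eq_intros simp: algebra_simps)
  from has_derivative_compose[OF this smooth_has_derivative[OF smooth]]
  show ?thesis
    unfolding has_field_derivative_def euler_def inner_scaleR_left
    by (simp only: sum_distrib_right[symmetric] mult.assoc sum_distrib_left[symmetric] mult_commute_abs)
qed

lemma continuous_on_euler: "continuous_on UNIV euler"
  unfolding euler_def
  by (intro continuous_on_sum continuous_on_mult continuous_intros smooth_continuous smooth_partial_deriv smooth)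

lemma support_euler: "p \<notin> S \<Longrightarrow> euler p = 0"
  unfolding euler_def by (simp add: partial_deriv_outside_support[OF closed support])

definition radial :: "('m, 'k) point \<Rightarrow> real" where
  "radial q = rho \<gamma> q * (\<Sum>i\<in>UNIV. field_coef \<gamma> i q * drho \<gamma> i q * grushin_X \<gamma> i f q)"

text \<open>The generator of the dilations contains derivatives in \<open>t\<close> without the
  degenerate coefficient, which the fields do not control where |z| is small. Multiplied by
  \<open>psi\<close> it becomes \<open>rho\<close> times the inner product of the field gradients of
  the gauge and of \<open>f\<close>; the identity holds for each direction separately.\<close>

lemma psi_euler: "psi \<gamma> q * euler q = radial q"
proof (cases "q = 0")
  case True
  then show ?thesis by (simp add: support_euler zero radial_def)
next
  case False
  have r: "rho \<gamma> q * rho \<gamma> q powr (- (2 * \<gamma> + 1)) = inverse (rho \<gamma> q powr (2 * \<gamma>))"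
    using rho_pos[OF gamma False] by (simp add: powr_diff powr_minus powr_add field_simps)
  have n: "norm (fst q) powr \<gamma> * norm (fst q) powr \<gamma> = norm (fst q) powr (2 * \<gamma>)"
    by (simp add: powr_add[symmetric])
  have "psi \<gamma> q * (((fst q, (\<gamma> + 1) *\<^sub>R snd q) \<bullet> field_dir i) * pd i q)
      = rho \<gamma> q * (field_coef \<gamma> i q * drho \<gamma> i q * grushin_X \<gamma> i f q)" for i
  proof (cases i)
    case (Inl a)
    then show ?thesis
      using r unfolding psi_eq[OF gamma False] grushin_X_eq drho_def
      by (simp add: field_dir_def field_coef_def inner_axis divide_inverse)
  next
    case (Inr b)
    have reg: "E * C = A * (D * (B * D))" if "A * B = C" "D * D = E" for A B C D E :: real
      by (simp add: that[symmetric] ac_simps)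
    from Inr show ?thesis
      using r n unfolding psi_eq[OF gamma False] grushin_X_eq drho_def
      by (simp add: field_dir_def field_coef_def inner_axis divide_inverse) (auto intro!: disjI2 reg)
  qed
  then show ?thesis
    unfolding euler_def radial_def sum_field_dir sum_distrib_left by simp
qed

text \<open>Differentiating under the integral produces \<open>euler\<close> at the dilated point.
  As \<open>psi\<close> is invariant under dilations, the factor \<open>psi\<close> in the weight
  can be evaluated there too and turns \<open>euler\<close> into \<open>radial\<close>.\<close>

lemma correlation_has_derivative:
  assumes \<Theta>: "continuous_on (- {0}) \<Theta>"
  shows "((\<lambda>s. \<integral>p. psi \<gamma> p * \<Theta> p * f p * f (dil \<gamma> s p) \<partial>lebesgue) has_real_derivative
     (\<integral>p. \<Theta> p * f p * radial (dil \<gamma> s p) \<partial>lebesgue)) (at s)"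
proof -
  have c: "continuous_on UNIV (\<lambda>p. psi \<gamma> p * \<Theta> p * f p)"
    by (rule continuous_on_mult_away_0[OF smooth_continuous[OF smooth] continuous_on_mult[OF continuous_on_psi[OF gamma] \<Theta>] closed zero support])
  obtain B1 where B1: "0 \<le> B1" "\<And>p. \<bar>psi \<gamma> p * \<Theta> p * f p\<bar> \<le> B1"
    by (rule continuous_compact_support_bounded[OF c compact]) (auto simp: support)
  obtain B2 where B2: "0 \<le> B2" "\<And>p. \<bar>euler p\<bar> \<le> B2"
    by (rule continuous_compact_support_bounded[OF continuous_on_euler compact support_euler]) auto
  have "((\<lambda>r. \<integral>p. psi \<gamma> p * \<Theta> p * f p * f (dil \<gamma> (s + r) p) \<partial>lebesgue) has_real_derivative
     (\<integral>p. psi \<gamma> p * \<Theta> p * f p * euler (dil \<gamma> (s + 0) p) \<partial>lebesgue)) (at 0)"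
  proof (rule has_real_derivative_integral[where d = 1 and D = "\<lambda>p. B1 * B2 * indicator S p"])
    fix r
    show "integrable lebesgue (\<lambda>p. psi \<gamma> p * \<Theta> p * f p * f (dil \<gamma> (s + r) p))"
      by (rule integrable_continuous_compact_support[OF _ compact])
         (auto intro!: continuous_on_mult c continuous_on_compose2[OF smooth_continuous[OF smooth, of UNIV]] continuous_intros simp: support)
    fix p
    have "((\<lambda>r. f (dil \<gamma> (s + r) p)) has_real_derivative euler (dil \<gamma> (s + r) p)) (at r)"
      using has_derivative_dil[of p "s + r"] by (simp add: DERIV_shift add.commute)
    then show "((\<lambda>r. psi \<gamma> p * \<Theta> p * f p * f (dil \<gamma> (s + r) p)) has_real_derivative
        psi \<gamma> p * \<Theta> p * f p * euler (dil \<gamma> (s + r) p)) (at r)"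
      by (rule DERIV_cmult)
    show "\<bar>psi \<gamma> p * \<Theta> p * f p * euler (dil \<gamma> (s + r) p)\<bar> \<le> B1 * B2 * indicator S p"
    proof (cases "p \<in> S")
      case True
      then show ?thesis
        using mult_mono[OF B1(2)[of p] B2(2)[of "dil \<gamma> (s + r) p"]] B1(1) by (simp add: abs_mult)
    qed (simp add: support)
  next
    have "integrable lborel (\<lambda>p. indicator S p *\<^sub>R (B1 * B2))"
      by (intro borel_integrable_compact compact) auto
    then show "integrable lebesgue (\<lambda>p. B1 * B2 * indicator S p)"
      by (auto simp: mult.commute integrable_completion borel_measurable_integrable)
  qed simp
  then have "((\<lambda>s. \<integral>p. psi \<gamma> p * \<Theta> p * f p * f (dil \<gamma> s p) \<partial>lebesgue) has_real_derivative
     (\<integral>p. psi \<gamma> p * \<Theta> p * f p * euler (dil \<gamma> s p) \<partial>lebesgue)) (at s)"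
    using DERIV_shift[of "\<lambda>s. \<integral>p. psi \<gamma> p * \<Theta> p * f p * f (dil \<gamma> s p) \<partial>lebesgue" _ 0 s] by (simp add: add.commute)
  moreover have "psi \<gamma> p * \<Theta> p * f p * euler (dil \<gamma> s p) = \<Theta> p * f p * radial (dil \<gamma> s p)" for p
    by (simp add: psi_euler[symmetric] psi_dil[OF gamma])
  ultimately show ?thesis by simp
qed

end

section \<open>Passage to the limit\<close>

context test_fun
begin

lemma sq_integrable_f: "sq_integrable lebesgue f"
  by (rule sq_integrable_continuous_compact_support[OF smooth_continuous[OF smooth] compact support])

lemma sq_integrable_X: "sq_integrable lebesgue (grushin_X \<gamma> i f)"
  unfolding grushin_X_eq[abs_def]
  by (rule sq_integrable_continuous_compact_support[OF _ compact])
     (auto intro!: continuous_on_mult continuous_on_field_coef gamma smooth_continuous[OF smooth_pd] simp: support_pd)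

lemma sq_integrable_X2: "sq_integrable lebesgue (grushin_X \<gamma> i (grushin_X \<gamma> i f))"
  unfolding grushin_X2_eq[abs_def]
  by (rule sq_integrable_continuous_compact_support[OF _ compact])
     (auto intro!: continuous_on_mult continuous_on_power continuous_on_field_coef gamma smooth_continuous[OF smooth_pd2] simp: support_pd2)

lemma support_X: "p \<notin> S \<Longrightarrow> grushin_X \<gamma> i f p = 0"
  by (simp add: grushin_X_eq support_pd)

lemma support_X2: "p \<notin> S \<Longrightarrow> grushin_X \<gamma> i (grushin_X \<gamma> i f) p = 0"
  by (simp add: grushin_X2_eq support_pd2)

lemma sq_integrable_B: "sq_integrable lebesgue (grushin_op (\<lambda>i j. grushin_X \<gamma> i (grushin_X \<gamma> j f)))"
  unfolding grushin_op_def[abs_def] by (intro sq_integrable_sum sq_integrable_X2)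

lemma support_B: "p \<notin> S \<Longrightarrow> grushin_op (\<lambda>i j. grushin_X \<gamma> i (grushin_X \<gamma> j f)) p = 0"
  by (simp add: grushin_op_def support_X2)

end

section \<open>From the Sobolev completion to limits in the space of square integrable
  functions\<close>

lemma sq_integrable_L2_on:
  assumes "u \<in> L2_on \<Omega>"
  shows "sq_integrable lebesgue (\<lambda>p. indicator \<Omega> p * u p)"
proof -
  have m: "(\<lambda>p. indicator \<Omega> p * u p) \<in> borel_measurable lebesgue"
    using assms by (simp add: L2_on_def set_borel_measurable_def)
  have "(\<integral>\<^sup>+p. ennreal ((indicator \<Omega> p * u p)\<^sup>2) \<partial>lebesgue) = (\<integral>\<^sup>+ p \<in> \<Omega>. ennreal ((u p)\<^sup>2) \<partial>lebesgue)"
    by (intro nn_integral_cong) (auto simp: indicator_def)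
  also have "\<dots> < \<infinity>" using assms by (simp add: L2_on_def)
  finally have "integrable lebesgue (\<lambda>p. (indicator \<Omega> p * u p)\<^sup>2)"
    using m by (intro integrableI_bounded) auto
  with m show ?thesis by (simp add: sq_integrable_def)
qed

text \<open>The test functions vanish outside \<Omega>, so convergence in \<Omega> becomes
  convergence on the whole space once the limits are extended by zero. The diagonal second
  derivatives are collected into \<open>grushin_op\<close>.\<close>

lemma S22_0_approximation:
  fixes u :: "('m::finite, 'k::finite) point \<Rightarrow> real"
  assumes g: "\<gamma> > 0" and u: "S22_0 \<gamma> \<Omega> u V W" and \<Omega>: "0 \<notin> \<Omega>"
  obtains f S where "\<And>n. test_fun \<gamma> (f n) (S n)" "\<And>n. S n \<subseteq> \<Omega>"
    "(\<lambda>n. l2norm lebesgue (\<lambda>p. f n p - indicator \<Omega> p * u p)) \<longlonglongrightarrow> 0"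
    "\<And>i. (\<lambda>n. l2norm lebesgue (\<lambda>p. grushin_X \<gamma> i (f n) p - indicator \<Omega> p * V i p)) \<longlonglongrightarrow> 0"
    "(\<lambda>n. l2norm lebesgue (\<lambda>p. grushin_op (\<lambda>i j. grushin_X \<gamma> i (grushin_X \<gamma> j (f n))) p
        - indicator \<Omega> p * grushin_op W p)) \<longlonglongrightarrow> 0"
proof -
  let ?N = "\<lambda>f. S22_norm_sq \<Omega> (\<lambda>p. f p - u p) (\<lambda>i p. grushin_X \<gamma> i f p - V i p)
                  (\<lambda>i j p. grushin_X \<gamma> i (grushin_X \<gamma> j f) p - W i j p)"
  from u obtain f where f: "\<And>n. f n \<in> test_functions \<Omega>" and lim: "(\<lambda>n. ?N (f n)) \<longlonglongrightarrow> 0"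
    unfolding S22_0_def by blast
  note L2 = u[unfolded S22_0_def]
  define S where "S = (\<lambda>n. closure {p. f n p \<noteq> 0})"
  have S: "S n \<subseteq> \<Omega>" for n using f[of n] by (simp add: test_functions_def S_def)
  have t: "test_fun \<gamma> (f n) (S n)" for n
  proof
    show "p \<notin> S n \<Longrightarrow> f n p = 0" for p
      unfolding S_def using closure_subset[of "{p. f n p \<noteq> 0}"] by auto
  qed (use f[of n] g S[of n] \<Omega> in \<open>auto simp: test_functions_def S_def\<close>)
  \<comment> \<open>Outside \<Omega> both functions vanish, and inside \<Omega> the integrand is one
    of the terms of the squared Sobolev norm.\<close>
  have le: "(\<integral>\<^sup>+p. ennreal ((h p - indicator \<Omega> p * k p)\<^sup>2) \<partial>lebesgue) \<le> ?N (f n)"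
    if h: "\<And>p. p \<notin> S n \<Longrightarrow> h p = 0"
      and hk: "\<And>p. (h p - k p)\<^sup>2 \<le> (f n p - u p)\<^sup>2 + sq_length (\<lambda>i p. grushin_X \<gamma> i (f n) p - V i p) p
         + (\<Sum>i\<in>UNIV. \<Sum>j\<in>UNIV. (grushin_X \<gamma> i (grushin_X \<gamma> j (f n)) p - W i j p)\<^sup>2)" for n h k
    unfolding S22_norm_sq_def
  proof (rule nn_integral_mono)
    fix p
    show "ennreal ((h p - indicator \<Omega> p * k p)\<^sup>2) \<le>
      ennreal ((f n p - u p)\<^sup>2 + sq_length (\<lambda>i p. grushin_X \<gamma> i (f n) p - V i p) p
         + (\<Sum>i\<in>UNIV. \<Sum>j\<in>UNIV. (grushin_X \<gamma> i (grushin_X \<gamma> j (f n)) p - W i j p)\<^sup>2)) * indicator \<Omega> p"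
      using hk[of p] h[of p] S[of n] by (cases "p \<in> \<Omega>") (auto intro!: ennreal_leI)
  qed
  have sq_nonneg: "0 \<le> sq_length X p" for X :: "'m + 'k \<Rightarrow> ('m, 'k) point \<Rightarrow> real" and p
    by (simp add: sq_length_def sum_nonneg)
  have dbl: "0 \<le> (\<Sum>i\<in>UNIV. \<Sum>j\<in>UNIV. (X i j)\<^sup>2)" for X :: "'m + 'k \<Rightarrow> 'm + 'k \<Rightarrow> real"
    by (intro sum_nonneg) auto
  have U: "(\<lambda>n. l2norm lebesgue (\<lambda>p. f n p - indicator \<Omega> p * u p)) \<longlonglongrightarrow> 0"
    using L2 by (intro l2norm_tendsto_0[OF _ le lim] sq_integrable_diff test_fun.sq_integrable_f[OF t] sq_integrable_L2_on
        test_fun.support[OF t]) (auto simp: sq_nonneg dbl)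
  have X: "(\<lambda>n. l2norm lebesgue (\<lambda>p. grushin_X \<gamma> i (f n) p - indicator \<Omega> p * V i p)) \<longlonglongrightarrow> 0" for i
  proof (intro l2norm_tendsto_0[OF _ le lim] sq_integrable_diff test_fun.sq_integrable_X[OF t] sq_integrable_L2_on
        test_fun.support_X[OF t])
    fix n p
    have "(grushin_X \<gamma> i (f n) p - V i p)\<^sup>2 \<le> sq_length (\<lambda>i p. grushin_X \<gamma> i (f n) p - V i p) p"
      unfolding sq_length_def by (rule member_le_sum) auto
    then show "(grushin_X \<gamma> i (f n) p - V i p)\<^sup>2 \<le> (f n p - u p)\<^sup>2
        + sq_length (\<lambda>i p. grushin_X \<gamma> i (f n) p - V i p) p
        + (\<Sum>i\<in>UNIV. \<Sum>j\<in>UNIV. (grushin_X \<gamma> i (grushin_X \<gamma> j (f n)) p - W i j p)\<^sup>2)"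
      using dbl by (simp add: add_increasing add_increasing2)
  qed (use L2 in auto)
  have sqW: "sq_integrable lebesgue (\<lambda>p. grushin_X \<gamma> i (grushin_X \<gamma> i (f n)) p - indicator \<Omega> p * W i i p)" for i n
    using L2 by (intro sq_integrable_diff test_fun.sq_integrable_X2[OF t] sq_integrable_L2_on) auto
  have X2: "(\<lambda>n. l2norm lebesgue (\<lambda>p. grushin_X \<gamma> i (grushin_X \<gamma> i (f n)) p - indicator \<Omega> p * W i i p)) \<longlonglongrightarrow> 0" for i
  proof (intro l2norm_tendsto_0[OF sqW le lim] test_fun.support_X2[OF t])
    fix n p
    have "(grushin_X \<gamma> i (grushin_X \<gamma> i (f n)) p - W i i p)\<^sup>2 \<le>
        (\<Sum>j\<in>UNIV. (grushin_X \<gamma> i (grushin_X \<gamma> j (f n)) p - W i j p)\<^sup>2)"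
      by (rule member_le_sum[where f = "\<lambda>j. (grushin_X \<gamma> i (grushin_X \<gamma> j (f n)) p - W i j p)\<^sup>2"]) auto
    also have "\<dots> \<le> (\<Sum>i\<in>UNIV. \<Sum>j\<in>UNIV. (grushin_X \<gamma> i (grushin_X \<gamma> j (f n)) p - W i j p)\<^sup>2)"
      by (rule member_le_sum) (auto intro: sum_nonneg)
    finally show "(grushin_X \<gamma> i (grushin_X \<gamma> i (f n)) p - W i i p)\<^sup>2 \<le> (f n p - u p)\<^sup>2
        + sq_length (\<lambda>i p. grushin_X \<gamma> i (f n) p - V i p) p
        + (\<Sum>i\<in>UNIV. \<Sum>j\<in>UNIV. (grushin_X \<gamma> i (grushin_X \<gamma> j (f n)) p - W i j p)\<^sup>2)"
      using sq_nonneg by (simp add: add_increasing add_increasing2)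
  qed
  have B: "(\<lambda>n. l2norm lebesgue (\<lambda>p. grushin_op (\<lambda>i j. grushin_X \<gamma> i (grushin_X \<gamma> j (f n))) p
        - indicator \<Omega> p * grushin_op W p)) \<longlonglongrightarrow> 0"
  proof (rule Lim_null_comparison)
    have "l2norm lebesgue (\<lambda>p. grushin_op (\<lambda>i j. grushin_X \<gamma> i (grushin_X \<gamma> j (f n))) p - indicator \<Omega> p * grushin_op W p)
      = l2norm lebesgue (\<lambda>p. \<Sum>i\<in>UNIV. grushin_X \<gamma> i (grushin_X \<gamma> i (f n)) p - indicator \<Omega> p * W i i p)" for n
      by (simp add: grushin_op_def sum_subtractf sum_distrib_left)
    then show "\<forall>\<^sub>F n in sequentially. norm (l2norm lebesgue (\<lambda>p. grushin_op (\<lambda>i j. grushin_X \<gamma> i (grushin_X \<gamma> j (f n))) p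
        - indicator \<Omega> p * grushin_op W p)) \<le>
       (\<Sum>i\<in>UNIV. l2norm lebesgue (\<lambda>p. grushin_X \<gamma> i (grushin_X \<gamma> i (f n)) p - indicator \<Omega> p * W i i p))"
      using l2norm_sum_le[of UNIV lebesgue "\<lambda>i p. grushin_X \<gamma> i (grushin_X \<gamma> i (f n)) p - indicator \<Omega> p * W i i p" for n] sqW
      by simp
    show "(\<lambda>n. \<Sum>i\<in>UNIV. l2norm lebesgue (\<lambda>p. grushin_X \<gamma> i (grushin_X \<gamma> i (f n)) p - indicator \<Omega> p * W i i p)) \<longlonglongrightarrow> 0"
      using tendsto_sum[OF X2] by simp
  qed
  show ?thesis by (rule that[OF t S U X B])
qed

text \<open>Converts the topological statement that the origin lies outside the support into a lower
  bound for the gauge.\<close>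

lemma gauge_ball_small:
  assumes g: "\<gamma> > 0" and U: "open U" "(0 :: ('m::finite, 'k::finite) point) \<in> U"
  obtains r where "r > 0" "gauge_ball \<gamma> r \<subseteq> U"
proof -
  obtain e where e: "e > 0" "ball 0 e \<subseteq> U" using U by (meson open_contains_ball)
  \<comment> \<open>With \<open>r\<close> at most 1 the bound on the \<open>t\<close> part is at
    most \<open>rho \<gamma> p\<close>, so the norm is at most twice the gauge and hence below
    \<open>e\<close>.\<close>
  define r where "r = min 1 (e / 2)"
  have "p \<in> ball 0 e" if "rho \<gamma> p < r" for p :: "('m, 'k) point"
  proof -
    have "rho \<gamma> p powr (\<gamma> + 1) \<le> rho \<gamma> p"
      using that g powr_mono'[of 1 "\<gamma> + 1" "rho \<gamma> p"] by (simp add: r_def)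
    then have "norm p \<le> rho \<gamma> p + rho \<gamma> p"
      using norm_fst_le_rho[OF g, of p] norm_snd_le_rho[OF g, of p] norm_Pair_le[of "fst p" "snd p"] by simp
    with that show ?thesis by (simp add: r_def)
  qed
  then show ?thesis
    using e by (intro that[of r]) (auto simp: gauge_ball_def r_def)
qed

text \<open>Here \<open>u\<close>, \<open>V\<close> and \<open>F\<close> stand for the function, its
  field derivatives and its image under the operator, all extended by zero and known as joint limits
  of test functions. Each support \<open>S n\<close> avoids the origin, but the supports may
  approach it as \<open>n\<close> grows; only the limit \<open>u\<close> is known to vanish for
  \<open>rho \<gamma> p < r0\<close>.\<close>

locale grushin_limit =
  fixes \<gamma> R r0 :: real and u :: "('m::finite, 'k::finite) point \<Rightarrow> real"
    and V :: "'m + 'k \<Rightarrow> ('m, 'k) point \<Rightarrow> real" and F f S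
  assumes gamma: "\<gamma> > 0" and R: "R > 0" and r0: "r0 > 0"
    and test: "\<And>n. test_fun \<gamma> (f n) (S n)" and S: "\<And>n. S n \<subseteq> gauge_ball \<gamma> R"
    and sq_u: "sq_integrable lebesgue u" and sq_V: "\<And>i. sq_integrable lebesgue (V i)"
    and sq_F: "sq_integrable lebesgue F"
    and lim_u: "(\<lambda>n. l2norm lebesgue (\<lambda>p. f n p - u p)) \<longlonglongrightarrow> 0"
    and lim_V: "\<And>i. (\<lambda>n. l2norm lebesgue (\<lambda>p. grushin_X \<gamma> i (f n) p - V i p)) \<longlonglongrightarrow> 0"
    and lim_F: "(\<lambda>n. l2norm lebesgue (\<lambda>p. grushin_op (\<lambda>i j. grushin_X \<gamma> i (grushin_X \<gamma> j (f n))) p - F p)) \<longlonglongrightarrow> 0"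
    and out_u: "\<And>p. R \<le> rho \<gamma> p \<Longrightarrow> u p = 0" and out_V: "\<And>p i. R \<le> rho \<gamma> p \<Longrightarrow> V i p = 0"
    and out_F: "\<And>p. R \<le> rho \<gamma> p \<Longrightarrow> F p = 0"
    and near_u: "AE p in lebesgue. rho \<gamma> p < r0 \<longrightarrow> u p = 0"
begin

lemma outS: "R \<le> rho \<gamma> p \<Longrightarrow> p \<notin> S n"
  using S[of n] by (auto simp: gauge_ball_def)

lemma measurable_lebesgue[measurable]:
  fixes i :: "'m + 'k"
  shows "(rho \<gamma> :: ('m, 'k) point \<Rightarrow> real) \<in> borel_measurable lebesgue" "field_coef \<gamma> i \<in> borel_measurable lebesgue"
  "drho \<gamma> i \<in> borel_measurable lebesgue"
  by (auto intro!: measurable_completion simp: borel_measurable_rho borel_measurable_field_coef borel_measurable_drho gamma)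

lemma measurable_uVF[measurable]:
  "u \<in> borel_measurable lebesgue" "V i \<in> borel_measurable lebesgue" "F \<in> borel_measurable lebesgue"
  "(\<lambda>p. u (dil \<gamma> s p)) \<in> borel_measurable lebesgue" "(\<lambda>p. V i (dil \<gamma> s p)) \<in> borel_measurable lebesgue"
  by (intro borel_measurable_dil sq_integrable_measurable sq_u sq_V sq_F)+

lemma weight_sq_integrable:
  assumes h: "h \<in> borel_measurable borel" and M: "\<And>p. p \<noteq> 0 \<Longrightarrow> rho \<gamma> p < R \<Longrightarrow> \<bar>h p\<bar> \<le> M"
    and H: "sq_integrable lebesgue H" "\<And>p. R \<le> rho \<gamma> p \<Longrightarrow> H p = 0"
  shows "sq_integrable lebesgue (\<lambda>p. h p * (H p :: real))"
proof (rule sq_integrable_bound[OF H(1), where C = M])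
  note [measurable] = H(1)
  have [measurable]: "h \<in> borel_measurable lebesgue"
    using h by (intro measurable_completion) simp
  show "(\<lambda>p. h p * H p) \<in> borel_measurable lebesgue" by measurable
  have "\<bar>h p * H p\<bar> \<le> M * \<bar>H p\<bar>" if "p \<noteq> 0" for p
    using M[OF that] H(2)[of p] by (cases "rho \<gamma> p < R") (simp_all add: abs_mult mult_right_mono)
  then show "AE p in lebesgue. \<bar>h p * H p\<bar> \<le> M * \<bar>H p\<bar>"
    using AE_neq_0 by (auto elim!: eventually_mono)
qed

lemma weight_limit:
  assumes h: "h \<in> borel_measurable borel" and M: "\<And>p. p \<noteq> 0 \<Longrightarrow> rho \<gamma> p < R \<Longrightarrow> \<bar>h p\<bar> \<le> M" "0 \<le> M"
    and H: "sq_integrable lebesgue H" "\<And>p. R \<le> rho \<gamma> p \<Longrightarrow> H p = 0"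
    and Hn: "\<And>n. sq_integrable lebesgue (Hn n)" "\<And>p n. R \<le> rho \<gamma> p \<Longrightarrow> Hn n p = 0"
    and lim: "(\<lambda>n. l2norm lebesgue (\<lambda>p. Hn n p - H p)) \<longlonglongrightarrow> 0"
  shows "(\<lambda>n. l2norm lebesgue (\<lambda>p. h p * Hn n p - h p * (H p :: real))) \<longlonglongrightarrow> 0"
proof (rule l2norm_zero_limit[OF lim M(2)])
  fix n
  have "\<bar>h p * Hn n p - h p * H p\<bar> \<le> M * \<bar>Hn n p - H p\<bar>" if "p \<noteq> 0" for p
    using M(1)[OF that] H(2)[of p] Hn(2)[of p n]
    by (cases "rho \<gamma> p < R") (simp_all add: right_diff_distrib[symmetric] abs_mult mult_right_mono)
  then show "AE p in lebesgue. \<bar>h p * Hn n p - h p * H p\<bar> \<le> M * \<bar>Hn n p - H p\<bar>"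
    using AE_neq_0 by (auto elim!: eventually_mono)
qed (intro sq_integrable_diff Hn H)

lemma dil_limit:
  fixes H :: "('m, 'k) point \<Rightarrow> real"
  assumes H: "sq_integrable lebesgue H" "\<And>n. sq_integrable lebesgue (Hn n)"
    and lim: "(\<lambda>n. l2norm lebesgue (\<lambda>p. Hn n p - H p)) \<longlonglongrightarrow> 0"
  shows "(\<lambda>n. l2norm lebesgue (\<lambda>p. Hn n (dil \<gamma> s p) - H (dil \<gamma> s p))) \<longlonglongrightarrow> 0"
proof -
  have "(\<lambda>p. Hn n p - H p) \<in> borel_measurable lebesgue" for n
    by (rule sq_integrable_measurable[OF sq_integrable_diff[OF H(2,1)]])
  from l2norm_dil[OF this, where \<gamma> = \<gamma> and s = s]
  have "(\<lambda>n. l2norm lebesgue (\<lambda>p. Hn n (dil \<gamma> s p) - H (dil \<gamma> s p))) =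
     (\<lambda>n. exp (- hom_dim CARD('m) CARD('k) \<gamma> * s / 2) * l2norm lebesgue (\<lambda>p. Hn n p - H p))"
    by simp
  then show ?thesis using tendsto_mult_left[OF lim] by simp
qed

text \<open>Every integral in \<open>Green_identity\<close> pairs a weighted convergent sequence
  with a dilated convergent one. The bounds on \<theta> and its derivative keep the weighted
  sequences convergent although the supports may reach towards the origin.\<close>

lemma weak_identity:
  assumes th: "\<And>r. r > 0 \<Longrightarrow> (\<theta> has_real_derivative \<theta>' r) (at r)" "continuous_on {0<..} \<theta>'"
    and M: "\<And>r. 0 < r \<Longrightarrow> r < R \<Longrightarrow> \<bar>\<theta> r\<bar> \<le> M" "\<And>r. 0 < r \<Longrightarrow> r < R \<Longrightarrow> \<bar>\<theta>' r\<bar> \<le> M"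
  shows "(\<integral>p. (\<theta> (rho \<gamma> p) * F p) * u (dil \<gamma> s p) \<partial>lebesgue) =
    - (\<Sum>i\<in>UNIV. (\<integral>p. (\<theta>' (rho \<gamma> p) * (field_coef \<gamma> i p * drho \<gamma> i p) * V i p) * u (dil \<gamma> s p) \<partial>lebesgue)
       + exp s * (\<integral>p. (\<theta> (rho \<gamma> p) * V i p) * V i (dil \<gamma> s p) \<partial>lebesgue))"
proof -
  have M0: "0 \<le> M" using M(1)[of "R / 2"] R by auto
  have thc: "continuous_on {0<..} \<theta>"
    by (rule continuous_at_imp_continuous_on) (auto intro!: DERIV_isCont[OF th(1)])
  have comp: "continuous_on (- {0}) (\<lambda>p. h (rho \<gamma> p))" if "continuous_on {0<..} h" for h :: "real \<Rightarrow> real"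
    by (rule continuous_on_compose2[OF that continuous_on_rho[OF gamma]]) (auto intro: rho_pos[OF gamma])
  have m1: "(\<lambda>p. \<theta> (rho \<gamma> p)) \<in> borel_measurable borel"
    by (intro borel_measurable_away_0 comp thc)
  have m2: "(\<lambda>p. \<theta>' (rho \<gamma> p) * (field_coef \<gamma> i p * drho \<gamma> i p)) \<in> borel_measurable borel" for i
    by (intro borel_measurable_away_0 comp th continuous_on_mult continuous_on_field_coef continuous_on_drho gamma)
  have b1: "\<bar>\<theta> (rho \<gamma> p)\<bar> \<le> M" if "p \<noteq> 0" "rho \<gamma> p < R" for p
    using M that rho_pos[OF gamma that(1)] by auto
  have b2: "\<bar>\<theta>' (rho \<gamma> p) * (field_coef \<gamma> i p * drho \<gamma> i p)\<bar> \<le> M" if "p \<noteq> 0" "rho \<gamma> p < R" for p i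
    using mult_mono[OF M(2)[OF rho_pos[OF gamma that(1)] that(2)] abs_field_coef_drho_le_1[OF gamma that(1)], of i] M0
    by (simp add: abs_mult)
  note out = test_fun.support_B[OF test outS] test_fun.support_X[OF test outS]
  note sqn = test_fun.sq_integrable_B[OF test] test_fun.sq_integrable_X[OF test] test_fun.sq_integrable_f[OF test]
  have L: "(\<lambda>n. \<integral>p. (\<theta> (rho \<gamma> p) * grushin_op (\<lambda>i j. grushin_X \<gamma> i (grushin_X \<gamma> j (f n))) p) * f n (dil \<gamma> s p) \<partial>lebesgue)
    \<longlonglongrightarrow> (\<integral>p. (\<theta> (rho \<gamma> p) * F p) * u (dil \<gamma> s p) \<partial>lebesgue)"
    by (intro l2_pairing_tendsto weight_sq_integrable[OF m1 b1] weight_limit[OF m1 b1 M0] sq_integrable_dil dil_limit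
        sq_F sq_u lim_u lim_F sqn out out_F)
  have R1: "(\<lambda>n. \<integral>p. (\<theta>' (rho \<gamma> p) * (field_coef \<gamma> i p * drho \<gamma> i p) * grushin_X \<gamma> i (f n) p) * f n (dil \<gamma> s p) \<partial>lebesgue)
    \<longlonglongrightarrow> (\<integral>p. (\<theta>' (rho \<gamma> p) * (field_coef \<gamma> i p * drho \<gamma> i p) * V i p) * u (dil \<gamma> s p) \<partial>lebesgue)" for i
    by (intro l2_pairing_tendsto weight_sq_integrable[OF m2 b2] weight_limit[OF m2 b2 M0] sq_integrable_dil dil_limit
        sq_V sq_u lim_u lim_V sqn out out_V)
  have R2: "(\<lambda>n. \<integral>p. (\<theta> (rho \<gamma> p) * grushin_X \<gamma> i (f n) p) * grushin_X \<gamma> i (f n) (dil \<gamma> s p) \<partial>lebesgue)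
    \<longlonglongrightarrow> (\<integral>p. (\<theta> (rho \<gamma> p) * V i p) * V i (dil \<gamma> s p) \<partial>lebesgue)" for i
    by (intro l2_pairing_tendsto weight_sq_integrable[OF m1 b1] weight_limit[OF m1 b1 M0] sq_integrable_dil dil_limit
        sq_V lim_V sqn out out_V)
  have eq: "(\<integral>p. (\<theta> (rho \<gamma> p) * grushin_op (\<lambda>i j. grushin_X \<gamma> i (grushin_X \<gamma> j (f n))) p) * f n (dil \<gamma> s p) \<partial>lebesgue)
    = - (\<Sum>i\<in>UNIV. (\<integral>p. (\<theta>' (rho \<gamma> p) * (field_coef \<gamma> i p * drho \<gamma> i p) * grushin_X \<gamma> i (f n) p) * f n (dil \<gamma> s p) \<partial>lebesgue)
       + exp s * (\<integral>p. (\<theta> (rho \<gamma> p) * grushin_X \<gamma> i (f n) p) * grushin_X \<gamma> i (f n) (dil \<gamma> s p) \<partial>lebesgue))" (is "?L = - sum ?A UNIV") for n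
  proof -
    have i1: "integrable lebesgue (\<lambda>p. (\<theta>' (rho \<gamma> p) * (field_coef \<gamma> i p * drho \<gamma> i p) * grushin_X \<gamma> i (f n) p) * f n (dil \<gamma> s p))" for i
      by (intro sq_integrable_mult_integrable weight_sq_integrable[OF m2 b2] sq_integrable_dil sqn out)
    have i2: "integrable lebesgue (\<lambda>p. (\<theta> (rho \<gamma> p) * grushin_X \<gamma> i (f n) p) * grushin_X \<gamma> i (f n) (dil \<gamma> s p))" for i
      by (intro sq_integrable_mult_integrable weight_sq_integrable[OF m1 b1] sq_integrable_dil sqn out)
    have "?A i = (\<integral>p. (\<theta>' (rho \<gamma> p) * (field_coef \<gamma> i p * drho \<gamma> i p) * grushin_X \<gamma> i (f n) p) * f n (dil \<gamma> s p)
       + exp s * ((\<theta> (rho \<gamma> p) * grushin_X \<gamma> i (f n) p) * grushin_X \<gamma> i (f n) (dil \<gamma> s p)) \<partial>lebesgue)" for i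
      using i1 i2 by simp
    also have "\<dots> i = (\<integral>p. grushin_X \<gamma> i (f n) p *
         (\<theta>' (rho \<gamma> p) * (field_coef \<gamma> i p * drho \<gamma> i p) * f n (dil \<gamma> s p)
            + \<theta> (rho \<gamma> p) * exp s * grushin_X \<gamma> i (f n) (dil \<gamma> s p)) \<partial>lebesgue)" for i
      by (intro Bochner_Integration.integral_cong refl) (simp add: algebra_simps)
    finally have A: "?A i = (\<integral>p. grushin_X \<gamma> i (f n) p *
         (\<theta>' (rho \<gamma> p) * (field_coef \<gamma> i p * drho \<gamma> i p) * f n (dil \<gamma> s p)
            + \<theta> (rho \<gamma> p) * exp s * grushin_X \<gamma> i (f n) (dil \<gamma> s p)) \<partial>lebesgue)" for i .
    have "?L = (\<integral>p. grushin_op (\<lambda>i j. grushin_X \<gamma> i (grushin_X \<gamma> j (f n))) p * (\<theta> (rho \<gamma> p) * f n (dil \<gamma> s p)) \<partial>lebesgue)"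
      by (simp add: ac_simps)
    also have "\<dots> = - sum ?A UNIV"
      unfolding A by (rule test_fun.Green_identity[OF test th])
    finally show ?thesis .
  qed
  show ?thesis
    by (rule LIMSEQ_unique[OF L]) (unfold eq, intro tendsto_intros R1 R2)
qed

text \<open>
  The support assumption concerns \<open>u\<close> only. The weight \<open>(r\<^sub>0 - \<rho>)\<^sub>+\<^sup>2\<close> transfers it to \<open>V\<close>: in the weak
  identity all terms containing \<open>u\<close> vanish.
\<close>

lemma near_V: "AE p in lebesgue. rho \<gamma> p < r0 \<longrightarrow> V i p = 0"
proof -
  define \<theta> where "\<theta> = (\<lambda>r. (max 0 (r0 - r))\<^sup>2)"
  define \<theta>' where "\<theta>' = (\<lambda>r. - 2 * max 0 (r0 - r))"
  have d: "(\<theta> has_real_derivative \<theta>' r) (at r)" for r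
    unfolding \<theta>_def \<theta>'_def by (rule has_real_derivative_max_0_diff_power2)
  have c: "continuous_on A \<theta>'" for A
    unfolding \<theta>'_def by (intro continuous_intros)
  define M where "M = r0\<^sup>2 + 2 * r0"
  have b: "\<bar>\<theta> r\<bar> \<le> M" "\<bar>\<theta>' r\<bar> \<le> M" if "0 < r" for r
  proof -
    define x where "x = max 0 (r0 - r)"
    have "0 \<le> x" "x \<le> r0" using that r0 by (auto simp: x_def)
    then show "\<bar>\<theta> r\<bar> \<le> M" "\<bar>\<theta>' r\<bar> \<le> M"
      using add_increasing2[of "2 * r0" "x\<^sup>2" "r0\<^sup>2"] add_increasing[of "r0\<^sup>2" "2 * x" "2 * r0"]
        power_mono[of x r0 2] r0 unfolding \<theta>_def \<theta>'_def M_def x_def[symmetric] by simp_all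
  qed
  have u0: "AE p in lebesgue. \<theta> (rho \<gamma> p) * u p = 0" "AE p in lebesgue. \<theta>' (rho \<gamma> p) * u p = 0"
    using near_u by (eventually_elim, auto simp: \<theta>_def \<theta>'_def max_def)+
  have z1: "(\<integral>p. (\<theta> (rho \<gamma> p) * F p) * u p \<partial>lebesgue) = 0"
    by (rule integral_eq_zero_AE) (use u0(1) in \<open>eventually_elim; auto\<close>)
  have z2: "(\<integral>p. (\<theta>' (rho \<gamma> p) * (field_coef \<gamma> i p * drho \<gamma> i p) * V i p) * u p \<partial>lebesgue) = 0" for i
    by (rule integral_eq_zero_AE) (use u0(2) in \<open>eventually_elim; auto\<close>)
  have m: "(\<lambda>p. \<theta> (rho \<gamma> p)) \<in> borel_measurable borel"
    unfolding \<theta>_def using borel_measurable_rho[OF gamma] by measurable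
  have sq: "integrable lebesgue (\<lambda>p. (\<theta> (rho \<gamma> p) * V i p) * V i p)" for i
    by (intro sq_integrable_mult_integrable weight_sq_integrable[OF m, where M = M] sq_V out_V b rho_pos gamma)
  have nn: "0 \<le> (\<theta> (rho \<gamma> p) * V i p) * V i p" for p i
    by (simp add: \<theta>_def mult.assoc)
  \<comment> \<open>At \<open>s = 0\<close> a sum of nonnegative integrals is left, so each
    vanishes; since \<theta> is positive below \<open>r0\<close>, this forces \<open>V i\<close> to
    be zero there.\<close>
  have "(\<Sum>i\<in>UNIV. \<integral>p. (\<theta> (rho \<gamma> p) * V i p) * V i p \<partial>lebesgue) = 0"
    using weak_identity[OF d c b, of 0] z1 z2 by simp
  moreover have "0 \<le> (\<integral>p. (\<theta> (rho \<gamma> p) * V i p) * V i p \<partial>lebesgue)" for i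
    using nn by (intro integral_nonneg_AE) auto
  ultimately have "(\<integral>p. (\<theta> (rho \<gamma> p) * V i p) * V i p \<partial>lebesgue) = 0"
    by (simp add: sum_nonneg_eq_0_iff)
  then have "AE p in lebesgue. (\<theta> (rho \<gamma> p) * V i p) * V i p = 0"
    using integral_nonneg_eq_0_iff_AE[OF sq] nn by auto
  then show ?thesis
    by eventually_elim (auto simp: \<theta>_def max_def split: if_splits)
qed

text \<open>A power of the gauge may be unbounded near the origin. It is replaced by the power of a
  function of the gauge bounded away from zero, which changes none of the integrals because the
  other factors vanish near the origin.\<close>

lemma power_identity:
  "(\<integral>p. (rho \<gamma> p powr \<kappa> * F p) * u (dil \<gamma> s p) \<partial>lebesgue) =
    - (\<Sum>i\<in>UNIV. \<kappa> * (\<integral>p. (rho \<gamma> p powr (\<kappa> - 1) * (field_coef \<gamma> i p * drho \<gamma> i p) * V i p) * u (dil \<gamma> s p) \<partial>lebesgue)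
       + exp s * (\<integral>p. (rho \<gamma> p powr \<kappa> * V i p) * V i (dil \<gamma> s p) \<partial>lebesgue))"
proof -
  \<comment> \<open>Below \<open>r0 * exp (- s)\<close> the factor
    \<open>u (dil \<gamma> s p)\<close> vanishes, below \<open>r0\<close> the factor
    \<open>V i p\<close> does; so modifying the weight below \<open>r1\<close> affects neither kind
    of integral.\<close>
  define r1 where "r1 = min r0 (r0 * exp (- s))"
  have r1: "r1 > 0" "r1 \<le> r0" using r0 by (auto simp: r1_def)
  \<comment> \<open>a positive continuously differentiable function that is the identity on \<open>[r1, \<infinity>)\<close>\<close>
  define m where "m = (\<lambda>r. r + (max 0 (r1 - r))\<^sup>2 / r1)"
  define m' where "m' = (\<lambda>r. 1 - 2 * max 0 (r1 - r) / r1)"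
  have dm: "(m has_real_derivative m' r) (at r)" for r
    unfolding m_def m'_def
    by (rule DERIV_cong[OF DERIV_add[OF DERIV_ident DERIV_cdivide[OF has_real_derivative_max_0_diff_power2]]]) simp
  have m_pos: "m r > 0" if "0 \<le> r" for r
  proof (cases "r = 0")
    case False
    then show ?thesis using that r1 by (auto simp: m_def intro!: add_pos_nonneg)
  qed (use r1 in \<open>simp add: m_def\<close>)
  define \<theta> where "\<theta> = (\<lambda>r. m r powr \<kappa>)"
  define \<theta>' where "\<theta>' = (\<lambda>r. \<kappa> * m r powr (\<kappa> - 1) * m' r)"
  have d: "(\<theta> has_real_derivative \<theta>' r) (at r)" if "r > 0" for r
    unfolding \<theta>_def \<theta>'_def using DERIV_fun_powr[OF dm m_pos, of r \<kappa>] that by simp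
  have cm: "continuous_on A m" for A
    unfolding m_def using r1 by (intro continuous_intros) auto
  have c: "continuous_on A \<theta>'" "continuous_on A \<theta>" if "A \<subseteq> {0..}" for A
  proof -
    have "m x \<noteq> 0" if "x \<in> A" for x
      using m_pos[of x] that \<open>A \<subseteq> {0..}\<close> by auto
    then show "continuous_on A \<theta>'" "continuous_on A \<theta>"
      unfolding \<theta>'_def \<theta>_def m'_def using r1 by (auto intro!: continuous_intros cm)
  qed
  have "bounded (\<theta> ` {0..R})" "bounded (\<theta>' ` {0..R})"
    by (intro compact_imp_bounded compact_continuous_image c; auto)+
  then obtain M1 M2 where "\<forall>r\<in>{0..R}. \<bar>\<theta> r\<bar> \<le> M1" "\<forall>r\<in>{0..R}. \<bar>\<theta>' r\<bar> \<le> M2"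
    by (auto simp: bounded_iff)
  then have M: "\<bar>\<theta> r\<bar> \<le> M1" "\<bar>\<theta>' r\<bar> \<le> M2" if "0 \<le> r" "r \<le> R" for r
    using that by auto
  have eq: "\<theta> r = r powr \<kappa>" "\<theta>' r = \<kappa> * r powr (\<kappa> - 1)" if "r1 \<le> r" for r
    using that by (auto simp: \<theta>_def \<theta>'_def m_def m'_def max_def)
  have us: "AE p in lebesgue. rho \<gamma> p < r1 \<longrightarrow> u (dil \<gamma> s p) = 0"
    using AE_dil[OF near_u, of \<gamma> s]
  proof eventually_elim
    case (elim p)
    show ?case
    proof
      assume "rho \<gamma> p < r1"
      then have "rho \<gamma> p < r0 * exp (- s)" by (simp add: r1_def)
      then have "rho \<gamma> (dil \<gamma> s p) < r0" by (simp add: rho_dil[OF gamma] exp_minus field_simps)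
      with elim show "u (dil \<gamma> s p) = 0" by simp
    qed
  qed
  note [measurable] = dil_measurable_lebesgue[of \<gamma> s, where 'm = 'm and 'k = 'k]
  have cm: "continuous_on UNIV m" "continuous_on UNIV m'"
    unfolding m_def m'_def using r1 by (intro continuous_intros; simp)+
  have [measurable]: "m \<in> borel_measurable borel" "m' \<in> borel_measurable borel"
    using cm by (auto intro: borel_measurable_continuous_onI)
  have [measurable]: "\<theta> \<in> borel_measurable borel" "\<theta>' \<in> borel_measurable borel"
    unfolding \<theta>_def \<theta>'_def by measurable
  have 1: "(\<integral>p. (\<theta> (rho \<gamma> p) * F p) * u (dil \<gamma> s p) \<partial>lebesgue)
      = (\<integral>p. (rho \<gamma> p powr \<kappa> * F p) * u (dil \<gamma> s p) \<partial>lebesgue)"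
    by (rule integral_cong_AE; measurable?) (use us in \<open>eventually_elim; use eq in force\<close>)
  have 2: "(\<integral>p. (\<theta>' (rho \<gamma> p) * (field_coef \<gamma> i p * drho \<gamma> i p) * V i p) * u (dil \<gamma> s p) \<partial>lebesgue)
      = (\<integral>p. \<kappa> * ((rho \<gamma> p powr (\<kappa> - 1) * (field_coef \<gamma> i p * drho \<gamma> i p) * V i p) * u (dil \<gamma> s p)) \<partial>lebesgue)" for i
    by (rule integral_cong_AE; measurable?) (use us in \<open>eventually_elim; use eq in force\<close>)
  have 3: "(\<integral>p. (\<theta> (rho \<gamma> p) * V i p) * V i (dil \<gamma> s p) \<partial>lebesgue)
      = (\<integral>p. (rho \<gamma> p powr \<kappa> * V i p) * V i (dil \<gamma> s p) \<partial>lebesgue)" for i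
    by (rule integral_cong_AE; measurable?) (use near_V[of i] in \<open>eventually_elim; use eq r1 in force\<close>)
  have b: "\<bar>\<theta> r\<bar> \<le> max M1 M2" "\<bar>\<theta>' r\<bar> \<le> max M1 M2" if "0 < r" "r < R" for r
    using M[of r] that by auto
  show ?thesis
    using weak_identity[OF d c(1) b, of s] unfolding 1 2 3 by force
qed

end

section \<open>The Carleman estimate\<close>

context grushin_limit
begin

lemma measurable_psi[measurable]:
  fixes i :: "'m + 'k"
  shows "(psi \<gamma> :: ('m, 'k) point \<Rightarrow> real) \<in> borel_measurable lebesgue" "ang \<gamma> i \<in> borel_measurable lebesgue"
proof -
  show [measurable]: "(psi \<gamma> :: ('m, 'k) point \<Rightarrow> real) \<in> borel_measurable lebesgue"
    by (auto intro!: measurable_completion simp: borel_measurable_psi gamma)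
  show "ang \<gamma> i \<in> borel_measurable lebesgue"
    unfolding ang_def by measurable
qed

section \<open>The unitary group of dilations\<close>

definition T :: "real \<Rightarrow> (('m, 'k) point \<Rightarrow> real) \<Rightarrow> ('m, 'k) point \<Rightarrow> real" where
  "T s g p = exp (hom_dim CARD('m) CARD('k) \<gamma> * s / 2) * g (dil \<gamma> s p)"

lemma T_0: "T 0 g = g"
  by (simp add: T_def fun_eq_iff)

lemma sq_integrable_T: "sq_integrable lebesgue g \<Longrightarrow> sq_integrable lebesgue (T s g)"
  unfolding T_def[abs_def] by (intro sq_integrable_cmult sq_integrable_dil)

lemma l2norm_T: "sq_integrable lebesgue g \<Longrightarrow> l2norm lebesgue (T s g) = l2norm lebesgue g"
  unfolding T_def[abs_def] l2norm_cmult
  by (simp add: l2norm_dil sq_integrable_measurable exp_minus)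

lemma T_adjoint:
  assumes h: "sq_integrable lebesgue h" and g: "sq_integrable lebesgue g"
  shows "(\<integral>p. T s h p * g p \<partial>lebesgue) = (\<integral>p. h p * T (- s) g p \<partial>lebesgue)"
proof -
  have m: "(\<lambda>p. h p * T (- s) g p) \<in> borel_measurable lebesgue"
    using h sq_integrable_T[OF g, of "- s"] by (intro borel_measurable_times sq_integrable_measurable)
  have "(\<integral>p. h p * T (- s) g p \<partial>lebesgue) = exp (hom_dim CARD('m) CARD('k) \<gamma> * s) * (\<integral>p. h (dil \<gamma> s p) * T (- s) g (dil \<gamma> s p) \<partial>lebesgue)"
    by (rule integral_dil[OF m])
  also have "\<dots> = (\<integral>p. exp (hom_dim CARD('m) CARD('k) \<gamma> * s) * (h (dil \<gamma> s p) * T (- s) g (dil \<gamma> s p)) \<partial>lebesgue)" by simp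
  also have "\<dots> = (\<integral>p. T s h p * g p \<partial>lebesgue)"
  proof -
    have "exp (hom_dim CARD('m) CARD('k) \<gamma> * s) * exp (hom_dim CARD('m) CARD('k) \<gamma> * (- s) / 2) = exp (hom_dim CARD('m) CARD('k) \<gamma> * s / 2)" by (simp add: exp_add[symmetric] del: exp_minus)
    then show ?thesis
      by (intro Bochner_Integration.integral_cong refl) (simp add: T_def dil_dil mult.assoc[symmetric])
  qed
  finally show ?thesis ..
qed

lemma T_T: "T s (T r g) = T (s + r) g"
  by (simp add: T_def fun_eq_iff dil_dil mult.assoc[symmetric] exp_add[symmetric] add_divide_distrib distrib_left add.commute)

lemma T_diff: "T s (\<lambda>p. h p - g p) = (\<lambda>p. T s h p - T s g p)"
  by (simp add: T_def fun_eq_iff right_diff_distrib)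

text \<open>Where \<open>H\<close> is nonzero the gauge lies between \<open>r0\<close> and
  \<open>R\<close>, and the sum of the two endpoint powers bounds its power for either sign of the
  exponent.\<close>

lemma near_sq_integrable:
  fixes H :: "('m, 'k) point \<Rightarrow> real"
  assumes H: "sq_integrable lebesgue H" "\<And>p. R \<le> rho \<gamma> p \<Longrightarrow> H p = 0"
    and near: "AE p in lebesgue. rho \<gamma> p < r0 \<longrightarrow> H p = 0"
  shows "sq_integrable lebesgue (\<lambda>p. rho \<gamma> p powr c * H p)"
proof (rule sq_integrable_bound[OF H(1), where C = "r0 powr c + R powr c"])
  note [measurable] = H(1)
  show "(\<lambda>p. rho \<gamma> p powr c * H p) \<in> borel_measurable lebesgue" by measurable
  have b: "r powr c \<le> r0 powr c + R powr c" if "r0 \<le> r" "r \<le> R" for r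
  proof (cases "0 \<le> c")
    case True
    then show ?thesis using that r0 powr_mono2[of c r R] by (simp add: add_increasing)
  next
    case False
    then show ?thesis using that r0 powr_mono2'[of c r0 r] by (simp add: add_increasing2)
  qed
  show "AE p in lebesgue. \<bar>rho \<gamma> p powr c * H p\<bar> \<le> (r0 powr c + R powr c) * \<bar>H p\<bar>"
    using near
  proof eventually_elim
    case (elim p)
    show ?case
    proof (cases "H p = 0")
      case False
      with elim H(2)[of p] have "r0 \<le> rho \<gamma> p" "rho \<gamma> p \<le> R" by linarith+
      from b[OF this] show ?thesis by (simp add: abs_mult mult_right_mono)
    qed simp
  qed
qed

text \<open>Dilations with |s| at most \<open>h\<close> have uniformly bounded operator norm, so the
  bound of \<open>l2_pairing_diff\<close> is uniform in \<open>s\<close>, as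
  \<open>mean_value_limit\<close> requires.\<close>

lemma pairing_dil_uniform:
  fixes H K :: "('m, 'k) point \<Rightarrow> real"
  assumes H: "sq_integrable lebesgue H" "\<And>n. sq_integrable lebesgue (Hn n)"
    "(\<lambda>n. l2norm lebesgue (\<lambda>p. Hn n p - H p)) \<longlonglongrightarrow> 0"
    and K: "sq_integrable lebesgue K" "\<And>n. sq_integrable lebesgue (Kn n)"
    "(\<lambda>n. l2norm lebesgue (\<lambda>p. Kn n p - K p)) \<longlonglongrightarrow> 0"
  obtains \<delta> where "\<delta> \<longlonglongrightarrow> 0"
    "\<And>n s. \<bar>s\<bar> \<le> h \<Longrightarrow> \<bar>(\<integral>p. Hn n p * Kn n (dil \<gamma> s p) \<partial>lebesgue) - (\<integral>p. H p * K (dil \<gamma> s p) \<partial>lebesgue)\<bar> \<le> \<delta> n"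
proof
  \<comment> \<open>An upper bound for the factor in \<open>l2norm_dil\<close> over all |s| at most
    \<open>h\<close>.\<close>
  define E where "E = exp (\<bar>hom_dim CARD('m) CARD('k) \<gamma>\<bar> * h / 2)"
  define \<delta> where "\<delta> = (\<lambda>n. l2norm lebesgue (\<lambda>p. Hn n p - H p) * (E * l2norm lebesgue K + E * l2norm lebesgue (\<lambda>p. Kn n p - K p))
      + l2norm lebesgue H * (E * l2norm lebesgue (\<lambda>p. Kn n p - K p)))"
  show "\<delta> \<longlonglongrightarrow> 0"
    unfolding \<delta>_def by (rule tendsto_eq_rhs, (rule tendsto_intros H(3) K(3))+) simp
  fix n s assume s: "\<bar>s\<bar> \<le> h"
  have E: "l2norm lebesgue (\<lambda>p. g (dil \<gamma> s p)) \<le> E * l2norm lebesgue g"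
    if "sq_integrable lebesgue g" for g :: "('m, 'k) point \<Rightarrow> real"
  proof -
    have "- hom_dim CARD('m) CARD('k) \<gamma> * s \<le> \<bar>hom_dim CARD('m) CARD('k) \<gamma>\<bar> * \<bar>s\<bar>"
      by (metis abs_ge_self abs_minus_cancel abs_mult mult_minus_left)
    also have "\<dots> \<le> \<bar>hom_dim CARD('m) CARD('k) \<gamma>\<bar> * h"
      using s by (intro mult_left_mono) auto
    finally have "exp (- hom_dim CARD('m) CARD('k) \<gamma> * s / 2) \<le> E"
      unfolding E_def by simp
    then show ?thesis
      using that by (simp add: l2norm_dil sq_integrable_measurable mult_right_mono)
  qed
  have "\<bar>(\<integral>p. Hn n p * Kn n (dil \<gamma> s p) \<partial>lebesgue) - (\<integral>p. H p * K (dil \<gamma> s p) \<partial>lebesgue)\<bar> \<le>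
    l2norm lebesgue (\<lambda>p. Hn n p - H p) * (l2norm lebesgue (\<lambda>p. K (dil \<gamma> s p))
        + l2norm lebesgue (\<lambda>p. Kn n (dil \<gamma> s p) - K (dil \<gamma> s p)))
      + l2norm lebesgue H * l2norm lebesgue (\<lambda>p. Kn n (dil \<gamma> s p) - K (dil \<gamma> s p))"
    by (intro l2_pairing_diff H K sq_integrable_dil)
  also have "\<dots> \<le> \<delta> n"
    unfolding \<delta>_def using E[OF K(1)] E[OF sq_integrable_diff[OF K(2,1)], of n]
    by (intro add_mono mult_left_mono) auto
  finally show "\<bar>(\<integral>p. Hn n p * Kn n (dil \<gamma> s p) \<partial>lebesgue) - (\<integral>p. H p * K (dil \<gamma> s p) \<partial>lebesgue)\<bar> \<le> \<delta> n" .
qed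

end

text \<open>The case of a finite right-hand side, in which \<open>G\<close> below is square
  integrable. The number \<open>b\<close> is the scaling exponent of the weight in \<open>w\<close>:
  pulling that weight out of \<open>T s w\<close> leaves the factor
  \<open>exp (- b * s)\<close>.\<close>

locale grushin_carleman = grushin_limit \<gamma> R r0 u V F f S
  for \<gamma> R r0 :: real and u :: "('m::finite, 'k::finite) point \<Rightarrow> real" and V F f S +
  fixes \<alpha> b :: real
  assumes alpha: "\<alpha> > 0" and b: "b = \<alpha> + 2 - hom_dim CARD('m) CARD('k) \<gamma> / 2"
    and finite_K: "integrable lebesgue (\<lambda>p. rho \<gamma> p powr (- 2 * \<alpha>) * (F p)\<^sup>2 * inverse (psi \<gamma> p))"
begin

section \<open>The weighted functions and their energy identity\<close>

definition w where "w p = rho \<gamma> p powr (- \<alpha> - 2) * (sqrt (psi \<gamma> p) * u p)"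

definition G where "G p = rho \<gamma> p powr (- \<alpha>) * F p / sqrt (psi \<gamma> p)"

definition \<xi> where "\<xi> i p = rho \<gamma> p powr (- \<alpha> - 1) * V i p"

definition q where "q p = (\<Sum>i\<in>UNIV. ang \<gamma> i p * \<xi> i p)"

lemma sq_integrable_ang_mult:
  fixes H :: "('m, 'k) point \<Rightarrow> real" and i :: "'m + 'k"
  assumes "sq_integrable lebesgue H"
  shows "sq_integrable lebesgue (\<lambda>p. ang \<gamma> i p * H p)"
proof (rule sq_integrable_bound[OF assms, where C = 1])
  note [measurable] = assms
  show "(\<lambda>p. ang \<gamma> i p * H p) \<in> borel_measurable lebesgue" by measurable
  have "\<bar>ang \<gamma> i p * H p\<bar> \<le> 1 * \<bar>H p\<bar>" if "p \<noteq> 0" for p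
    unfolding abs_mult by (rule mult_right_mono[OF abs_ang_le_1[OF gamma that]]) simp
  then show "AE p in lebesgue. \<bar>ang \<gamma> i p * H p\<bar> \<le> 1 * \<bar>H p\<bar>"
    using AE_neq_0 by (auto elim!: eventually_mono)
qed

lemma abs_sqrt_psi_le_1: "p \<noteq> 0 \<Longrightarrow> \<bar>sqrt (psi \<gamma> p)\<bar> \<le> 1"
  using psi_le_1[OF gamma, of p] psi_nonneg[of \<gamma> p] by simp

lemma sq_w_power: "sq_integrable lebesgue (\<lambda>p. rho \<gamma> p powr c * w p)"
proof -
  have "sq_integrable lebesgue (\<lambda>p. sqrt (psi \<gamma> p) * u p)"
  proof (rule weight_sq_integrable[where M = 1, OF _ abs_sqrt_psi_le_1 sq_u out_u])
    show "(\<lambda>p. sqrt (psi \<gamma> p)) \<in> borel_measurable borel"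
      by (rule measurable_compose[OF borel_measurable_psi[OF gamma]])
         (intro borel_measurable_continuous_onI continuous_intros)
  qed
  moreover have "AE p in lebesgue. rho \<gamma> p < r0 \<longrightarrow> sqrt (psi \<gamma> p) * u p = 0"
    using near_u by eventually_elim auto
  ultimately have "sq_integrable lebesgue (\<lambda>p. rho \<gamma> p powr (c + (- \<alpha> - 2)) * (sqrt (psi \<gamma> p) * u p))"
    using out_u by (intro near_sq_integrable) auto
  then show ?thesis unfolding w_def powr_add mult.assoc .
qed

lemma sq_w: "sq_integrable lebesgue w"
proof -
  have "(\<lambda>p. rho \<gamma> p powr 0 * w p) = w"
    by (auto simp: fun_eq_iff w_def)
  then show ?thesis using sq_w_power[of 0] by simp
qed

lemma sq_\<xi>_power: "sq_integrable lebesgue (\<lambda>p. rho \<gamma> p powr c * \<xi> i p)"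
  using near_sq_integrable[OF sq_V out_V near_V, of "c + (- \<alpha> - 1)" i]
  unfolding \<xi>_def powr_add mult.assoc .

lemma sq_\<xi>: "sq_integrable lebesgue (\<xi> i)"
proof -
  have "(\<lambda>p. rho \<gamma> p powr 0 * \<xi> i p) = \<xi> i"
    by (auto simp: fun_eq_iff \<xi>_def)
  then show ?thesis using sq_\<xi>_power[of 0 i] by simp
qed

lemma sq_q: "sq_integrable lebesgue q"
  unfolding q_def[abs_def] by (intro sq_integrable_sum sq_integrable_ang_mult sq_\<xi>)

lemma G_power2: "(G p)\<^sup>2 = rho \<gamma> p powr (- 2 * \<alpha>) * (F p)\<^sup>2 * inverse (psi \<gamma> p)"
proof -
  have "(rho \<gamma> p powr (- \<alpha>))\<^sup>2 = rho \<gamma> p powr (- 2 * \<alpha>)"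
    by (simp add: power2_eq_square powr_add[symmetric])
  then show ?thesis
    unfolding G_def power_divide power_mult_distrib by (simp add: psi_nonneg divide_inverse)
qed

lemma sq_G: "sq_integrable lebesgue G"
  unfolding sq_integrable_def
proof
  show "G \<in> borel_measurable lebesgue" unfolding G_def by measurable
  show "integrable lebesgue (\<lambda>p. (G p)\<^sup>2)" unfolding G_power2 by (rule finite_K)
qed

lemma rho_dil_powr: "rho \<gamma> (dil \<gamma> s p) powr c = exp (s * c) * rho \<gamma> p powr c"
  by (simp add: rho_dil[OF gamma] powr_mult) (simp add: powr_def mult.commute)

lemma T_w: "T s w p = exp (- b * s) * (rho \<gamma> p powr (- \<alpha> - 2) * (sqrt (psi \<gamma> p) * u (dil \<gamma> s p)))"
proof -
  have "exp (hom_dim CARD('m) CARD('k) \<gamma> * s / 2) * exp (s * (- \<alpha> - 2)) = exp (- b * s)"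
    by (simp add: exp_add[symmetric] b algebra_simps del: exp_minus)
  then show ?thesis
    unfolding T_def w_def rho_dil_powr psi_dil[OF gamma] by (simp add: mult.assoc[symmetric])
qed

lemma T_\<xi>: "T s (\<xi> i) p = exp (- b * s) * (exp s * (rho \<gamma> p powr (- \<alpha> - 1) * V i (dil \<gamma> s p)))"
proof -
  have "exp (hom_dim CARD('m) CARD('k) \<gamma> * s / 2) * exp (s * (- \<alpha> - 1)) = exp (- b * s) * exp s"
    by (simp add: exp_add[symmetric] b algebra_simps del: exp_minus)
  then show ?thesis
    unfolding T_def \<xi>_def rho_dil_powr by (simp add: mult.assoc[symmetric])
qed

lemma T_q: "T s q p = (\<Sum>i\<in>UNIV. ang \<gamma> i p * T s (\<xi> i) p)"
  unfolding T_def q_def ang_dil[OF gamma] sum_distrib_left by (simp add: ac_simps)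

lemma rho_powr_mult: "rho \<gamma> p powr x * rho \<gamma> p powr y = rho \<gamma> p powr (x + y)"
  by (simp add: powr_add)

text \<open>This is \<open>power_identity\<close> with exponent \<open>- 2 * \<alpha> - 2\<close>,
  multiplied by \<open>exp (- b * s)\<close>. The weight is shared between the two factors of each
  pairing; the root of \<open>psi\<close> in \<open>w\<close> cancels the one in \<open>G\<close>
  and turns \<open>ang\<close> into the field derivative of the gauge.\<close>

lemma energy_identity:
  "(\<integral>p. G p * T s w p \<partial>lebesgue) = (2 * \<alpha> + 2) * (\<integral>p. q p * T s w p \<partial>lebesgue)
     - (\<Sum>i\<in>UNIV. \<integral>p. \<xi> i p * T s (\<xi> i) p \<partial>lebesgue)"
proof -
  have 1: "(\<integral>p. G p * T s w p \<partial>lebesgue)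
      = exp (- b * s) * (\<integral>p. (rho \<gamma> p powr (- 2 * \<alpha> - 2) * F p) * u (dil \<gamma> s p) \<partial>lebesgue)"
  proof -
    have "(\<integral>p. G p * T s w p \<partial>lebesgue)
        = (\<integral>p. exp (- b * s) * ((rho \<gamma> p powr (- 2 * \<alpha> - 2) * F p) * u (dil \<gamma> s p)) \<partial>lebesgue)"
    proof (rule integral_cong_AE)
      show "(\<lambda>p. G p * T s w p) \<in> borel_measurable lebesgue"
        by (intro borel_measurable_times sq_integrable_measurable sq_G sq_integrable_T sq_w)
      show "AE p in lebesgue. G p * T s w p = exp (- b * s) * ((rho \<gamma> p powr (- 2 * \<alpha> - 2) * F p) * u (dil \<gamma> s p))"
        \<comment> \<open>Cancelling the roots of \<open>psi\<close> in \<open>G\<close> and in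
          \<open>T s w\<close> is valid where \<open>psi\<close> is positive.\<close>
        using AE_fst_neq_0
      proof eventually_elim
        case (elim p)
        have "rho \<gamma> p powr (- 2 * \<alpha> - 2) = rho \<gamma> p powr (- \<alpha>) * rho \<gamma> p powr (- \<alpha> - 2)"
          unfolding rho_powr_mult by (rule arg_cong[where f = "\<lambda>x. rho \<gamma> p powr x"]) simp
        then show ?case
          using psi_pos[OF gamma elim] unfolding T_w G_def by (simp only: ) (simp add: field_simps)
      qed
    qed measurable
    then show ?thesis by simp
  qed
  have int: "integrable lebesgue (\<lambda>p. (ang \<gamma> i p * \<xi> i p) * T s w p)" for i
    by (intro sq_integrable_mult_integrable sq_integrable_ang_mult sq_\<xi> sq_integrable_T sq_w)
  have 2: "(\<integral>p. (ang \<gamma> i p * \<xi> i p) * T s w p \<partial>lebesgue) = exp (- b * s) *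
      (\<integral>p. (rho \<gamma> p powr (- 2 * \<alpha> - 2 - 1) * (field_coef \<gamma> i p * drho \<gamma> i p) * V i p) * u (dil \<gamma> s p) \<partial>lebesgue)" for i
  proof -
    have "(\<integral>p. (ang \<gamma> i p * \<xi> i p) * T s w p \<partial>lebesgue) = (\<integral>p. exp (- b * s) *
      ((rho \<gamma> p powr (- 2 * \<alpha> - 2 - 1) * (field_coef \<gamma> i p * drho \<gamma> i p) * V i p) * u (dil \<gamma> s p)) \<partial>lebesgue)"
    proof (rule integral_cong_AE)
      show "(\<lambda>p. (ang \<gamma> i p * \<xi> i p) * T s w p) \<in> borel_measurable lebesgue" using int by auto
      show "AE p in lebesgue. (ang \<gamma> i p * \<xi> i p) * T s w p = exp (- b * s) *
          ((rho \<gamma> p powr (- 2 * \<alpha> - 2 - 1) * (field_coef \<gamma> i p * drho \<gamma> i p) * V i p) * u (dil \<gamma> s p))"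
        using AE_neq_0
      proof eventually_elim
        case (elim p)
        have r: "rho \<gamma> p powr (- 2 * \<alpha> - 2 - 1) = rho \<gamma> p powr (- \<alpha> - 1) * rho \<gamma> p powr (- \<alpha> - 2)"
          unfolding rho_powr_mult by (rule arg_cong[where f = "\<lambda>x. rho \<gamma> p powr x"]) simp
        show ?case
          unfolding T_w \<xi>_def r sqrt_psi_ang[OF gamma elim, symmetric] by (simp only: ac_simps)
      qed
    qed measurable
    then show ?thesis by simp
  qed
  have 3: "(\<integral>p. \<xi> i p * T s (\<xi> i) p \<partial>lebesgue)
      = exp (- b * s) * (exp s * (\<integral>p. (rho \<gamma> p powr (- 2 * \<alpha> - 2) * V i p) * V i (dil \<gamma> s p) \<partial>lebesgue))" for i
  proof -
    have r: "rho \<gamma> p powr (- 2 * \<alpha> - 2) = rho \<gamma> p powr (- \<alpha> - 1) * rho \<gamma> p powr (- \<alpha> - 1)" for p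
      unfolding rho_powr_mult by (rule arg_cong[where f = "\<lambda>x. rho \<gamma> p powr x"]) simp
    have "(\<integral>p. \<xi> i p * T s (\<xi> i) p \<partial>lebesgue)
      = (\<integral>p. exp (- b * s) * (exp s * ((rho \<gamma> p powr (- 2 * \<alpha> - 2) * V i p) * V i (dil \<gamma> s p))) \<partial>lebesgue)"
      unfolding T_\<xi> r \<xi>_def by (intro Bochner_Integration.integral_cong refl) (simp only: ac_simps)
    then show ?thesis by simp
  qed
  have 4: "(\<integral>p. q p * T s w p \<partial>lebesgue) = (\<Sum>i\<in>UNIV. \<integral>p. (ang \<gamma> i p * \<xi> i p) * T s w p \<partial>lebesgue)"
    unfolding q_def sum_distrib_right using int by (intro Bochner_Integration.integral_sum)
  show ?thesis
    unfolding 1 4 2 3 power_identity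
    by (simp add: sum_distrib_left sum.distrib sum_subtractf sum_negf algebra_simps)
qed

abbreviation D where "D s \<equiv> (\<lambda>p. T s w p - T (- s) w p)"

lemma sq_D: "sq_integrable lebesgue (D s)"
  by (intro sq_integrable_diff sq_integrable_T sq_w)

lemma pairing_D:
  assumes "sq_integrable lebesgue g"
  shows "(\<integral>p. g p * D s p \<partial>lebesgue) = (\<integral>p. g p * T s w p \<partial>lebesgue) - (\<integral>p. g p * T (- s) w p \<partial>lebesgue)"
  using sq_integrable_mult_integrable[OF assms sq_integrable_T[OF sq_w]] by (simp add: right_diff_distrib)

lemma T_symmetric:
  assumes "sq_integrable lebesgue g"
  shows "(\<integral>p. g p * T (- s) g p \<partial>lebesgue) = (\<integral>p. g p * T s g p \<partial>lebesgue)"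
  using T_adjoint[OF assms assms, of s] by (simp add: mult.commute)

text \<open>Subtracting the identities for \<open>s\<close> and \<open>-s\<close> removes the terms in \<open>\<xi>\<close>, as \<open>T\<close> is unitary.\<close>

lemma energy_identity_antisymmetric:
  "(\<integral>p. G p * D s p \<partial>lebesgue) = (2 * \<alpha> + 2) * (\<integral>p. (q p - b * w p) * D s p \<partial>lebesgue)"
proof -
  \<comment> \<open>Since the correlation of \<open>w\<close> is even, \<open>b * w\<close> can be
    subtracted from \<open>q\<close> without changing the pairing; \<open>q - b * w\<close> is the
    function that appears when the correlation is differentiated.\<close>
  have "(\<integral>p. w p * D s p \<partial>lebesgue) = 0"
    by (simp add: pairing_D sq_w T_symmetric)
  moreover have "(\<integral>p. (q p - b * w p) * D s p \<partial>lebesgue)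
      = (\<integral>p. q p * D s p \<partial>lebesgue) - b * (\<integral>p. w p * D s p \<partial>lebesgue)"
    using sq_integrable_mult_integrable[OF sq_q sq_D] sq_integrable_mult_integrable[OF sq_w sq_D]
    by (simp add: left_diff_distrib mult.assoc)
  moreover have "(\<integral>p. G p * D s p \<partial>lebesgue) = (2 * \<alpha> + 2) * (\<integral>p. q p * D s p \<partial>lebesgue)"
    unfolding pairing_D[OF sq_G] pairing_D[OF sq_q] energy_identity by (simp add: T_symmetric sq_\<xi> algebra_simps)
  ultimately show ?thesis by simp
qed

text \<open>
  The approximating test functions need not vanish near the origin uniformly, hence the truncation
  of \<open>\<rho>\<close> in the weight.
\<close>

definition \<Theta> :: "('m, 'k) point \<Rightarrow> real" where
  "\<Theta> p = max r0 (rho \<gamma> p) powr (- 2 * \<alpha> - 4)"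

lemma continuous_on_\<Theta>: "continuous_on A \<Theta>"
  unfolding \<Theta>_def[abs_def]
  by (rule continuous_on_powr) (use r0 in \<open>auto intro!: continuous_on_max continuous_on_rho gamma continuous_on_const\<close>)

lemma \<Theta>_bound: "\<bar>\<Theta> p\<bar> \<le> r0 powr (- 2 * \<alpha> - 4)"
  unfolding \<Theta>_def using r0 alpha by (auto intro!: powr_mono2')

lemma \<Theta>_u: "AE p in lebesgue. \<Theta> p * u p = rho \<gamma> p powr (- 2 * \<alpha> - 4) * u p"
  using near_u by eventually_elim (auto simp: \<Theta>_def max_def not_less)

text \<open>The limit of \<open>radial\<close> along the test functions, as
  \<open>radial_limit\<close> shows.\<close>

definition Y :: "('m, 'k) point \<Rightarrow> real" where
  "Y p = (\<Sum>i\<in>UNIV. rho \<gamma> p * (field_coef \<gamma> i p * drho \<gamma> i p) * V i p)"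

section \<open>Correlations of the limit functions and their derivatives\<close>

lemma weight_radial:
  fixes i :: "'m + 'k"
  shows "(\<lambda>p. rho \<gamma> p * (field_coef \<gamma> i p * drho \<gamma> i p)) \<in> borel_measurable borel"
    "p \<noteq> 0 \<Longrightarrow> rho \<gamma> p < R \<Longrightarrow> \<bar>rho \<gamma> p * (field_coef \<gamma> i p * drho \<gamma> i p)\<bar> \<le> R"
proof -
  show "(\<lambda>p. rho \<gamma> p * (field_coef \<gamma> i p * drho \<gamma> i p)) \<in> borel_measurable borel"
    by (intro borel_measurable_times borel_measurable_rho borel_measurable_field_coef borel_measurable_drho gamma)
  assume "p \<noteq> 0" "rho \<gamma> p < R"
  then show "\<bar>rho \<gamma> p * (field_coef \<gamma> i p * drho \<gamma> i p)\<bar> \<le> R"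
    using mult_mono[of "rho \<gamma> p" R "\<bar>field_coef \<gamma> i p * drho \<gamma> i p\<bar>" 1] abs_field_coef_drho_le_1[OF gamma, of p i] R
    by (simp add: abs_mult)
qed

lemma sq_Y: "sq_integrable lebesgue Y"
  unfolding Y_def[abs_def]
  by (intro sq_integrable_sum weight_sq_integrable[OF weight_radial sq_V out_V])

lemma radial_eq:
  "test_fun.radial \<gamma> (f n) p = (\<Sum>i\<in>UNIV. rho \<gamma> p * (field_coef \<gamma> i p * drho \<gamma> i p) * grushin_X \<gamma> i (f n) p)"
  by (simp add: test_fun.radial_def[OF test] sum_distrib_left mult.assoc)

lemma sq_radial_term:
  "sq_integrable lebesgue (\<lambda>p. rho \<gamma> p * (field_coef \<gamma> i p * drho \<gamma> i p) * grushin_X \<gamma> i (f n) p)"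
  by (rule weight_sq_integrable[OF weight_radial test_fun.sq_integrable_X[OF test] test_fun.support_X[OF test outS]])

lemma sq_radial: "sq_integrable lebesgue (test_fun.radial \<gamma> (f n))"
  unfolding radial_eq[abs_def] by (intro sq_integrable_sum sq_radial_term)

lemma radial_limit: "(\<lambda>n. l2norm lebesgue (\<lambda>p. test_fun.radial \<gamma> (f n) p - Y p)) \<longlonglongrightarrow> 0"
proof (rule Lim_null_comparison)
  let ?h = "\<lambda>i p. rho \<gamma> p * (field_coef \<gamma> i p * drho \<gamma> i p)"
  have sq: "sq_integrable lebesgue (\<lambda>p. ?h i p * grushin_X \<gamma> i (f n) p - ?h i p * V i p)" for i n
    by (intro sq_integrable_diff sq_radial_term weight_sq_integrable[OF weight_radial sq_V out_V])
  have "l2norm lebesgue (\<lambda>p. test_fun.radial \<gamma> (f n) p - Y p) \<le>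
      (\<Sum>i\<in>UNIV. l2norm lebesgue (\<lambda>p. ?h i p * grushin_X \<gamma> i (f n) p - ?h i p * V i p))" for n
    using l2norm_sum_le[of UNIV lebesgue "\<lambda>i p. ?h i p * grushin_X \<gamma> i (f n) p - ?h i p * V i p", OF sq]
    by (simp add: radial_eq Y_def sum_subtractf)
  then show "\<forall>\<^sub>F n in sequentially. norm (l2norm lebesgue (\<lambda>p. test_fun.radial \<gamma> (f n) p - Y p)) \<le>
      (\<Sum>i\<in>UNIV. l2norm lebesgue (\<lambda>p. ?h i p * grushin_X \<gamma> i (f n) p - ?h i p * V i p))"
    by simp
  have "(\<lambda>n. l2norm lebesgue (\<lambda>p. ?h i p * grushin_X \<gamma> i (f n) p - ?h i p * V i p)) \<longlonglongrightarrow> 0" for i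
    using R by (intro weight_limit[OF weight_radial _ sq_V out_V _ _ lim_V]
        test_fun.sq_integrable_X[OF test] test_fun.support_X[OF test outS]) auto
  from tendsto_sum[OF this]
  show "(\<lambda>n. \<Sum>i\<in>UNIV. l2norm lebesgue (\<lambda>p. ?h i p * grushin_X \<gamma> i (f n) p - ?h i p * V i p)) \<longlonglongrightarrow> 0"
    by simp
qed

lemma measurable_Y[measurable]: "Y \<in> borel_measurable lebesgue"
  by (rule sq_integrable_measurable[OF sq_Y])

lemma measurable_dil_Y[measurable]: "(\<lambda>p. Y (dil \<gamma> s p)) \<in> borel_measurable lebesgue"
  by (rule borel_measurable_dil[OF measurable_Y])

lemma measurable_\<Theta>: "\<Theta> \<in> borel_measurable borel"
  by (rule borel_measurable_continuous_onI[OF continuous_on_\<Theta>])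

lemma measurable_\<Theta>'[measurable]: "\<Theta> \<in> borel_measurable lebesgue"
  using measurable_\<Theta> by (auto intro: measurable_completion)

lemma rho_split: "rho \<gamma> p powr (- 2 * \<alpha> - 4) = rho \<gamma> p powr (- \<alpha> - 2) * rho \<gamma> p powr (- \<alpha> - 2)"
  unfolding rho_powr_mult by (rule arg_cong[where f = "\<lambda>x. rho \<gamma> p powr x"]) simp

text \<open>Invariance of \<open>psi\<close> gives each copy of \<open>w\<close> a factor
  \<open>sqrt (psi \<gamma> p)\<close> at the same point, so their product is
  \<open>psi \<gamma> p\<close>. The truncated weight differs from the power of the gauge only where
  \<open>u\<close> vanishes.\<close>

lemma correlation_w:
  "(\<integral>p. w p * T s w p \<partial>lebesgue) = exp (- b * s) * (\<integral>p. (psi \<gamma> p * \<Theta> p * u p) * u (dil \<gamma> s p) \<partial>lebesgue)"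
proof -
  have "(\<integral>p. w p * T s w p \<partial>lebesgue) = (\<integral>p. exp (- b * s) * ((psi \<gamma> p * \<Theta> p * u p) * u (dil \<gamma> s p)) \<partial>lebesgue)"
  proof (rule integral_cong_AE)
    show "(\<lambda>p. w p * T s w p) \<in> borel_measurable lebesgue"
      by (intro borel_measurable_times sq_integrable_measurable sq_integrable_T sq_w)
    show "AE p in lebesgue. w p * T s w p = exp (- b * s) * ((psi \<gamma> p * \<Theta> p * u p) * u (dil \<gamma> s p))"
      using \<Theta>_u
    proof eventually_elim
      case (elim p)
      have "psi \<gamma> p * \<Theta> p * u p = sqrt (psi \<gamma> p) * sqrt (psi \<gamma> p) * (\<Theta> p * u p)"
        by (simp add: psi_nonneg)
      then show ?case unfolding elim rho_split T_w w_def by (simp only: ac_simps)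
    qed
  qed measurable
  then show ?thesis by simp
qed

text \<open>The weight of \<xi> has one more power of the gauge than that of \<open>w\<close>. This
  power and the factor \<open>exp s\<close> from \<open>T_\<xi>\<close> form the gauge at the
  dilated point, and the root of \<open>psi\<close> in \<open>w\<close> combines with
  \<open>ang\<close>; together they give \<open>Y\<close>.\<close>

lemma correlation_q:
  "(\<integral>p. w p * T s q p \<partial>lebesgue) = exp (- b * s) * (\<integral>p. (\<Theta> p * u p) * Y (dil \<gamma> s p) \<partial>lebesgue)"
proof -
  have "(\<integral>p. w p * T s q p \<partial>lebesgue) = (\<integral>p. exp (- b * s) * ((\<Theta> p * u p) * Y (dil \<gamma> s p)) \<partial>lebesgue)"
  proof (rule integral_cong_AE)
    show "(\<lambda>p. w p * T s q p) \<in> borel_measurable lebesgue"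
      by (intro borel_measurable_times sq_integrable_measurable sq_integrable_T sq_w sq_q)
    show "AE p in lebesgue. w p * T s q p = exp (- b * s) * ((\<Theta> p * u p) * Y (dil \<gamma> s p))"
      using \<Theta>_u AE_neq_0
    proof eventually_elim
      case (elim p)
      have r: "rho \<gamma> p powr (- \<alpha> - 1) = rho \<gamma> p powr (- \<alpha> - 2) * rho \<gamma> p"
      proof -
        have "- \<alpha> - 1 = (- \<alpha> - 2) + 1" by simp
        then show ?thesis by (simp only: powr_add powr_one rho_nonneg)
      qed
      have "w p * (ang \<gamma> i p * T s (\<xi> i) p) = exp (- b * s) * ((\<Theta> p * u p) *
          (rho \<gamma> (dil \<gamma> s p) * (field_coef \<gamma> i (dil \<gamma> s p) * drho \<gamma> i (dil \<gamma> s p)) * V i (dil \<gamma> s p)))" for i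
        unfolding elim(1) rho_split T_\<xi> w_def rho_dil[OF gamma] drho_dil[OF gamma] sqrt_psi_ang[OF gamma elim(2), symmetric] r
        by (simp only: ac_simps)
      then show ?case
        unfolding T_q Y_def sum_distrib_left by simp
    qed
  qed measurable
  then show ?thesis by simp
qed

text \<open>The function \<open>s \<mapsto> \<langle>w, T\<^sub>s w\<rangle>\<close> has derivative \<open>\<langle>q - b w, T\<^bsub>-s\<^esub> w\<rangle>\<close>; only the resulting mean value estimate is stated.\<close>

lemma correlation_bound:
  assumes h: "0 \<le> h" and L: "\<And>s. 0 \<le> s \<Longrightarrow> s \<le> h \<Longrightarrow> \<bar>\<integral>p. (q p - b * w p) * D s p \<partial>lebesgue\<bar> \<le> L"
  shows "\<bar>2 * (\<integral>p. w p * T 0 w p \<partial>lebesgue) - (\<integral>p. w p * T h w p \<partial>lebesgue) - (\<integral>p. w p * T (- h) w p \<partial>lebesgue)\<bar> \<le> h * L"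
proof -
  define M where "M = r0 powr (- 2 * \<alpha> - 4)"
  have M: "0 \<le> M" by (simp add: M_def)
  have m1: "(\<lambda>p. psi \<gamma> p * \<Theta> p) \<in> borel_measurable borel"
    by (intro borel_measurable_times borel_measurable_psi gamma measurable_\<Theta>)
  have b1: "\<bar>psi \<gamma> p * \<Theta> p\<bar> \<le> M" if "p \<noteq> 0" for p
    using mult_mono[OF psi_le_1[OF gamma that] \<Theta>_bound[of p]] psi_nonneg[of \<gamma> p] M
    by (simp add: abs_mult M_def)
  have b2: "\<bar>\<Theta> p\<bar> \<le> M" for p using \<Theta>_bound by (simp add: M_def)
  note outf = test_fun.support[OF test outS] and sqf = test_fun.sq_integrable_f[OF test]
  \<comment> \<open>The pairings for \<open>f n\<close> approach those for the limit, uniformly for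
    |s| at most \<open>h\<close>: first the unnormalised correlation, then its derivative expressed
    through \<open>radial\<close>.\<close>
  obtain \<delta>A where \<delta>A: "\<delta>A \<longlonglongrightarrow> 0"
    "\<And>n s. \<bar>s\<bar> \<le> h \<Longrightarrow> \<bar>(\<integral>p. (psi \<gamma> p * \<Theta> p * f n p) * f n (dil \<gamma> s p) \<partial>lebesgue)
       - (\<integral>p. (psi \<gamma> p * \<Theta> p * u p) * u (dil \<gamma> s p) \<partial>lebesgue)\<bar> \<le> \<delta>A n"
    by (rule pairing_dil_uniform[OF weight_sq_integrable[OF m1 b1 sq_u out_u] weight_sq_integrable[OF m1 b1 sqf outf]
          weight_limit[OF m1 b1 M sq_u out_u sqf outf lim_u] sq_u sqf lim_u, of h]) blast+
  obtain \<delta>B where \<delta>B: "\<delta>B \<longlonglongrightarrow> 0"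
    "\<And>n s. \<bar>s\<bar> \<le> h \<Longrightarrow> \<bar>(\<integral>p. (\<Theta> p * f n p) * test_fun.radial \<gamma> (f n) (dil \<gamma> s p) \<partial>lebesgue)
       - (\<integral>p. (\<Theta> p * u p) * Y (dil \<gamma> s p) \<partial>lebesgue)\<bar> \<le> \<delta>B n"
    by (rule pairing_dil_uniform[OF weight_sq_integrable[OF measurable_\<Theta> b2 sq_u out_u] weight_sq_integrable[OF measurable_\<Theta> b2 sqf outf]
          weight_limit[OF measurable_\<Theta> b2 M sq_u out_u sqf outf lim_u] sq_Y sq_radial radial_limit, of h]) blast+
  define An where "An = (\<lambda>n s. \<integral>p. (psi \<gamma> p * \<Theta> p * f n p) * f n (dil \<gamma> s p) \<partial>lebesgue)"
  define A where "A = (\<lambda>s. \<integral>p. (psi \<gamma> p * \<Theta> p * u p) * u (dil \<gamma> s p) \<partial>lebesgue)"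
  define Bn where "Bn = (\<lambda>n s. \<integral>p. (\<Theta> p * f n p) * test_fun.radial \<gamma> (f n) (dil \<gamma> s p) \<partial>lebesgue)"
  define B where "B = (\<lambda>s. \<integral>p. (\<Theta> p * u p) * Y (dil \<gamma> s p) \<partial>lebesgue)"
  have An_lim: "(\<lambda>n. An n s) \<longlonglongrightarrow> A s" for s
    unfolding An_def A_def
    by (intro l2_pairing_tendsto weight_sq_integrable[OF m1 b1] weight_limit[OF m1 b1 M] sq_integrable_dil dil_limit
        sq_u out_u sqf outf lim_u)
  have An_der: "(An n has_real_derivative Bn n s) (at s)" for n s
    unfolding An_def Bn_def by (rule test_fun.correlation_has_derivative[OF test continuous_on_\<Theta>])
  have cA: "(\<integral>p. w p * T s w p \<partial>lebesgue) = exp (- b * s) * A s" for s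
    unfolding A_def by (rule correlation_w)
  have "\<bar>2 * (\<integral>p. w p * T 0 w p \<partial>lebesgue) - (\<integral>p. w p * T h w p \<partial>lebesgue) - (\<integral>p. w p * T (- h) w p \<partial>lebesgue)\<bar> \<le> h * L"
  \<comment> \<open>The term with \<open>b\<close> in the derivative comes from the factor
    \<open>exp (- b * s)\<close>, and \<open>exp (\<bar>b\<bar> * h)\<close> bounds that factor on
    the interval.\<close>
  proof (rule mean_value_limit[OF h, where C = "\<lambda>n s. exp (- b * s) * An n s"
        and D = "\<lambda>n s. exp (- b * s) * (Bn n s - b * An n s)" and d = "\<lambda>s. exp (- b * s) * (B s - b * A s)"
        and \<delta> = "\<lambda>n. exp (\<bar>b\<bar> * h) * (\<delta>B n + \<bar>b\<bar> * \<delta>A n)" and c = "\<lambda>s. \<integral>p. w p * T s w p \<partial>lebesgue"])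
    fix n s
    have "((\<lambda>s. exp (- b * s)) has_real_derivative - b * exp (- b * s)) (at s)"
      by (auto intro!: derivative_eq_intros)
    from DERIV_mult[OF this An_der]
    show "((\<lambda>s. exp (- b * s) * An n s) has_real_derivative exp (- b * s) * (Bn n s - b * An n s)) (at s)"
      by (simp add: algebra_simps)
    show "(\<lambda>n. exp (- b * s) * An n s) \<longlonglongrightarrow> (\<integral>p. w p * T s w p \<partial>lebesgue)"
      unfolding cA by (intro tendsto_intros An_lim)
    show "(\<lambda>n. exp (\<bar>b\<bar> * h) * (\<delta>B n + \<bar>b\<bar> * \<delta>A n)) \<longlonglongrightarrow> 0"
      by (rule tendsto_eq_rhs, (rule tendsto_intros \<delta>A \<delta>B)+) simp
    assume s: "\<bar>s\<bar> \<le> h"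
    have "- b * s \<le> \<bar>b\<bar> * \<bar>s\<bar>"
      by (metis abs_ge_self abs_minus_cancel abs_mult mult_minus_left)
    also have "\<dots> \<le> \<bar>b\<bar> * h" using s by (intro mult_left_mono) auto
    finally have e: "exp (- b * s) \<le> exp (\<bar>b\<bar> * h)" by simp
    have "\<bar>(Bn n s - B s) - b * (An n s - A s)\<bar> \<le> \<delta>B n + \<bar>b\<bar> * \<delta>A n"
    proof -
      have "\<bar>b * (An n s - A s)\<bar> \<le> \<bar>b\<bar> * \<delta>A n"
        unfolding abs_mult using \<delta>A(2)[OF s, of n] by (intro mult_left_mono) (auto simp: An_def A_def)
      moreover have "\<bar>Bn n s - B s\<bar> \<le> \<delta>B n"
        using \<delta>B(2)[OF s, of n] by (auto simp: Bn_def B_def)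
      ultimately show ?thesis by linarith
    qed
    from mult_mono[OF e this]
    have "\<bar>exp (- b * s) * ((Bn n s - B s) - b * (An n s - A s))\<bar> \<le> exp (\<bar>b\<bar> * h) * (\<delta>B n + \<bar>b\<bar> * \<delta>A n)"
      by (simp add: abs_mult)
    moreover have "exp (- b * s) * ((Bn n s - B s) - b * (An n s - A s))
        = exp (- b * s) * (Bn n s - b * An n s) - exp (- b * s) * (B s - b * A s)"
      by (simp add: algebra_simps)
    ultimately show "\<bar>exp (- b * s) * (Bn n s - b * An n s) - exp (- b * s) * (B s - b * A s)\<bar> \<le> exp (\<bar>b\<bar> * h) * (\<delta>B n + \<bar>b\<bar> * \<delta>A n)"
      by simp
  next
    fix s assume s: "0 \<le> s" "s \<le> h"
    have sqd: "sq_integrable lebesgue (\<lambda>p. q p - b * w p)"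
      by (intro sq_integrable_diff sq_integrable_cmult sq_q sq_w)
    \<comment> \<open>Moving \<open>T s\<close> across the pairing exhibits the limiting derivative
      as a pairing with \<open>T (- s) w\<close>, so its odd part is, up to sign, the pairing with
      \<open>D s\<close>.\<close>
    have dd: "exp (- b * s) * (B s - b * A s) = (\<integral>p. (q p - b * w p) * T (- s) w p \<partial>lebesgue)" for s
    proof -
      have "(\<integral>p. (q p - b * w p) * T (- s) w p \<partial>lebesgue) = (\<integral>p. T s (\<lambda>p. q p - b * w p) p * w p \<partial>lebesgue)"
        by (rule T_adjoint[OF sqd sq_w, symmetric])
      also have "\<dots> = (\<integral>p. w p * T s q p - b * (w p * T s w p) \<partial>lebesgue)"
        by (intro Bochner_Integration.integral_cong refl) (simp add: T_def algebra_simps)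
      also have "\<dots> = (\<integral>p. w p * T s q p \<partial>lebesgue) - b * (\<integral>p. w p * T s w p \<partial>lebesgue)"
        by (simp add: sq_integrable_mult_integrable sq_w sq_q sq_integrable_T)
      finally show ?thesis unfolding correlation_q cA B_def by (simp add: algebra_simps)
    qed
    show "\<bar>exp (- b * s) * (B s - b * A s) - exp (- b * - s) * (B (- s) - b * A (- s))\<bar> \<le> L"
      unfolding dd using L[OF s] pairing_D[OF sqd, of s] by (simp add: abs_minus_commute)
  qed
  then show ?thesis .
qed

section \<open>Growth of the displacement of \<open>w\<close> along the group\<close>

definition N where "N s = l2norm lebesgue (\<lambda>p. T s w p - w p)"

lemma N_nonneg: "0 \<le> N s"
  by (simp add: N_def)

lemma N_le_norm: "N s \<le> 2 * l2norm lebesgue w"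
  unfolding N_def using l2norm_triangle_diff[OF sq_integrable_T[OF sq_w] sq_w, of s] by (simp add: l2norm_T sq_w)

text \<open>As the group is isometric and the correlation is even, the squared displacement is a
  symmetric second difference of the correlation at 0, the quantity estimated by
  \<open>correlation_bound\<close>.\<close>

lemma N_power2: "(N s)\<^sup>2 = 2 * (\<integral>p. w p * T 0 w p \<partial>lebesgue) - (\<integral>p. w p * T s w p \<partial>lebesgue) - (\<integral>p. w p * T (- s) w p \<partial>lebesgue)"
proof -
  have "(N s)\<^sup>2 = (l2norm lebesgue w)\<^sup>2 + (l2norm lebesgue w)\<^sup>2 - 2 * (\<integral>p. T s w p * w p \<partial>lebesgue)"
    unfolding N_def by (subst l2norm_diff_power2) (simp_all add: sq_integrable_T sq_w l2norm_T)
  also have "(l2norm lebesgue w)\<^sup>2 = (\<integral>p. w p * T 0 w p \<partial>lebesgue)"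
    by (simp add: l2norm_power2 T_0) (simp add: power2_eq_square)
  also have "(\<integral>p. T s w p * w p \<partial>lebesgue) = (\<integral>p. w p * T s w p \<partial>lebesgue)"
    by (simp add: mult.commute)
  finally show ?thesis using T_symmetric[OF sq_w, of s] by simp
qed

text \<open>\<open>D s\<close> is the sum of \<open>T s w - w\<close> and
  \<open>w - T (- s) w\<close>. The latter is the image of the former under the isometry
  \<open>T (- s)\<close>.\<close>

lemma D_le_N: "l2norm lebesgue (D s) \<le> 2 * N s"
proof -
  have 1: "T (- s) (\<lambda>p. T s w p - w p) = (\<lambda>p. w p - T (- s) w p)"
    unfolding T_diff by (simp add: T_T T_0 fun_cong[OF T_0])
  have "l2norm lebesgue (\<lambda>p. (T s w p - w p) + (w p - T (- s) w p)) \<le> N s + l2norm lebesgue (\<lambda>p. w p - T (- s) w p)"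
    unfolding N_def by (intro l2norm_triangle sq_integrable_diff sq_integrable_T sq_w)
  also have "l2norm lebesgue (\<lambda>p. w p - T (- s) w p) = N s"
    unfolding 1[symmetric] N_def by (intro l2norm_T sq_integrable_diff sq_integrable_T sq_w)
  finally show ?thesis by simp
qed

text \<open>
  With \<open>M\<close> the supremum of \<open>N\<close> on \<open>[0, h]\<close>, the energy identity gives the self-improving
  estimate \<open>M\<^sup>2 \<le> h \<parallel>G\<parallel> M / (\<alpha> + 1)\<close>.
\<close>

lemma N_le:
  assumes h: "0 \<le> h"
  shows "N h \<le> h * l2norm lebesgue G / (\<alpha> + 1)"
proof -
  define M where "M = (SUP s\<in>{0..h}. N s)"
  define A where "A = h * l2norm lebesgue G / (\<alpha> + 1)"
  have A: "0 \<le> A" using h alpha by (simp add: A_def)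
  \<comment> \<open>The crude bound by twice the norm of \<open>w\<close> makes the supremum finite,
    so that it can be divided out at the end.\<close>
  have bdd: "bdd_above (N ` {0..h})" using N_le_norm by (auto intro!: bdd_aboveI)
  have NM: "N s \<le> M" if "0 \<le> s" "s \<le> h" for s
    unfolding M_def using that by (intro cSUP_upper bdd) auto
  have M: "0 \<le> M" using NM[of 0] N_nonneg[of 0] h by linarith
  have "N s \<le> sqrt (A * M)" if s: "0 \<le> s" "s \<le> h" for s
  proof -
    have "\<bar>\<integral>p. (q p - b * w p) * D r p \<partial>lebesgue\<bar> \<le> l2norm lebesgue G * M / (\<alpha> + 1)" if r: "0 \<le> r" "r \<le> s" for r
    proof -
      have "\<bar>\<integral>p. G p * D r p \<partial>lebesgue\<bar> \<le> l2norm lebesgue G * l2norm lebesgue (D r)"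
        by (rule l2_Cauchy_Schwarz[OF sq_G sq_D])
      also have "\<dots> \<le> l2norm lebesgue G * (2 * M)"
        using D_le_N[of r] NM[of r] r s by (intro mult_left_mono) auto
      \<comment> \<open>The antisymmetric identity carries the factor
        \<open>2 * \<alpha> + 2\<close>; dividing by it is the source of the decay in
        \<alpha>.\<close>
      finally have "(2 * (\<alpha> + 1)) * \<bar>\<integral>p. (q p - b * w p) * D r p \<partial>lebesgue\<bar> \<le> l2norm lebesgue G * (2 * M)"
        unfolding energy_identity_antisymmetric using alpha by (simp add: abs_mult algebra_simps)
      then show ?thesis using alpha by (simp add: field_simps)
    qed
    from correlation_bound[OF s(1) this] have "(N s)\<^sup>2 \<le> s * (l2norm lebesgue G * M / (\<alpha> + 1))"
      unfolding N_power2 by simp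
    also have "\<dots> \<le> h * (l2norm lebesgue G * M / (\<alpha> + 1))"
      using s M alpha by (intro mult_right_mono) auto
    finally have "(N s)\<^sup>2 \<le> A * M" by (simp add: A_def)
    then show ?thesis by (rule real_le_rsqrt)
  qed
  then have "M \<le> sqrt (A * M)"
    using h unfolding M_def[symmetric] by (subst (1) M_def) (intro cSUP_least; auto)
  then have "M\<^sup>2 \<le> A * M" using M A by (metis mult_nonneg_nonneg power_mono real_sqrt_pow2)
  then have "M \<le> A" using M A by (cases "M = 0") (auto simp: power2_eq_square)
  with NM[OF h] show ?thesis by (simp add: A_def)
qed

section \<open>Weighted bounds for the function and its gradient\<close>

lemma out_w: "R \<le> rho \<gamma> p \<Longrightarrow> w p = 0"
  by (simp add: w_def out_u)

text \<open>The weighted \<open>w\<close> is the weighted \<open>T h w\<close> minus the weighted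
  displacement. Homogeneity of the gauge gives the first term the factor \<open>exp (- 1)\<close>,
  at most 1/2, so it is absorbed on the left; the displacement is bounded by
  \<open>N_le\<close>.\<close>

lemma Hardy_bound:
  assumes \<epsilon>: "\<epsilon> > 0"
  shows "l2norm lebesgue (\<lambda>p. rho \<gamma> p powr (\<epsilon> / 2) * w p) \<le> 4 * R powr (\<epsilon> / 2) * l2norm lebesgue G / (\<epsilon> * (\<alpha> + 1))"
proof -
  \<comment> \<open>Chosen so that \<open>\<epsilon> / 2 * h\<close> equals 1, which makes the
    scaling factor exactly \<open>exp 1\<close>.\<close>
  define h where "h = 2 / \<epsilon>"
  have h: "0 < h" using \<epsilon> by (simp add: h_def)
  let ?\<omega> = "\<lambda>p. rho \<gamma> p powr (\<epsilon> / 2) * w p"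
  let ?W = "\<lambda>p. rho \<gamma> p powr (\<epsilon> / 2) * (T h w p - w p)"
  have e: "exp (- 1) \<le> (1 / 2 :: real)"
    using exp_ge_add_one_self[of 1] by (simp add: exp_minus field_simps)
  have T\<omega>: "T h ?\<omega> p = exp 1 * (rho \<gamma> p powr (\<epsilon> / 2) * T h w p)" for p
    using \<epsilon> by (simp add: T_def rho_dil_powr h_def)
  have sq\<omega>: "sq_integrable lebesgue ?\<omega>" by (rule sq_w_power)
  have e1: "exp (- 1) * exp 1 = (1 :: real)" by (simp add: exp_minus)
  have sqT: "sq_integrable lebesgue (\<lambda>p. rho \<gamma> p powr (\<epsilon> / 2) * T h w p)"
  proof -
    have "(\<lambda>p. rho \<gamma> p powr (\<epsilon> / 2) * T h w p) = (\<lambda>p. exp (- 1) * T h ?\<omega> p)"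
      by (simp only: T\<omega> mult.assoc[symmetric] e1 mult_1_left)
    then show ?thesis using sq_integrable_cmult[OF sq_integrable_T[OF sq\<omega>]] by simp
  qed
  have nT: "l2norm lebesgue (\<lambda>p. rho \<gamma> p powr (\<epsilon> / 2) * T h w p) = exp (- 1) * l2norm lebesgue ?\<omega>"
  proof -
    have "(\<lambda>p. rho \<gamma> p powr (\<epsilon> / 2) * T h w p) = (\<lambda>p. exp (- 1) * T h ?\<omega> p)"
      by (simp only: T\<omega> mult.assoc[symmetric] e1 mult_1_left)
    then show ?thesis by (simp only: l2norm_cmult l2norm_T[OF sq\<omega>] abs_exp_cancel)
  qed
  have sqd: "sq_integrable lebesgue (\<lambda>p. T h w p - w p)"
    by (intro sq_integrable_diff sq_integrable_T sq_w)
  have W: "l2norm lebesgue ?W \<le> R powr (\<epsilon> / 2) * N h"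
    unfolding N_def
  proof (rule l2norm_le[OF sqd])
    have "\<bar>?W p\<bar> \<le> R powr (\<epsilon> / 2) * \<bar>T h w p - w p\<bar>" for p
    proof (cases "rho \<gamma> p < R")
      case True
      then have "rho \<gamma> p powr (\<epsilon> / 2) \<le> R powr (\<epsilon> / 2)"
        using \<epsilon> by (intro powr_mono2) auto
      then show ?thesis by (simp add: abs_mult mult_right_mono)
    next
      case False
      \<comment> \<open>For positive \<open>h\<close> the dilation increases the gauge, so outside
        the ball both \<open>w\<close> and \<open>T h w\<close> vanish and the weight may be
        replaced by its value at \<open>R\<close>.\<close>
      have "1 * rho \<gamma> p \<le> exp h * rho \<gamma> p"
        using h by (intro mult_right_mono) auto
      with False have "R \<le> rho \<gamma> (dil \<gamma> h p)" by (simp add: rho_dil[OF gamma])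
      with False show ?thesis by (simp add: T_def out_w)
    qed
    then show "AE p in lebesgue. \<bar>?W p\<bar> \<le> R powr (\<epsilon> / 2) * \<bar>T h w p - w p\<bar>" by simp
  qed simp
  have "l2norm lebesgue (\<lambda>p. rho \<gamma> p powr (\<epsilon> / 2) * T h w p - ?W p) \<le> exp (- 1) * l2norm lebesgue ?\<omega> + R powr (\<epsilon> / 2) * N h"
  proof -
    have "?W = (\<lambda>p. rho \<gamma> p powr (\<epsilon> / 2) * T h w p - ?\<omega> p)"
      by (simp add: right_diff_distrib)
    then have "sq_integrable lebesgue ?W" using sq_integrable_diff[OF sqT sq\<omega>] by simp
    from l2norm_triangle_diff[OF sqT this] show ?thesis using W nT by linarith
  qed
  also have "(\<lambda>p. rho \<gamma> p powr (\<epsilon> / 2) * T h w p - ?W p) = ?\<omega>"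
    by (simp add: right_diff_distrib)
  finally have "l2norm lebesgue ?\<omega> \<le> exp (- 1) * l2norm lebesgue ?\<omega> + R powr (\<epsilon> / 2) * N h" .
  moreover have "exp (- 1) * l2norm lebesgue ?\<omega> \<le> 1 / 2 * l2norm lebesgue ?\<omega>"
    by (intro mult_right_mono e) auto
  ultimately have "l2norm lebesgue ?\<omega> \<le> 2 * (R powr (\<epsilon> / 2) * N h)" by linarith
  also have "\<dots> \<le> 2 * (R powr (\<epsilon> / 2) * (h * l2norm lebesgue G / (\<alpha> + 1)))"
    using N_le[of h] h by (intro mult_left_mono) auto
  also have "\<dots> = 4 * R powr (\<epsilon> / 2) * l2norm lebesgue G / (\<epsilon> * (\<alpha> + 1))"
    by (simp add: h_def)
  finally show ?thesis .
qed

text \<open>\<open>power_identity\<close> with \<open>s = 0\<close> and the exponent raised by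
  \<epsilon> expresses the weighted gradient energy through a pairing with \<open>G\<close> and a
  cross term with \<kappa>; part of the energy absorbs the cross term.\<close>

lemma gradient_bound:
  assumes \<epsilon>: "\<epsilon> > 0"
  defines "\<omega> \<equiv> l2norm lebesgue (\<lambda>p. rho \<gamma> p powr (\<epsilon> / 2) * w p)"
  shows "(\<Sum>i\<in>UNIV. (l2norm lebesgue (\<lambda>p. rho \<gamma> p powr (\<epsilon> / 2) * \<xi> i p))\<^sup>2)
    \<le> 2 * R powr (\<epsilon> / 2) * l2norm lebesgue G * \<omega> + (2 * \<alpha> + 2 + \<epsilon>)\<^sup>2 * \<omega>\<^sup>2"
proof -
  let ?\<omega> = "\<lambda>p. rho \<gamma> p powr (\<epsilon> / 2) * w p"
  let ?\<eta> = "\<lambda>i p. rho \<gamma> p powr (\<epsilon> / 2) * \<xi> i p"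
  let ?q = "\<lambda>p. \<Sum>i\<in>UNIV. ang \<gamma> i p * ?\<eta> i p"
  define \<kappa> where "\<kappa> = - 2 * \<alpha> - 2 + \<epsilon>"
  define E where "E = (\<Sum>i\<in>UNIV. (l2norm lebesgue (?\<eta> i))\<^sup>2)"
  have E0: "0 \<le> E" by (simp add: E_def sum_nonneg)
  note sq\<omega> = sq_w_power[of "\<epsilon> / 2"] and sq\<eta> = sq_\<xi>_power[of "\<epsilon> / 2"]
  have sqq: "sq_integrable lebesgue ?q"
    by (intro sq_integrable_sum sq_integrable_ang_mult sq\<eta>)
  \<comment> \<open>The vector with components \<open>ang\<close> has length at most one, so
    contracting with it does not increase the energy.\<close>
  have q: "(l2norm lebesgue ?q)\<^sup>2 \<le> E"
  proof -
    have "(l2norm lebesgue ?q)\<^sup>2 \<le> (\<integral>p. (\<Sum>i\<in>UNIV. (?\<eta> i p)\<^sup>2) \<partial>lebesgue)"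
      unfolding l2norm_power2
    proof (rule integral_mono_AE)
      show "integrable lebesgue (\<lambda>p. (?q p)\<^sup>2)" by (rule sq_integrableD[OF sqq])
      show "integrable lebesgue (\<lambda>p. \<Sum>i\<in>UNIV. (?\<eta> i p)\<^sup>2)"
        by (intro Bochner_Integration.integrable_sum sq_integrableD[OF sq\<eta>])
      have "(?q p)\<^sup>2 \<le> (\<Sum>i\<in>UNIV. (?\<eta> i p)\<^sup>2)" if "p \<noteq> 0" for p
      proof -
        have "(?q p)\<^sup>2 \<le> (\<Sum>i\<in>UNIV. (ang \<gamma> i p)\<^sup>2) * (\<Sum>i\<in>UNIV. (?\<eta> i p)\<^sup>2)"
          by (rule Cauchy_Schwarz_ineq_sum)
        also have "\<dots> \<le> 1 * (\<Sum>i\<in>UNIV. (?\<eta> i p)\<^sup>2)"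
          by (intro mult_right_mono sum_ang_power2_le gamma that sum_nonneg) auto
        finally show ?thesis by simp
      qed
      then show "AE p in lebesgue. (?q p)\<^sup>2 \<le> (\<Sum>i\<in>UNIV. (?\<eta> i p)\<^sup>2)"
        using AE_neq_0 by (auto elim!: eventually_mono)
    qed
    also have "\<dots> = E"
      unfolding E_def l2norm_power2 by (intro Bochner_Integration.integral_sum sq_integrableD[OF sq\<eta>])
    finally show ?thesis .
  qed
  have arg: "rho \<gamma> p powr x = rho \<gamma> p powr y * rho \<gamma> p powr z" if "x = y + z" for x y z p
    using that by (simp add: powr_add)
  have 1: "(\<integral>p. (rho \<gamma> p powr \<kappa> * F p) * u (dil \<gamma> 0 p) \<partial>lebesgue) = (\<integral>p. G p * (rho \<gamma> p powr \<epsilon> * w p) \<partial>lebesgue)"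
  proof (rule integral_cong_AE)
    show "(\<lambda>p. G p * (rho \<gamma> p powr \<epsilon> * w p)) \<in> borel_measurable lebesgue"
      by (intro borel_measurable_times sq_integrable_measurable sq_G sq_w_power)
    show "AE p in lebesgue. (rho \<gamma> p powr \<kappa> * F p) * u (dil \<gamma> 0 p) = G p * (rho \<gamma> p powr \<epsilon> * w p)"
      using AE_fst_neq_0
    proof eventually_elim
      case (elim p)
      have "rho \<gamma> p powr \<kappa> = rho \<gamma> p powr (- \<alpha>) * (rho \<gamma> p powr \<epsilon> * rho \<gamma> p powr (- \<alpha> - 2))"
        unfolding rho_powr_mult by (rule arg_cong[where f = "\<lambda>x. rho \<gamma> p powr x"]) (simp add: \<kappa>_def)
      then show ?case
        using psi_pos[OF gamma elim] unfolding w_def G_def by (simp only: dil_0) (simp add: field_simps)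
    qed
  qed measurable
  have 2: "(\<integral>p. (rho \<gamma> p powr (\<kappa> - 1) * (field_coef \<gamma> i p * drho \<gamma> i p) * V i p) * u (dil \<gamma> 0 p) \<partial>lebesgue)
      = (\<integral>p. (ang \<gamma> i p * ?\<eta> i p) * ?\<omega> p \<partial>lebesgue)" for i
  proof (rule integral_cong_AE)
    show "(\<lambda>p. (ang \<gamma> i p * ?\<eta> i p) * ?\<omega> p) \<in> borel_measurable lebesgue"
      by (intro borel_measurable_times[OF sq_integrable_measurable[OF sq_integrable_ang_mult[OF sq\<eta>]] sq_integrable_measurable[OF sq\<omega>]])
    show "AE p in lebesgue. (rho \<gamma> p powr (\<kappa> - 1) * (field_coef \<gamma> i p * drho \<gamma> i p) * V i p) * u (dil \<gamma> 0 p)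
        = (ang \<gamma> i p * ?\<eta> i p) * ?\<omega> p"
      using AE_neq_0
    proof eventually_elim
      case (elim p)
      have r: "rho \<gamma> p powr (\<kappa> - 1) = (rho \<gamma> p powr (\<epsilon> / 2) * rho \<gamma> p powr (- \<alpha> - 1))
          * (rho \<gamma> p powr (\<epsilon> / 2) * rho \<gamma> p powr (- \<alpha> - 2))"
        unfolding rho_powr_mult by (rule arg_cong[where f = "\<lambda>x. rho \<gamma> p powr x"]) (simp add: \<kappa>_def)
      show ?case
        unfolding w_def \<xi>_def r dil_0 sqrt_psi_ang[OF gamma elim, symmetric] by (simp only: ac_simps)
    qed
  qed measurable
  have 3: "(\<integral>p. (rho \<gamma> p powr \<kappa> * V i p) * V i (dil \<gamma> 0 p) \<partial>lebesgue) = (l2norm lebesgue (?\<eta> i))\<^sup>2" for i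
  proof -
    have r: "rho \<gamma> p powr \<kappa> = (rho \<gamma> p powr (\<epsilon> / 2) * rho \<gamma> p powr (- \<alpha> - 1)) * (rho \<gamma> p powr (\<epsilon> / 2) * rho \<gamma> p powr (- \<alpha> - 1))" for p
      unfolding rho_powr_mult by (rule arg_cong[where f = "\<lambda>x. rho \<gamma> p powr x"]) (simp add: \<kappa>_def)
    show ?thesis
      unfolding l2norm_power2 unfolding power2_eq_square \<xi>_def r dil_0
      by (intro Bochner_Integration.integral_cong refl) (simp only: ac_simps)
  qed
  have "(\<Sum>i\<in>UNIV. \<integral>p. (ang \<gamma> i p * ?\<eta> i p) * ?\<omega> p \<partial>lebesgue) = (\<integral>p. ?q p * ?\<omega> p \<partial>lebesgue)"
    unfolding sum_distrib_right
    by (intro Bochner_Integration.integral_sum[symmetric] sq_integrable_mult_integrable sq_integrable_ang_mult sq\<eta> sq\<omega>)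
  then have "(\<integral>p. G p * (rho \<gamma> p powr \<epsilon> * w p) \<partial>lebesgue) = - (\<kappa> * (\<integral>p. ?q p * ?\<omega> p \<partial>lebesgue) + E)"
    using power_identity[of \<kappa> 0] unfolding 1 2 3 E_def by (simp add: sum.distrib sum_distrib_left[symmetric])
  then have "E \<le> \<bar>\<integral>p. G p * (rho \<gamma> p powr \<epsilon> * w p) \<partial>lebesgue\<bar> + \<bar>\<kappa>\<bar> * \<bar>\<integral>p. ?q p * ?\<omega> p \<partial>lebesgue\<bar>"
    by (simp add: abs_mult[symmetric])
  also have "\<bar>\<integral>p. G p * (rho \<gamma> p powr \<epsilon> * w p) \<partial>lebesgue\<bar> \<le> l2norm lebesgue G * l2norm lebesgue (\<lambda>p. rho \<gamma> p powr \<epsilon> * w p)"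
    by (rule l2_Cauchy_Schwarz[OF sq_G sq_w_power])
  also have "l2norm lebesgue (\<lambda>p. rho \<gamma> p powr \<epsilon> * w p) \<le> R powr (\<epsilon> / 2) * \<omega>"
    unfolding \<omega>_def
  proof (rule l2norm_le[OF sq\<omega>])
    have "\<bar>rho \<gamma> p powr \<epsilon> * w p\<bar> \<le> R powr (\<epsilon> / 2) * \<bar>?\<omega> p\<bar>" for p
    proof (cases "rho \<gamma> p < R")
      case True
      then have "rho \<gamma> p powr (\<epsilon> / 2) \<le> R powr (\<epsilon> / 2)"
        using \<epsilon> by (intro powr_mono2) auto
      from mult_right_mono[OF this, of "\<bar>?\<omega> p\<bar>"] show ?thesis
        using arg[of \<epsilon> "\<epsilon> / 2" "\<epsilon> / 2" p] by (simp add: abs_mult)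
    qed (simp add: out_w)
    then show "AE p in lebesgue. \<bar>rho \<gamma> p powr \<epsilon> * w p\<bar> \<le> R powr (\<epsilon> / 2) * \<bar>?\<omega> p\<bar>" by simp
  qed simp
  also have "\<bar>\<integral>p. ?q p * ?\<omega> p \<partial>lebesgue\<bar> \<le> l2norm lebesgue ?q * \<omega>"
    unfolding \<omega>_def by (rule l2_Cauchy_Schwarz[OF sqq sq\<omega>])
  also have "l2norm lebesgue ?q \<le> sqrt E"
    using q by (rule real_le_rsqrt)
  finally have EE: "E \<le> l2norm lebesgue G * (R powr (\<epsilon> / 2) * \<omega>) + \<bar>\<kappa>\<bar> * (sqrt E * \<omega>)"
    by (simp add: mult_left_mono mult_right_mono \<omega>_def)
  \<comment> \<open>This square bounds twice the cross term by the sum of \<open>E\<close> and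
    \<open>\<kappa>\<^sup>2 * \<omega>\<^sup>2\<close>, so half of the energy is absorbed.\<close>
  have "0 \<le> (sqrt E - \<bar>\<kappa>\<bar> * \<omega>)\<^sup>2" by simp
  also have "\<dots> = E + \<kappa>\<^sup>2 * \<omega>\<^sup>2 - 2 * (\<bar>\<kappa>\<bar> * (sqrt E * \<omega>))"
    using E0 by (simp add: power2_diff power_mult_distrib)
  finally have "E \<le> 2 * (l2norm lebesgue G * (R powr (\<epsilon> / 2) * \<omega>)) + \<kappa>\<^sup>2 * \<omega>\<^sup>2"
    using EE by linarith
  also have "\<kappa>\<^sup>2 * \<omega>\<^sup>2 \<le> (2 * \<alpha> + 2 + \<epsilon>)\<^sup>2 * \<omega>\<^sup>2"
  proof (rule mult_right_mono)
    have "\<bar>\<kappa>\<bar> \<le> 2 * \<alpha> + 2 + \<epsilon>" using \<epsilon> alpha by (simp add: \<kappa>_def)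
    from power_mono[OF this abs_ge_zero, of 2] show "\<kappa>\<^sup>2 \<le> (2 * \<alpha> + 2 + \<epsilon>)\<^sup>2" by simp
  qed simp
  finally show ?thesis unfolding E_def by (simp add: algebra_simps)
qed

text \<open>The three summands of the constant bound, in this order, the term with
  \<open>\<alpha>\<^sup>2\<close>, the pairing with \<open>G\<close> and the squared exponent in
  \<open>gradient_bound\<close>.\<close>

lemma Carleman_bound:
  assumes \<epsilon>: "\<epsilon> > 0"
  shows "\<alpha>\<^sup>2 * (l2norm lebesgue (\<lambda>p. rho \<gamma> p powr (\<epsilon> / 2) * w p))\<^sup>2
      + (\<Sum>i\<in>UNIV. (l2norm lebesgue (\<lambda>p. rho \<gamma> p powr (\<epsilon> / 2) * \<xi> i p))\<^sup>2)
    \<le> (16 / \<epsilon>\<^sup>2 + 8 / \<epsilon> + 16 * (2 + \<epsilon>)\<^sup>2 / \<epsilon>\<^sup>2) * R powr \<epsilon> * (l2norm lebesgue G)\<^sup>2"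
proof -
  define \<omega> where "\<omega> = l2norm lebesgue (\<lambda>p. rho \<gamma> p powr (\<epsilon> / 2) * w p)"
  define A where "A = R powr (\<epsilon> / 2) * l2norm lebesgue G"
  have A2: "A\<^sup>2 = R powr \<epsilon> * (l2norm lebesgue G)\<^sup>2"
    by (simp add: A_def power_mult_distrib power2_eq_square[of "R powr (\<epsilon> / 2)"] powr_add[symmetric])
  have A0: "0 \<le> A" and \<omega>0: "0 \<le> \<omega>" by (simp_all add: A_def \<omega>_def)
  have \<omega>: "(\<alpha> + 1) * \<omega> \<le> 4 / \<epsilon> * A"
  proof -
    have "\<omega> \<le> 4 * A / (\<epsilon> * (\<alpha> + 1))"
      using Hardy_bound[OF \<epsilon>] by (simp add: \<omega>_def A_def mult.assoc)
    then have "(\<alpha> + 1) * \<omega> \<le> (\<alpha> + 1) * (4 * A / (\<epsilon> * (\<alpha> + 1)))"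
      using alpha by (intro mult_left_mono) auto
    also have "\<dots> = 4 / \<epsilon> * A" using alpha \<epsilon> by (simp add: divide_simps)
    finally show ?thesis .
  qed
  have \<alpha>\<omega>: "\<alpha> * \<omega> \<le> 4 / \<epsilon> * A" "\<omega> \<le> 4 / \<epsilon> * A"
    using \<omega> alpha \<omega>0 mult_nonneg_nonneg[of \<alpha> \<omega>] unfolding distrib_right by linarith+
  have 1: "\<alpha>\<^sup>2 * \<omega>\<^sup>2 \<le> 16 / \<epsilon>\<^sup>2 * A\<^sup>2"
    using power_mono[OF \<alpha>\<omega>(1), of 2] alpha \<omega>0 by (simp add: power_mult_distrib power_divide)
  have 2: "2 * A * \<omega> \<le> 8 / \<epsilon> * A\<^sup>2"
    using mult_left_mono[OF \<alpha>\<omega>(2), of "2 * A"] A0 by (simp add: power2_eq_square)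
  \<comment> \<open>The growth of the exponent in \<alpha> is matched by the factor
    \<open>\<alpha> + 1\<close> gained in \<open>Hardy_bound\<close>, so the constant depends on
    \<epsilon> alone.\<close>
  have "(2 * \<alpha> + 2 + \<epsilon>) * \<omega> \<le> (2 + \<epsilon>) * ((\<alpha> + 1) * \<omega>)"
    using alpha \<epsilon> \<omega>0 by (simp add: algebra_simps)
  also have "\<dots> \<le> (2 + \<epsilon>) * (4 / \<epsilon> * A)"
    using \<omega> \<epsilon> by (intro mult_left_mono) auto
  finally have "((2 * \<alpha> + 2 + \<epsilon>) * \<omega>)\<^sup>2 \<le> ((2 + \<epsilon>) * (4 / \<epsilon> * A))\<^sup>2"
    using alpha \<epsilon> \<omega>0 by (intro power_mono) auto
  then have 3: "(2 * \<alpha> + 2 + \<epsilon>)\<^sup>2 * \<omega>\<^sup>2 \<le> 16 * (2 + \<epsilon>)\<^sup>2 / \<epsilon>\<^sup>2 * A\<^sup>2"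
    unfolding power_mult_distrib power_divide by (simp add: ac_simps)
  have "\<alpha>\<^sup>2 * \<omega>\<^sup>2 + (\<Sum>i\<in>UNIV. (l2norm lebesgue (\<lambda>p. rho \<gamma> p powr (\<epsilon> / 2) * \<xi> i p))\<^sup>2)
     \<le> \<alpha>\<^sup>2 * \<omega>\<^sup>2 + (2 * A * \<omega> + (2 * \<alpha> + 2 + \<epsilon>)\<^sup>2 * \<omega>\<^sup>2)"
    using gradient_bound[OF \<epsilon>] by (simp add: \<omega>_def A_def mult.assoc)
  also have "\<dots> \<le> (16 / \<epsilon>\<^sup>2 + 8 / \<epsilon> + 16 * (2 + \<epsilon>)\<^sup>2 / \<epsilon>\<^sup>2) * A\<^sup>2"
    using 1 2 3 by (simp only: distrib_right)
  finally show ?thesis unfolding A2 \<omega>_def by (simp add: mult.assoc)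
qed

end

text \<open>What remains is to place the extended functions in the two locales and to rewrite the
  nonnegative integrals as squared norms, to which \<open>Carleman_bound\<close> applies.\<close>

theorem theorem1p1:
  fixes \<epsilon> :: real
  assumes "\<epsilon> > 0"
  shows "\<exists>C>0. \<forall>\<gamma>>0. \<forall>\<alpha>. \<alpha> > max 0 ((hom_dim CARD('m::finite) CARD('k::finite) \<gamma> - 4) / 2) \<longrightarrow>
    (\<forall>R>0. \<forall>(u :: ('m, 'k) point \<Rightarrow> real) Xu XXu.
       S22_0 \<gamma> (gauge_ball \<gamma> R - {0}) u Xu XXu \<longrightarrow>
       ess_support (gauge_ball \<gamma> R - {0}) u \<subseteq> gauge_ball \<gamma> R - {0} \<longrightarrow>
       ennreal (\<alpha>\<^sup>2) *
         (\<integral>\<^sup>+ p \<in> gauge_ball \<gamma> R.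
            ennreal (rho \<gamma> p powr (- 2 * \<alpha> - 4 + \<epsilon>) * (u p)\<^sup>2 * psi \<gamma> p) \<partial>lebesgue)
       + (\<integral>\<^sup>+ p \<in> gauge_ball \<gamma> R.
            ennreal (rho \<gamma> p powr (- 2 * \<alpha> - 2 + \<epsilon>) * sq_length Xu p) \<partial>lebesgue)
       \<le> ennreal (C * R powr \<epsilon>) *
         (\<integral>\<^sup>+ p \<in> gauge_ball \<gamma> R.
            ennreal (rho \<gamma> p powr (- 2 * \<alpha>) * (grushin_op XXu p)\<^sup>2 * inverse (psi \<gamma> p)) \<partial>lebesgue))"
proof -
  define C where "C = 16 / \<epsilon>\<^sup>2 + 8 / \<epsilon> + 16 * (2 + \<epsilon>)\<^sup>2 / \<epsilon>\<^sup>2"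
  have C: "C > 0" using assms by (simp add: C_def add_pos_pos)
  have main: "ennreal (\<alpha>\<^sup>2) *
         (\<integral>\<^sup>+ p \<in> gauge_ball \<gamma> R.
            ennreal (rho \<gamma> p powr (- 2 * \<alpha> - 4 + \<epsilon>) * (u p)\<^sup>2 * psi \<gamma> p) \<partial>lebesgue)
       + (\<integral>\<^sup>+ p \<in> gauge_ball \<gamma> R.
            ennreal (rho \<gamma> p powr (- 2 * \<alpha> - 2 + \<epsilon>) * sq_length V p) \<partial>lebesgue)
       \<le> ennreal (C * R powr \<epsilon>) *
         (\<integral>\<^sup>+ p \<in> gauge_ball \<gamma> R.
            ennreal (rho \<gamma> p powr (- 2 * \<alpha>) * (grushin_op W p)\<^sup>2 * inverse (psi \<gamma> p)) \<partial>lebesgue)"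
    if g: "\<gamma> > 0" and \<alpha>: "\<alpha> > 0" and R: "R > 0"
      and S22: "S22_0 \<gamma> (gauge_ball \<gamma> R - {0}) u V W"
      and supp: "ess_support (gauge_ball \<gamma> R - {0}) u \<subseteq> gauge_ball \<gamma> R - {0}"
    for \<gamma> \<alpha> R and u :: "('m, 'k) point \<Rightarrow> real" and V W
  proof -
    define \<Omega> where "\<Omega> = (gauge_ball \<gamma> R - {0} :: ('m, 'k) point set)"
    \<comment> \<open>Extension by zero makes the dilated functions meaningful on the whole space;
      the origin, which is removed from \<Omega>, is a null set.\<close>
    define u0 where "u0 = (\<lambda>p. indicator \<Omega> p * u p)"
    define V0 where "V0 = (\<lambda>i p. indicator \<Omega> p * V i p)"
    define F0 where "F0 = (\<lambda>p. indicator \<Omega> p * grushin_op W p)"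
    have \<Omega>: "p \<in> \<Omega> \<longleftrightarrow> p \<noteq> 0 \<and> rho \<gamma> p < R" for p
      by (auto simp: \<Omega>_def gauge_ball_def)
    obtain f S where f: "\<And>n. test_fun \<gamma> (f n) (S n)" "\<And>n. S n \<subseteq> \<Omega>"
      "(\<lambda>n. l2norm lebesgue (\<lambda>p. f n p - u0 p)) \<longlonglongrightarrow> 0"
      "\<And>i. (\<lambda>n. l2norm lebesgue (\<lambda>p. grushin_X \<gamma> i (f n) p - V0 i p)) \<longlonglongrightarrow> 0"
      "(\<lambda>n. l2norm lebesgue (\<lambda>p. grushin_op (\<lambda>i j. grushin_X \<gamma> i (grushin_X \<gamma> j (f n))) p - F0 p)) \<longlonglongrightarrow> 0"
      unfolding u0_def V0_def F0_def
      by (rule S22_0_approximation[OF g S22[folded \<Omega>_def]]) (auto simp: \<Omega>)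
    have L2: "u \<in> L2_on \<Omega>" "V i \<in> L2_on \<Omega>" "W i j \<in> L2_on \<Omega>" for i j
      using S22 unfolding S22_0_def \<Omega>_def by auto
    have sqF: "sq_integrable lebesgue F0"
      unfolding F0_def grushin_op_def sum_distrib_left
      by (intro sq_integrable_sum sq_integrable_L2_on L2)
    \<comment> \<open>The support hypothesis supplies a neighbourhood of the origin on which
      \<open>u\<close> vanishes almost everywhere, hence the radius \<open>r0\<close>.\<close>
    have "0 \<notin> ess_support \<Omega> u" using supp by (auto simp: \<Omega>_def)
    then obtain U where U: "open U" "0 \<in> U" "AE q in lebesgue. q \<in> U \<inter> \<Omega> \<longrightarrow> u q = 0"
      unfolding ess_support_def by blast
    obtain r0 where r0: "r0 > 0" "gauge_ball \<gamma> r0 \<subseteq> U"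
      by (rule gauge_ball_small[OF g U(1,2)])
    have near: "AE p in lebesgue. rho \<gamma> p < r0 \<longrightarrow> u0 p = 0"
      using U(3) by eventually_elim (use r0(2) in \<open>auto simp: u0_def gauge_ball_def indicator_def\<close>)
    interpret grushin_limit \<gamma> R r0 u0 V0 F0 f S
    proof (rule grushin_limit.intro)
      show "S n \<subseteq> gauge_ball \<gamma> R" for n using f(2)[of n] by (auto simp: \<Omega>_def)
      show "sq_integrable lebesgue u0" "sq_integrable lebesgue (V0 i)" for i
        unfolding u0_def V0_def by (intro sq_integrable_L2_on L2)+
    qed (use g R r0 f near sqF in \<open>auto simp: u0_def V0_def F0_def \<Omega>\<close>)
    let ?k = "\<lambda>p. rho \<gamma> p powr (- 2 * \<alpha>) * (F0 p)\<^sup>2 * inverse (psi \<gamma> p)"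
    let ?K = "\<integral>\<^sup>+ p \<in> gauge_ball \<gamma> R.
            ennreal (rho \<gamma> p powr (- 2 * \<alpha>) * (grushin_op W p)\<^sup>2 * inverse (psi \<gamma> p)) \<partial>lebesgue"
    have k0: "0 \<le> ?k p" for p by (simp add: psi_nonneg)
    have K: "?K = (\<integral>\<^sup>+ p. ennreal (?k p) \<partial>lebesgue)"
      by (rule nn_integral_cong_AE, use AE_neq_0 in eventually_elim)
         (auto simp: F0_def \<Omega> gauge_ball_def indicator_def)
    show ?thesis
    \<comment> \<open>An infinite right-hand side makes the inequality trivial because its constant
      factor is positive; otherwise finiteness provides the integrability assumption of
      \<open>grushin_carleman\<close>.\<close>
    proof (cases "?K = \<infinity>")
      case True
      then show ?thesis using C R by (simp add: ennreal_mult_top)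
    next
      case False
      have m: "?k \<in> borel_measurable lebesgue" by measurable
      have int: "integrable lebesgue ?k"
        using False k0 m unfolding K by (intro integrableI_nonneg) (auto simp: less_top)
      interpret grushin_carleman \<gamma> R r0 u0 V0 F0 f S \<alpha> "\<alpha> + 2 - hom_dim CARD('m) CARD('k) \<gamma> / 2"
        by unfold_locales (use \<alpha> int in auto)
      have pp: "(rho \<gamma> p powr x)\<^sup>2 = rho \<gamma> p powr (2 * x)" for x and p :: "('m, 'k) point"
        by (simp add: power2_eq_square powr_add[symmetric])
      have 1: "(\<integral>\<^sup>+ p \<in> gauge_ball \<gamma> R.
            ennreal (rho \<gamma> p powr (- 2 * \<alpha> - 4 + \<epsilon>) * (u p)\<^sup>2 * psi \<gamma> p) \<partial>lebesgue)
          = ennreal ((l2norm lebesgue (\<lambda>p. rho \<gamma> p powr (\<epsilon> / 2) * w p))\<^sup>2)"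
        unfolding ennreal_l2norm_power2[OF sq_w_power]
      proof (rule nn_integral_cong_AE)
        have "(rho \<gamma> p powr (\<epsilon> / 2) * w p)\<^sup>2 = rho \<gamma> p powr (- 2 * \<alpha> - 4 + \<epsilon>) * (u0 p)\<^sup>2 * psi \<gamma> p" for p
        proof -
          have "(rho \<gamma> p powr (\<epsilon> / 2) * w p)\<^sup>2 = (rho \<gamma> p powr \<epsilon> * rho \<gamma> p powr (2 * (- \<alpha> - 2))) * (u0 p)\<^sup>2 * psi \<gamma> p"
            unfolding w_def power_mult_distrib pp by (simp add: psi_nonneg)
          also have "rho \<gamma> p powr \<epsilon> * rho \<gamma> p powr (2 * (- \<alpha> - 2)) = rho \<gamma> p powr (- 2 * \<alpha> - 4 + \<epsilon>)"
            unfolding rho_powr_mult by (rule arg_cong[where f = "\<lambda>x. rho \<gamma> p powr x"]) simp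
          finally show ?thesis .
        qed
        then show "AE p in lebesgue. ennreal (rho \<gamma> p powr (- 2 * \<alpha> - 4 + \<epsilon>) * (u p)\<^sup>2 * psi \<gamma> p)
             * indicator (gauge_ball \<gamma> R) p = ennreal ((rho \<gamma> p powr (\<epsilon> / 2) * w p)\<^sup>2)"
          using AE_neq_0 by (auto elim!: eventually_mono simp: u0_def \<Omega> gauge_ball_def indicator_def)
      qed
      have 2: "(\<integral>\<^sup>+ p \<in> gauge_ball \<gamma> R.
            ennreal (rho \<gamma> p powr (- 2 * \<alpha> - 2 + \<epsilon>) * sq_length V p) \<partial>lebesgue)
          = ennreal (\<Sum>i\<in>UNIV. (l2norm lebesgue (\<lambda>p. rho \<gamma> p powr (\<epsilon> / 2) * \<xi> i p))\<^sup>2)"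
      proof (subst nn_integral_sum_l2norm[symmetric])
        have "(\<Sum>i\<in>UNIV. (rho \<gamma> p powr (\<epsilon> / 2) * \<xi> i p)\<^sup>2) = rho \<gamma> p powr (- 2 * \<alpha> - 2 + \<epsilon>) * sq_length V0 p" for p
        proof -
          have "(\<Sum>i\<in>UNIV. (rho \<gamma> p powr (\<epsilon> / 2) * \<xi> i p)\<^sup>2)
              = (rho \<gamma> p powr \<epsilon> * rho \<gamma> p powr (2 * (- \<alpha> - 1))) * sq_length V0 p"
            unfolding \<xi>_def power_mult_distrib pp sq_length_def sum_distrib_left by (simp add: mult.assoc)
          also have "rho \<gamma> p powr \<epsilon> * rho \<gamma> p powr (2 * (- \<alpha> - 1)) = rho \<gamma> p powr (- 2 * \<alpha> - 2 + \<epsilon>)"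
            unfolding rho_powr_mult by (rule arg_cong[where f = "\<lambda>x. rho \<gamma> p powr x"]) simp
          finally show ?thesis .
        qed
        then show "(\<integral>\<^sup>+ p \<in> gauge_ball \<gamma> R.
            ennreal (rho \<gamma> p powr (- 2 * \<alpha> - 2 + \<epsilon>) * sq_length V p) \<partial>lebesgue)
          = (\<integral>\<^sup>+ p. ennreal (\<Sum>i\<in>UNIV. (rho \<gamma> p powr (\<epsilon> / 2) * \<xi> i p)\<^sup>2) \<partial>lebesgue)"
          by (intro nn_integral_cong_AE, use AE_neq_0 in eventually_elim)
             (auto simp: V0_def \<Omega> gauge_ball_def indicator_def sq_length_def)
      qed (auto intro: sq_\<xi>_power)
      have 3: "?K = ennreal ((l2norm lebesgue G)\<^sup>2)"
        unfolding K ennreal_l2norm_power2[OF sq_G] G_power2 ..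
      show ?thesis
        unfolding 1 2 3 using Carleman_bound[OF assms] C
        by (simp add: ennreal_mult[symmetric] ennreal_plus[symmetric] sum_nonneg C_def[symmetric] del: ennreal_plus)
    qed
  qed
  show ?thesis
    by (rule exI[of _ C]) (use C main in auto)
qed

end
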